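(* Let $n\ge 1$, let $\Omega=\{(t,y)\in\mathbb{R}\times\mathbb{R}^n : 0<t<1,\ |y|<1\}$, and let $u,v$ be real-valued functions that are $C^\infty$ on the closure $\overline{\Omega}$, with $u\ge v$ in $\Omega$. Assume: (i) $u>0$, $v>0$ and $u_t>0$ in $\Omega$; (ii) $u(0,y)=0$ for $|y|<1$; (iii) whenever $0<t\le s<1$, $|y|<1$ and $u(t,y)=v(s,y)$, one has $\Delta u(t,y)\le \Delta v(s,y)$; (iv) $u_t(0,0)=0$; (v) $t\mapsto u(t,0)$ and $t\mapsto v(t,0)$ vanish at $t=0$ of finite order; (vi) $\nabla_y u_{tt}(0,0)=0$. Let $k$ be the smallest integer $i\geq 1$ with $\partial_t^i u(0,0)\ne 0$. If $k=2$ or $k=3$, then $u\equiv v$ in $\Omega$.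
   Context: Here $\Delta=\partial_t^2+\sum_{i=1}^n\partial_{y_i}^2$ is the full Laplacian in the variables $(t,y)$ (for $v$, evaluated at the point $(s,y)$), and $\nabla_y$ is the gradient in $y$. "Vanishes at $t=0$ of finite order" means that some $t$-derivative at $t=0$ is nonzero. *)

theory Defs
  imports "HOL-Analysis.Analysis"
begin

definition Cyl :: "(real \<times> (real ^ 'n)) set" where
  "Cyl = {(t, y). 0 < t \<and> t < 1 \<and> norm y < 1}"

text \<open>
  Derivative of \<open>f\<close> at \<open>x\<close> in direction \<open>b\<close>, relative to the set \<open>S\<close>. It depends only on the
  values of \<open>f\<close> on \<open>S\<close>. In the interior of \<open>S\<close> it is the usual directional derivative; at a
  boundary point it is the one-sided one. We use it for \<open>S = closure Cyl\<close>, which is convex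
  with nonempty interior, so that the Frechet derivative within \<open>S\<close> is unique at each of
  its points, including the points with \<open>t = 0\<close>.
\<close>

definition dderiv :: "'a::real_normed_vector set \<Rightarrow> 'a \<Rightarrow> ('a \<Rightarrow> real) \<Rightarrow> 'a \<Rightarrow> real" where
  "dderiv S b f x = frechet_derivative f (at x within S) b"

text \<open>
  All iterated partial derivatives exist and are (Frechet) differentiable relative to \<open>S\<close>, hence
  continuous on \<open>S\<close>. For \<open>S\<close> the closure of a bounded convex open set this says that \<open>f\<close> is
  smooth in the interior and all its derivatives extend continuously to \<open>S\<close>.
\<close>

definition smooth_on_set :: "'a::euclidean_space set \<Rightarrow> ('a \<Rightarrow> real) \<Rightarrow> bool" where
  "smooth_on_set S f \<longleftrightarrow>
     (\<forall>bs. set bs \<subseteq> Basis \<longrightarrow> foldr (dderiv S) bs f differentiable_on S)"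

definition Dt :: "(real \<times> (real ^ 'n) \<Rightarrow> real) \<Rightarrow> real \<times> (real ^ 'n) \<Rightarrow> real" where
  "Dt = dderiv (closure Cyl) (1, 0)"

definition Dy :: "'n \<Rightarrow> (real \<times> (real ^ 'n) \<Rightarrow> real) \<Rightarrow> real \<times> (real ^ 'n) \<Rightarrow> real" where
  "Dy i = dderiv (closure Cyl) (0, axis i 1)"

definition grad_y :: "(real \<times> (real ^ 'n) \<Rightarrow> real) \<Rightarrow> real \<times> (real ^ 'n) \<Rightarrow> real ^ 'n" where
  "grad_y f x = (\<chi> i. Dy i f x)"

definition laplacian :: "(real \<times> (real ^ 'n) \<Rightarrow> real) \<Rightarrow> real \<times> (real ^ 'n) \<Rightarrow> real" where
  "laplacian f x = Dt (Dt f) x + (\<Sum>i\<in>UNIV. Dy i (Dy i f) x)"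

end

theory Submission
  imports Defs
begin

text \<open>
  Writing \<open>v (s, y) = u (\<tau> (s, y), y)\<close>, the function \<open>s - \<tau> \<ge> 0\<close> satisfies an elliptic
  differential inequality whose coefficients degenerate only where \<open>u\<^sub>t = 0\<close>. By the strong
  maximum principle either \<open>u = v\<close> everywhere or \<open>v < u\<close> in the cylinder. In the second case a
  Hopf barrier at the origin survives the degeneracy: for \<open>k = 2\<close> because \<open>u\<^sub>t\<^sub>t > 0\<close> there, for
  \<open>k = 3\<close> because \<open>u\<^sub>t\<^sub>t\<close> is at least a multiple of \<open>t\<close> on a narrow paraboloid and, by Euler's
  identity, the term \<open>y \<bullet> grad u\<^sub>t\<close> is at most \<open>2 u\<^sub>t\<close> up to higher order. It yields
  \<open>v (s, 0) \<le> u ((1 - \<epsilon>) s, 0)\<close> for small \<open>s\<close>. On the other hand the inequality between the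
  Laplacians forces the leading \<open>t\<close>-coefficient of \<open>v\<close> at the origin to be at least that of \<open>u\<close>.
  For \<open>k = 2\<close> this follows by letting \<open>s\<close> tend to \<open>0\<close>; for \<open>k = 3\<close> one also has to bound the
  \<open>y\<close>-Laplacian of \<open>v\<close> on the axis, and the finite order of \<open>v\<close> enters.
\<close>

section \<open>Iterated directional derivatives\<close>

text \<open>The height \<open>\<tau>\<close> is never differentiated, nor shown to be continuous:
  \<open>Dt u\<close> vanishes at the origin, so the implicit function theorem fails just where it
  is wanted. Contact between graphs replaces it. A contact puts \<open>u\<close> and
  \<open>v\<close> over the same \<open>y\<close> and on the same level, the only situation in which
  the Laplacians can be compared. All displacements are quadratic polynomials, so their expansions
  along coordinate lines are exact.

  Hopf's classical argument wins by a large multiple of the transversal derivative. Here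
  \<open>Dt u\<close> has no positive lower bound near the origin, so the sign must come from
  \<open>Dt (Dt u)\<close>. For \<open>k = 3\<close> that vanishes at the origin too; since its
  \<open>y\<close>-gradient also vanishes there, it is a multiple of \<open>t\<close> up to
  quadratic terms.

  For \<open>k = 3\<close> the inequality between the Laplacians reads \<open>0 \<le> 0\<close> in
  the limit at the origin, so it must be used at positive \<open>s\<close>, to first order in
  \<open>t\<close>. There it controls only the full Laplacian of \<open>v\<close>, and the
  \<open>y\<close>-part could a priori absorb all of it.\<close>

lemma smooth_on_set_dderiv:
  assumes "smooth_on_set S f" "b \<in> Basis"
  shows "smooth_on_set S (dderiv S b f)"
  unfolding smooth_on_set_def
proof (intro allI impI)
  fix bs :: "'a list"
  assume "set bs \<subseteq> Basis"
  then show "foldr (dderiv S) bs (dderiv S b f) differentiable_on S"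
    using assms(1)[unfolded smooth_on_set_def, rule_format, of "bs @ [b]"] assms(2) by simp
qed

lemma smooth_on_set_differentiable_on: "smooth_on_set S f \<Longrightarrow> f differentiable_on S"
  unfolding smooth_on_set_def by (metis empty_set empty_subsetI foldr_Nil id_apply)

lemma smooth_on_set_continuous_on: "smooth_on_set S f \<Longrightarrow> continuous_on S f"
  by (simp add: differentiable_imp_continuous_on smooth_on_set_differentiable_on)

lemma has_derivative_dderiv:
  fixes f :: "'a::euclidean_space \<Rightarrow> real"
  assumes "f differentiable_on S" "x \<in> S"
  shows "(f has_derivative (\<lambda>h. \<Sum>b\<in>Basis. (h \<bullet> b) * dderiv S b f x)) (at x within S)"
proof -
  let ?F = "frechet_derivative f (at x within S)"
  have "(f has_derivative ?F) (at x within S)"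
    using assms by (simp add: differentiable_on_def frechet_derivative_works)
  moreover have "?F = (\<lambda>h. \<Sum>b\<in>Basis. (h \<bullet> b) * dderiv S b f x)"
  proof (rule ext)
    fix h
    have lin: "linear ?F"
      using assms by (simp add: differentiable_on_def linear_frechet_derivative)
    have "?F h = ?F (\<Sum>b\<in>Basis. (h \<bullet> b) *\<^sub>R b)" by (simp add: euclidean_representation)
    also have "\<dots> = (\<Sum>b\<in>Basis. (h \<bullet> b) * dderiv S b f x)"
      by (simp add: linear_sum[OF lin] linear_cmul[OF lin] dderiv_def)
    finally show "?F h = (\<Sum>b\<in>Basis. (h \<bullet> b) * dderiv S b f x)" .
  qed
  ultimately show ?thesis by (rule has_derivative_eq_rhs)
qed

lemma dderiv_cong:
  assumes "\<And>y. y \<in> S \<Longrightarrow> f y = g y" "x \<in> S"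
  shows "dderiv S b f x = dderiv S b g x"
proof -
  have "(f has_derivative F) (at x within S) \<longleftrightarrow> (g has_derivative F) (at x within S)" for F
    using has_derivative_transform[of x S g f F] has_derivative_transform[of x S f g F] assms by auto
  then show ?thesis by (simp add: dderiv_def frechet_derivative_def)
qed

lemma DERIV_along_basis:
  fixes f :: "'a::euclidean_space \<Rightarrow> real"
  assumes "f differentiable_on S" "b \<in> Basis" "x + r *\<^sub>R b \<in> interior S"
  shows "((\<lambda>r. f (x + r *\<^sub>R b)) has_real_derivative dderiv S b f (x + r *\<^sub>R b)) (at r)"
proof -
  let ?p = "x + r *\<^sub>R b"
  have "(f has_derivative (\<lambda>h. \<Sum>c\<in>Basis. (h \<bullet> c) * dderiv S c f ?p)) (at ?p within S)"
    using assms interior_subset by (intro has_derivative_dderiv) auto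
  then have f: "(f has_derivative (\<lambda>h. \<Sum>c\<in>Basis. (h \<bullet> c) * dderiv S c f ?p)) (at ?p)"
    by (simp only: at_within_interior[OF assms(3)])
  have "((\<lambda>r. x + r *\<^sub>R b) has_derivative (\<lambda>h. h *\<^sub>R b)) (at r)"
    by (auto intro!: derivative_eq_intros)
  from has_derivative_compose[OF this f]
  have "((\<lambda>r. f (x + r *\<^sub>R b)) has_derivative (\<lambda>h. \<Sum>c\<in>Basis. (h *\<^sub>R b \<bullet> c) * dderiv S c f ?p)) (at r)" .
  moreover have "(\<Sum>c\<in>Basis. (h *\<^sub>R b \<bullet> c) * dderiv S c f ?p) = dderiv S b f ?p * h" for h
  proof -
    have "(\<Sum>c\<in>Basis. (h *\<^sub>R b \<bullet> c) * dderiv S c f ?p)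
        = (\<Sum>c\<in>Basis. if c = b then h * dderiv S c f ?p else 0)"
      using assms(2) by (intro sum.cong) (auto simp: inner_Basis)
    then show ?thesis using assms(2) by simp
  qed
  ultimately show ?thesis by (simp add: has_field_derivative_def mult_commute_abs)
qed

text \<open>The mean value theorem is applied in direction \<open>b\<close> and then in direction
  \<open>c\<close>. The left side is symmetric in \<open>b\<close> and \<open>c\<close>, which makes
  the mixed derivatives agree as \<open>h\<close> shrinks.\<close>

lemma second_difference_mvt:
  fixes f :: "'a::euclidean_space \<Rightarrow> real"
  assumes f: "smooth_on_set S f" and bc: "b \<in> Basis" "c \<in> Basis" and "h > 0"
    and sub: "cball x (2 * h) \<subseteq> interior S"
  shows "\<exists>p\<in>cball x (2 * h).
    f (x + h *\<^sub>R b + h *\<^sub>R c) - f (x + h *\<^sub>R b) - f (x + h *\<^sub>R c) + f x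
      = h * h * dderiv S c (dderiv S b f) p"
proof -
  have mem: "x + r *\<^sub>R b + s *\<^sub>R c \<in> cball x (2 * h)" if "0 \<le> r" "r \<le> h" "0 \<le> s" "s \<le> h" for r s
  proof -
    have "norm (r *\<^sub>R b + s *\<^sub>R c) \<le> norm (r *\<^sub>R b) + norm (s *\<^sub>R c)" by (rule norm_triangle_ineq)
    also have "\<dots> \<le> 2 * h" using that bc by simp
    finally have "norm (- (r *\<^sub>R b + s *\<^sub>R c)) \<le> 2 * h" by (simp only: norm_minus_cancel)
    moreover have "x - (x + r *\<^sub>R b + s *\<^sub>R c) = - (r *\<^sub>R b + s *\<^sub>R c)" by simp
    ultimately show ?thesis by (simp only: mem_cball dist_norm)
  qed
  have memi: "x + r *\<^sub>R b + s *\<^sub>R c \<in> interior S" if "0 \<le> r" "r \<le> h" "0 \<le> s" "s \<le> h" for r s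
    using mem[OF that] sub by auto
  have df: "f differentiable_on S" "dderiv S b f differentiable_on S"
    using f bc by (auto intro: smooth_on_set_differentiable_on smooth_on_set_dderiv)
  define F where "F r = f (x + r *\<^sub>R b + h *\<^sub>R c) - f (x + r *\<^sub>R b)" for r
  have "(F has_real_derivative
      (dderiv S b f (x + r *\<^sub>R b + h *\<^sub>R c) - dderiv S b f (x + r *\<^sub>R b))) (at r)"
    if r: "0 \<le> r" "r \<le> h" for r
  proof -
    have "((\<lambda>r. f (x + h *\<^sub>R c + r *\<^sub>R b)) has_real_derivative dderiv S b f (x + h *\<^sub>R c + r *\<^sub>R b)) (at r)"
      using memi[OF r, of h] \<open>h > 0\<close>
      by (intro DERIV_along_basis df bc) (simp_all add: algebra_simps)
    moreover have "((\<lambda>r. f (x + r *\<^sub>R b)) has_real_derivative dderiv S b f (x + r *\<^sub>R b)) (at r)"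
      using memi[OF r, of 0] \<open>h > 0\<close> by (intro DERIV_along_basis df bc) simp_all
    ultimately have "((\<lambda>r. f (x + h *\<^sub>R c + r *\<^sub>R b) - f (x + r *\<^sub>R b)) has_real_derivative
        (dderiv S b f (x + h *\<^sub>R c + r *\<^sub>R b) - dderiv S b f (x + r *\<^sub>R b))) (at r)"
      by (rule DERIV_diff)
    moreover have "x + h *\<^sub>R c + r *\<^sub>R b = x + r *\<^sub>R b + h *\<^sub>R c" for r by (simp add: algebra_simps)
    ultimately show ?thesis by (simp add: F_def[abs_def])
  qed
  from MVT2[OF \<open>h > 0\<close> this] obtain r where r: "0 < r" "r < h"
    and 1: "F h - F 0 = h * (dderiv S b f (x + r *\<^sub>R b + h *\<^sub>R c) - dderiv S b f (x + r *\<^sub>R b))"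
    by auto
  have "((\<lambda>s. dderiv S b f (x + r *\<^sub>R b + s *\<^sub>R c)) has_real_derivative
      dderiv S c (dderiv S b f) (x + r *\<^sub>R b + s *\<^sub>R c)) (at s)"
    if "0 \<le> s" "s \<le> h" for s
    using memi[OF _ _ that, of r] r by (intro DERIV_along_basis df bc) simp_all
  from MVT2[OF \<open>h > 0\<close> this] obtain s where s: "0 < s" "s < h"
    and 2: "dderiv S b f (x + r *\<^sub>R b + h *\<^sub>R c) - dderiv S b f (x + r *\<^sub>R b)
       = h * dderiv S c (dderiv S b f) (x + r *\<^sub>R b + s *\<^sub>R c)"
    by auto
  show ?thesis
    using 1 2 mem[of r s] r s
    by (intro bexI[of _ "x + r *\<^sub>R b + s *\<^sub>R c"]) (auto simp: F_def algebra_simps)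
qed

lemma dderiv_commute_interior:
  fixes f :: "'a::euclidean_space \<Rightarrow> real"
  assumes f: "smooth_on_set S f" and bc: "b \<in> Basis" "c \<in> Basis" and x: "x \<in> interior S"
  shows "dderiv S c (dderiv S b f) x = dderiv S b (dderiv S c f) x"
proof (rule ccontr)
  let ?P = "dderiv S c (dderiv S b f)" and ?Q = "dderiv S b (dderiv S c f)"
  assume neq: "?P x \<noteq> ?Q x"
  define e where "e = \<bar>?P x - ?Q x\<bar> / 2"
  have "e > 0" using neq by (simp add: e_def)
  have cont: "continuous (at x) ?P" "continuous (at x) ?Q"
    using f bc x
    by (auto intro!: continuous_on_interior[OF _ x] smooth_on_set_continuous_on smooth_on_set_dderiv)
  obtain d1 where d1: "d1 > 0" "\<And>y. dist y x < d1 \<Longrightarrow> dist (?P y) (?P x) < e"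
    using cont(1) \<open>e > 0\<close> unfolding continuous_at_eps_delta dist_norm by metis
  obtain d2 where d2: "d2 > 0" "\<And>y. dist y x < d2 \<Longrightarrow> dist (?Q y) (?Q x) < e"
    using cont(2) \<open>e > 0\<close> unfolding continuous_at_eps_delta dist_norm by metis
  obtain d3 where d3: "d3 > 0" "cball x d3 \<subseteq> interior S"
    using x open_contains_cball open_interior by blast
  define h where "h = min d1 (min d2 d3) / 4"
  have h: "h > 0" "2 * h < d1" "2 * h < d2" "2 * h \<le> d3"
    using d1(1) d2(1) d3(1) by (auto simp: h_def)
  have sub: "cball x (2 * h) \<subseteq> interior S" using h(4) d3(2) by auto
  obtain p where p: "p \<in> cball x (2 * h)"
    "f (x + h *\<^sub>R b + h *\<^sub>R c) - f (x + h *\<^sub>R b) - f (x + h *\<^sub>R c) + f x = h * h * ?P p"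
    using second_difference_mvt[OF f bc h(1) sub] by blast
  obtain q where q: "q \<in> cball x (2 * h)"
    "f (x + h *\<^sub>R c + h *\<^sub>R b) - f (x + h *\<^sub>R c) - f (x + h *\<^sub>R b) + f x = h * h * ?Q q"
    using second_difference_mvt[OF f bc(2,1) h(1) sub] by blast
  have eq: "x + h *\<^sub>R c + h *\<^sub>R b = x + h *\<^sub>R b + h *\<^sub>R c" by (simp add: algebra_simps)
  have "h * h * ?P p = h * h * ?Q q" using p(2) q(2) unfolding eq by linarith
  then have "?P p = ?Q q" using h(1) by simp
  moreover have "dist (?P p) (?P x) < e" using p(1) h d1(2) by (simp add: dist_commute)
  moreover have "dist (?Q q) (?Q x) < e" using q(1) h d2(2) by (simp add: dist_commute)
  ultimately show False unfolding e_def dist_real_def by (smt (verit) field_sum_of_halves)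
qed

text \<open>Boundary points, among them those with \<open>t = 0\<close>, are reached by continuity
  of both mixed derivatives; hence the requirement that \<open>S\<close> be the closure of its
  interior.\<close>

lemma dderiv_commute:
  fixes f :: "'a::euclidean_space \<Rightarrow> real"
  assumes f: "smooth_on_set S f" and bc: "b \<in> Basis" "c \<in> Basis"
    and S: "S = closure (interior S)" and x: "x \<in> S"
  shows "dderiv S c (dderiv S b f) x = dderiv S b (dderiv S c f) x"
proof -
  have "continuous_on (closure (interior S)) (\<lambda>x. dderiv S c (dderiv S b f) x - dderiv S b (dderiv S c f) x)"
    by (subst S[symmetric])
      (intro continuous_on_diff smooth_on_set_continuous_on smooth_on_set_dderiv f bc)
  then have "dderiv S c (dderiv S b f) x - dderiv S b (dderiv S c f) x = 0"
  proof (rule continuous_constant_on_closure)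
    show "x \<in> closure (interior S)" by (subst S[symmetric]) (rule x)
  qed (simp add: dderiv_commute_interior[OF f bc])
  then show ?thesis by simp
qed

section \<open>Calculus on the closed cylinder\<close>

lemma Cyl_eq: "Cyl = {0<..<1} \<times> ball 0 (1::real)"
  by (auto simp: Cyl_def)

lemma mem_Cyl: "(t, y) \<in> Cyl \<longleftrightarrow> 0 < t \<and> t < 1 \<and> norm y < 1"
  by (simp add: Cyl_def)

lemma open_Cyl: "open Cyl"
  unfolding Cyl_eq by (intro open_Times) auto

lemma convex_Cyl: "convex Cyl"
  unfolding Cyl_eq by (intro convex_Times) auto

lemma closure_Cyl: "closure Cyl = {0..1} \<times> cball 0 1"
  by (simp add: Cyl_eq closure_Times)

lemma mem_closure_Cyl: "(t, y) \<in> closure Cyl \<longleftrightarrow> 0 \<le> t \<and> t \<le> 1 \<and> norm y \<le> 1"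
  by (simp add: closure_Cyl)

lemma interior_closure_Cyl: "interior (closure Cyl) = Cyl"
  by (simp add: convex_interior_closure[OF convex_Cyl] interior_open[OF open_Cyl])

abbreviation (input) smooth :: "(real \<times> (real ^ 'n) \<Rightarrow> real) \<Rightarrow> bool" where
  "smooth \<equiv> smooth_on_set (closure Cyl)"

lemma Basis_t: "(1, 0) \<in> (Basis :: (real \<times> (real ^ 'n)) set)"
  by (simp add: Basis_prod_def)

lemma Basis_y: "(0, axis i 1) \<in> (Basis :: (real \<times> (real ^ 'n)) set)"
  by (auto simp: Basis_prod_def axis_in_Basis_iff)

lemma smooth_Dt: "smooth f \<Longrightarrow> smooth (Dt f)"
  unfolding Dt_def by (intro smooth_on_set_dderiv Basis_t)

lemma smooth_Dy: "smooth f \<Longrightarrow> smooth (Dy i f)"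
  unfolding Dy_def by (intro smooth_on_set_dderiv Basis_y)

lemma Dt_Dy: "smooth f \<Longrightarrow> x \<in> closure Cyl \<Longrightarrow> Dt (Dy i f) x = Dy i (Dt f) x"
  unfolding Dt_def Dy_def
  by (intro dderiv_commute Basis_t Basis_y) (simp_all add: interior_closure_Cyl)

lemma sum_Basis_cylinder:
  "(\<Sum>b\<in>Basis. F b) = F (1, 0) + (\<Sum>i\<in>UNIV. F (0, axis i 1))"
  for F :: "real \<times> (real ^ 'n) \<Rightarrow> real"
proof -
  have "(Basis :: (real ^ 'n) set) = range (\<lambda>i. axis i 1)"
    unfolding Basis_vec_def by auto
  moreover have "inj (\<lambda>i::'n. axis i (1::real))" by (auto simp: inj_on_def axis_eq_axis)
  ultimately have "(\<Sum>b\<in>(Basis :: (real ^ 'n) set). F (0, b)) = (\<Sum>i\<in>UNIV. F (0, axis i 1))"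
    using sum.reindex[of "\<lambda>i. axis i 1" UNIV "\<lambda>b. F (0, b)"] by (simp add: comp_def)
  moreover have "sum F Basis = (\<Sum>b\<in>Basis. F (b, 0)) + (\<Sum>b\<in>Basis. F (0, b))"
    unfolding Basis_prod_def by (subst sum.union_disjoint) (auto simp: sum.reindex inj_on_def)
  ultimately show ?thesis by simp
qed

lemma inner_grad_y: "w \<bullet> grad_y f x = (\<Sum>i\<in>UNIV. w $ i * Dy i f x)"
  by (simp add: inner_vec_def grad_y_def)

lemma inner_axis_grad_y: "axis i 1 \<bullet> grad_y f x = Dy i f x"
  by (simp add: inner_axis' grad_y_def)

section \<open>Chain rule and mean value theorem on the closed cylinder\<close>

lemma has_derivative_cylinder:
  assumes "smooth f" "x \<in> closure Cyl"
  shows "(f has_derivative (\<lambda>h. fst h * Dt f x + snd h \<bullet> grad_y f x)) (at x within closure Cyl)"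
proof -
  have "(f has_derivative (\<lambda>h. \<Sum>b\<in>Basis. (h \<bullet> b) * dderiv (closure Cyl) b f x)) (at x within closure Cyl)"
    by (intro has_derivative_dderiv smooth_on_set_differentiable_on assms)
  moreover have "(\<Sum>b\<in>Basis. (h \<bullet> b) * dderiv (closure Cyl) b f x) = fst h * Dt f x + snd h \<bullet> grad_y f x" for h
    by (simp add: sum_Basis_cylinder inner_prod_def inner_axis inner_grad_y Dt_def Dy_def)
  ultimately show ?thesis by simp
qed

text \<open>One chain rule for vertical segments, horizontal lines, chords and parabolas: all are
  straight in \<open>y\<close> and arbitrary in \<open>t\<close>. The set \<open>R\<close> keeps the
  derivative one-sided where a curve ends on the boundary.\<close>

lemma DERIV_curve:
  assumes f: "smooth f" and \<alpha>: "(\<alpha> has_real_derivative \<alpha>') (at r within R)"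
    and R: "\<And>q. q \<in> R \<Longrightarrow> (\<alpha> q, y + q *\<^sub>R w) \<in> closure Cyl" and r: "r \<in> R"
  shows "((\<lambda>q. f (\<alpha> q, y + q *\<^sub>R w)) has_real_derivative
      \<alpha>' * Dt f (\<alpha> r, y + r *\<^sub>R w) + w \<bullet> grad_y f (\<alpha> r, y + r *\<^sub>R w)) (at r within R)"
proof -
  let ?p = "\<lambda>q. (\<alpha> q, y + q *\<^sub>R w)"
  have p: "(?p has_derivative (\<lambda>h. (\<alpha>' * h, h *\<^sub>R w))) (at r within R)"
    using \<alpha> unfolding has_field_derivative_def
    by (auto intro!: derivative_eq_intros simp: mult_commute_abs)
  have sub: "?p ` R \<subseteq> closure Cyl" using R by auto
  have "(f has_derivative (\<lambda>h. fst h * Dt f (?p r) + snd h \<bullet> grad_y f (?p r))) (at (?p r) within ?p ` R)"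
    by (rule has_derivative_subset[OF has_derivative_cylinder[OF f R[OF r]] sub])
  from has_derivative_in_compose[OF p this]
  have "((\<lambda>q. f (?p q)) has_derivative
      (\<lambda>h. fst (\<alpha>' * h, h *\<^sub>R w) * Dt f (?p r) + snd (\<alpha>' * h, h *\<^sub>R w) \<bullet> grad_y f (?p r))) (at r within R)" .
  then show ?thesis
    unfolding has_field_derivative_def by (rule has_derivative_eq_rhs) (auto simp: algebra_simps)
qed

lemma DERIV_t:
  assumes "smooth f" "0 < t" "t < 1" "norm y \<le> 1"
  shows "((\<lambda>t. f (t, y)) has_real_derivative Dt f (t, y)) (at t)"
proof -
  have "((\<lambda>q. f (q, y + q *\<^sub>R 0)) has_real_derivative
      1 * Dt f (t, y + t *\<^sub>R 0) + 0 \<bullet> grad_y f (t, y + t *\<^sub>R 0)) (at t within {0<..<1})"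
    using assms by (intro DERIV_curve) (auto simp: mem_closure_Cyl)
  then show ?thesis using assms by (simp add: at_within_open[of t "{0<..<1}"])
qed

lemma DERIV_y:
  assumes "smooth f" "0 \<le> t" "t \<le> 1" "norm (y + r *\<^sub>R w) < 1"
  shows "((\<lambda>r. f (t, y + r *\<^sub>R w)) has_real_derivative w \<bullet> grad_y f (t, y + r *\<^sub>R w)) (at r)"
proof -
  let ?R = "{r. norm (y + r *\<^sub>R w) < 1}"
  have "open ?R" by (intro open_Collect_less continuous_intros)
  moreover have "((\<lambda>q. f (t, y + q *\<^sub>R w)) has_real_derivative
      0 * Dt f (t, y + r *\<^sub>R w) + w \<bullet> grad_y f (t, y + r *\<^sub>R w)) (at r within ?R)"
    using assms by (intro DERIV_curve[where \<alpha> = "\<lambda>_. t"]) (auto simp: mem_closure_Cyl)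
  ultimately show ?thesis using assms by (simp add: at_within_open[of r ?R])
qed

lemma mvt_cylinder:
  assumes f: "smooth f" and a: "a \<in> closure Cyl" and x: "x \<in> closure Cyl"
  shows "\<exists>r. 0 < r \<and> r < 1 \<and> a + r *\<^sub>R (x - a) \<in> closure Cyl \<and>
    f x - f a = fst (x - a) * Dt f (a + r *\<^sub>R (x - a)) + snd (x - a) \<bullet> grad_y f (a + r *\<^sub>R (x - a))"
proof -
  let ?p = "\<lambda>q. (fst a + q * (fst x - fst a), snd a + q *\<^sub>R (snd x - snd a))"
  let ?D = "\<lambda>q. (fst x - fst a) * Dt f (?p q) + (snd x - snd a) \<bullet> grad_y f (?p q)"
  have p: "?p q = a + q *\<^sub>R (x - a)" for q by (simp add: prod_eq_iff)
  have mem: "?p q \<in> closure Cyl" if "0 \<le> q" "q \<le> 1" for q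
  proof -
    have "convex (closure Cyl)" by (intro convex_closure convex_Cyl)
    from convexD_alt[OF this a x that] show ?thesis unfolding p by (simp add: algebra_simps)
  qed
  have der: "((\<lambda>q. f (?p q)) has_derivative (\<lambda>h. ?D q * h)) (at q within {0..1})" if "0 \<le> q" "q \<le> 1" for q
    unfolding has_field_derivative_def[symmetric] using that mem
    by (intro DERIV_curve f) (auto intro!: derivative_eq_intros)
  from mvt_simple[OF zero_less_one der]
  obtain r where "r \<in> {0<..<1}" "f (?p 1) - f (?p 0) = ?D r * (1 - 0)" by auto
  then show ?thesis using mem[of r] unfolding p by (intro exI[of _ r]) auto
qed

section \<open>Expansions at the origin\<close>

lemma finite_uniform_radius:
  assumes "\<And>i::'i::finite. \<exists>d>0::real. \<forall>x. norm x < d \<longrightarrow> P i x"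
  shows "\<exists>d>0. \<forall>i x. norm x < d \<longrightarrow> P i x"
proof -
  obtain d where d: "\<And>i. d i > 0" "\<And>i x. norm x < d i \<Longrightarrow> P i x" using assms by metis
  have "Min (range d) \<le> d i" for i by (intro Min_le) auto
  moreover have "Min (range d) > 0" using d(1) by (subst Min_gr_iff) auto
  ultimately show ?thesis using d(2) by (meson less_le_trans)
qed

lemma zero_mem_closure_Cyl: "(0, 0) \<in> closure Cyl"
  by (simp add: mem_closure_Cyl)

lemma first_order_expansion:
  assumes "smooth f" "e > 0"
  shows "\<exists>d>0. \<forall>x. norm x < d \<longrightarrow> x \<in> closure Cyl \<longrightarrow>
    \<bar>f x - f (0, 0) - (fst x * Dt f (0, 0) + snd x \<bullet> grad_y f (0, 0))\<bar> \<le> e * norm x"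
proof -
  from has_derivative_cylinder[OF assms(1) zero_mem_closure_Cyl]
  obtain d where "d > 0" "\<forall>x\<in>closure Cyl. norm (x - (0, 0)) < d \<longrightarrow>
    norm (f x - f (0, 0) - (fst (x - (0, 0)) * Dt f (0, 0) + snd (x - (0, 0)) \<bullet> grad_y f (0, 0)))
      \<le> e * norm (x - (0, 0))"
    unfolding has_derivative_within_alt using assms(2) by blast
  then show ?thesis by (intro exI[of _ d]) (auto simp flip: zero_prod_def)
qed

lemma abs_inner_snd_le: "\<bar>snd x \<bullet> a\<bar> \<le> norm x * norm a"
  for x :: "real \<times> (real ^ 'n)"
  using norm_snd_le[of "snd x" "fst x"]
  by (intro order_trans[OF Cauchy_Schwarz_ineq2] mult_right_mono) simp_all

lemma abs_fst_le: "\<bar>fst x\<bar> \<le> norm x"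
  for x :: "real \<times> (real ^ 'n)"
  using norm_fst_le[of "fst x" "snd x"] by simp

lemma lipschitz_at_origin:
  assumes f: "smooth f"
  shows "\<exists>C>0. \<exists>d>0. \<forall>x. norm x < d \<longrightarrow> x \<in> closure Cyl \<longrightarrow> \<bar>f x - f (0, 0)\<bar> \<le> C * norm x"
proof -
  obtain d where d: "d > 0" "\<And>x. norm x < d \<Longrightarrow> x \<in> closure Cyl \<Longrightarrow>
    \<bar>f x - f (0, 0) - (fst x * Dt f (0, 0) + snd x \<bullet> grad_y f (0, 0))\<bar> \<le> 1 * norm x"
    using first_order_expansion[OF f, of 1] by auto
  let ?C = "1 + \<bar>Dt f (0, 0)\<bar> + norm (grad_y f (0, 0))"
  have "\<bar>f x - f (0, 0)\<bar> \<le> ?C * norm x" if "norm x < d" "x \<in> closure Cyl" for x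
  proof -
    have "\<bar>fst x * Dt f (0, 0)\<bar> \<le> norm x * \<bar>Dt f (0, 0)\<bar>"
      unfolding abs_mult by (intro mult_right_mono abs_fst_le) simp
    with d(2)[OF that] abs_inner_snd_le[of x "grad_y f (0, 0)"] show ?thesis
      by (simp add: algebra_simps)
  qed
  moreover have "?C > 0" by (smt (verit) norm_ge_zero)
  ultimately show ?thesis using d(1) by blast
qed

lemma second_order_bound:
  assumes f: "smooth f"
  shows "\<exists>C>0. \<exists>d>0. \<forall>x. norm x < d \<longrightarrow> x \<in> closure Cyl \<longrightarrow>
    \<bar>f x - f (0, 0) - (fst x * Dt f (0, 0) + snd x \<bullet> grad_y f (0, 0))\<bar> \<le> C * (norm x)\<^sup>2"
proof -
  obtain C0 d0 where 0: "C0 > 0" "d0 > 0" "\<And>x. norm x < d0 \<Longrightarrow> x \<in> closure Cyl \<Longrightarrow>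
    \<bar>Dt f x - Dt f (0, 0)\<bar> \<le> C0 * norm x"
    using lipschitz_at_origin[OF smooth_Dt[OF f]] by blast
  have "\<exists>C d. C > 0 \<and> d > 0 \<and> (\<forall>x. norm x < d \<longrightarrow> x \<in> closure Cyl \<longrightarrow>
    \<bar>Dy i f x - Dy i f (0, 0)\<bar> \<le> C * norm x)" for i
    using lipschitz_at_origin[OF smooth_Dy[OF f, of i]] by blast
  then obtain C where C: "\<And>i. C i > 0" "\<And>i. \<exists>d>0. \<forall>x. norm x < d \<longrightarrow> x \<in> closure Cyl \<longrightarrow>
    \<bar>Dy i f x - Dy i f (0, 0)\<bar> \<le> C i * norm x" by metis
  have "\<exists>d>0. \<forall>i x. norm x < d \<longrightarrow> x \<in> closure Cyl \<longrightarrow>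
    \<bar>Dy i f x - Dy i f (0, 0)\<bar> \<le> C i * norm x"
    by (rule finite_uniform_radius[OF C(2)])
  then obtain d1 where d1: "d1 > 0" "\<And>i x. norm x < d1 \<Longrightarrow> x \<in> closure Cyl \<Longrightarrow>
    \<bar>Dy i f x - Dy i f (0, 0)\<bar> \<le> C i * norm x" by blast
  let ?C = "C0 + sum C UNIV"
  have "\<bar>f x - f (0, 0) - (fst x * Dt f (0, 0) + snd x \<bullet> grad_y f (0, 0))\<bar> \<le> ?C * (norm x)\<^sup>2"
    if x: "norm x < min d0 d1" "x \<in> closure Cyl" for x
  proof -
    obtain r where r: "0 < r" "r < 1" "r *\<^sub>R x \<in> closure Cyl"
      "f x - f (0, 0) = fst x * Dt f (r *\<^sub>R x) + snd x \<bullet> grad_y f (r *\<^sub>R x)"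
      using mvt_cylinder[OF f zero_mem_closure_Cyl x(2)] by (auto simp flip: zero_prod_def)
    have le: "norm (r *\<^sub>R x) \<le> norm x" using r by (simp add: mult_left_le_one_le)
    have A: "\<bar>Dt f (r *\<^sub>R x) - Dt f (0, 0)\<bar> \<le> C0 * norm x"
      using 0(3)[of "r *\<^sub>R x"] le r(3) x(1) 0(1)
      by (smt (verit) mult_left_mono min_less_iff_conj)
    have "\<bar>Dy i f (r *\<^sub>R x) - Dy i f (0, 0)\<bar> \<le> C i * norm x" for i
      using d1(2)[of "r *\<^sub>R x" i] le r(3) x(1) C(1)[of i]
      by (smt (verit) mult_left_mono min_less_iff_conj)
    then have "norm (grad_y f (r *\<^sub>R x) - grad_y f (0, 0)) \<le> (\<Sum>i\<in>UNIV. C i * norm x)"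
      by (intro order_trans[OF norm_le_l1_cart] sum_mono) (simp add: grad_y_def)
    then have B: "norm (grad_y f (r *\<^sub>R x) - grad_y f (0, 0)) \<le> sum C UNIV * norm x"
      by (simp add: sum_distrib_right)
    have "f x - f (0, 0) - (fst x * Dt f (0, 0) + snd x \<bullet> grad_y f (0, 0))
      = fst x * (Dt f (r *\<^sub>R x) - Dt f (0, 0)) + snd x \<bullet> (grad_y f (r *\<^sub>R x) - grad_y f (0, 0))"
      unfolding r(4) by (simp add: algebra_simps inner_diff_right)
    also have "\<bar>\<dots>\<bar> \<le> norm x * (C0 * norm x) + norm x * (sum C UNIV * norm x)"
    proof (rule order_trans[OF abs_triangle_ineq add_mono])
      show "\<bar>fst x * (Dt f (r *\<^sub>R x) - Dt f (0, 0))\<bar> \<le> norm x * (C0 * norm x)"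
        unfolding abs_mult by (intro mult_mono A abs_fst_le) auto
      show "\<bar>snd x \<bullet> (grad_y f (r *\<^sub>R x) - grad_y f (0, 0))\<bar> \<le> norm x * (sum C UNIV * norm x)"
        by (rule order_trans[OF abs_inner_snd_le]) (intro mult_left_mono B, simp)
    qed
    also have "\<dots> = ?C * (norm x)\<^sup>2" by (simp add: algebra_simps power2_eq_square)
    finally show ?thesis .
  qed
  moreover have "?C > 0" using 0(1) C(1) by (simp add: add_pos_nonneg sum_nonneg less_imp_le)
  moreover have "min d0 d1 > 0" using 0(2) d1(1) by simp
  ultimately show ?thesis by blast
qed

section \<open>One-sided limits and leading coefficients in \<open>t\<close>\<close>

lemma tendsto_t:
  assumes "smooth f" "norm y \<le> 1"
  shows "((\<lambda>t. f (t, y)) \<longlongrightarrow> f (0, y)) (at_right 0)"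
proof -
  have "continuous_on {0..1} (\<lambda>t. f (t, y))"
    by (rule continuous_on_compose2[OF smooth_on_set_continuous_on[OF assms(1)]])
      (use assms(2) in \<open>auto simp: mem_closure_Cyl intro!: continuous_intros\<close>)
  then have "((\<lambda>t. f (t, y)) \<longlongrightarrow> f (0, y)) (at 0 within {0..1})"
    by (simp add: continuous_on_def)
  then show ?thesis by (simp add: at_within_Icc_at_right)
qed

lemma eventually_right_unit: "\<forall>\<^sub>F t in at_right 0. 0 < t \<and> t < (1::real)"
  unfolding eventually_at_right_field by (rule exI[of _ 1]) simp

text \<open>Induction by l'Hospital's rule, passing from \<open>f\<close> to \<open>Dt f\<close>.
  This is how leading coefficients on the axis are read off.\<close>

lemma taylor_limit_t:
  assumes "smooth f" "\<And>j. j < m \<Longrightarrow> (Dt ^^ j) f (0, 0) = 0"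
  shows "((\<lambda>t. f (t, 0) / t ^ m) \<longlongrightarrow> (Dt ^^ m) f (0, 0) / fact m) (at_right 0)"
  using assms
proof (induction m arbitrary: f)
  case 0
  then show ?case using tendsto_t[of f 0] by simp
next
  case (Suc m)
  let ?L = "(Dt ^^ Suc m) f (0, 0) / fact (Suc m)"
  have "((\<lambda>t. Dt f (t, 0) / t ^ m) \<longlongrightarrow> (Dt ^^ m) (Dt f) (0, 0) / fact m) (at_right 0)"
  proof (rule Suc.IH)
    show "(Dt ^^ j) (Dt f) (0, 0) = 0" if "j < m" for j
      using Suc.prems(2)[of "Suc j"] that by (simp only: funpow_Suc_right o_apply)
  qed (simp add: Suc.prems smooth_Dt)
  then have "((\<lambda>t. Dt f (t, 0) / t ^ m) \<longlongrightarrow> (Dt ^^ Suc m) f (0, 0) / fact m) (at_right 0)"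
    by (simp only: funpow_Suc_right o_apply)
  from tendsto_divide[OF this tendsto_const, of "real (Suc m)"]
  have lim: "((\<lambda>t. Dt f (t, 0) / (real (Suc m) * t ^ m)) \<longlongrightarrow> ?L) (at_right 0)"
    by (simp add: mult.commute del: funpow.simps of_nat_Suc)
  show ?case
  proof (rule lhopital_right_0[OF _ _ _ _ _ _ lim])
    show "((\<lambda>t. f (t, 0)) \<longlongrightarrow> 0) (at_right 0)"
      using Suc.prems(2)[of 0] tendsto_t[OF Suc.prems(1), of 0] by simp
    have "((\<lambda>t. t ^ Suc m) \<longlongrightarrow> 0 ^ Suc m) (at_right (0::real))"
      by (intro tendsto_power tendsto_ident_at)
    then show "((\<lambda>t. t ^ Suc m) \<longlongrightarrow> 0) (at_right (0::real))" by simp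
    show "\<forall>\<^sub>F t in at_right 0. t ^ Suc m \<noteq> (0::real)"
      using eventually_right_unit by eventually_elim simp
    show "\<forall>\<^sub>F t in at_right 0. real (Suc m) * t ^ m \<noteq> 0"
      using eventually_right_unit by eventually_elim simp
    show "\<forall>\<^sub>F t in at_right 0. ((\<lambda>t. f (t, 0)) has_real_derivative Dt f (t, 0)) (at t)"
      using eventually_right_unit by eventually_elim (rule DERIV_t[OF Suc.prems(1)], auto)
    show "\<forall>\<^sub>F t in at_right 0. ((\<lambda>t. t ^ Suc m) has_real_derivative real (Suc m) * t ^ m) (at t)"
    proof (intro always_eventually allI)
      show "((\<lambda>t. t ^ Suc m) has_real_derivative real (Suc m) * t ^ m) (at t)" for t
        using DERIV_pow[of "Suc m" t UNIV] by simp
    qed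
  qed
qed

section \<open>Second differences, Euler's identity and the second derivative test\<close>

lemma axis_eq_scaleR: "axis i r = r *\<^sub>R axis i (1::real)"
  by (simp add: axis_def vec_eq_iff)

lemma norm_axis_real: "norm (axis i r) = \<bar>r :: real\<bar>"
  by (subst axis_eq_scaleR) (simp add: norm_axis_1)

text \<open>The function \<open>K\<close> of the proof subtracts \<open>B * r\<^sup>2\<close> from
  the symmetric sum; its derivative is \<open>2 * r\<close> times a value of
  \<open>c * Dy i (Dy i f) - B\<close>, hence nonpositive. With \<open>c = 1\<close> this bounds the
  second difference above, with \<open>c = -1\<close> below.\<close>

lemma second_difference_y_le:
  fixes f :: "real \<times> (real ^ 'n) \<Rightarrow> real"
  assumes f: "smooth f" and t: "0 \<le> t" "t \<le> 1" and \<rho>: "0 \<le> \<rho>" "\<rho> < 1"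
    and B: "\<And>\<xi>. \<bar>\<xi>\<bar> \<le> \<rho> \<Longrightarrow> c * Dy i (Dy i f) (t, axis i \<xi>) \<le> B"
  shows "c * (f (t, axis i \<rho>) + f (t, axis i (- \<rho>)) - 2 * f (t, 0)) \<le> B * \<rho>\<^sup>2"
proof -
  have ax: "0 + r *\<^sub>R axis i (1::real) = axis i r" for r :: real
    by (simp add: axis_eq_scaleR[of i r])
  have D: "((\<lambda>r. g (t, axis i r)) has_real_derivative Dy i g (t, axis i r)) (at r)"
    if "smooth g" "\<bar>r\<bar> < 1" for g r
    using DERIV_y[OF that(1) t, of 0 r "axis i 1"] that(2)
    unfolding ax inner_axis_grad_y norm_axis_real by blast
  have D': "((\<lambda>r. g (t, axis i (- r))) has_real_derivative - Dy i g (t, axis i (- r))) (at r)"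
    if "smooth g" "\<bar>r\<bar> < 1" for g r
  proof -
    have "((\<lambda>r. g (t, axis i (- r))) has_real_derivative Dy i g (t, axis i (- r)) * (- 1)) (at r)"
    proof (rule DERIV_chain2[where f = "\<lambda>r. g (t, axis i r)" and g = uminus])
      show "((\<lambda>r. g (t, axis i r)) has_real_derivative Dy i g (t, axis i (- r))) (at (- r))"
        using that by (intro D) simp_all
      show "(uminus has_real_derivative - 1) (at r)" by (rule DERIV_minus[OF DERIV_ident])
    qed
    then show ?thesis by simp
  qed
  define K where "K r = c * (f (t, axis i r) + f (t, axis i (- r))) - B * r\<^sup>2" for r
  have K': "(K has_real_derivative (c * (Dy i f (t, axis i r) - Dy i f (t, axis i (- r))) - B * (2 * r))) (at r)"
    if "\<bar>r\<bar> < 1" for r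
  proof -
    have "((\<lambda>r. B * r\<^sup>2) has_real_derivative B * (2 * r)) (at r)"
      using DERIV_cmult[OF DERIV_pow[of 2 r UNIV], of B] by simp
    from DERIV_diff[OF DERIV_cmult[OF DERIV_add[OF D[OF f that] D'[OF f that]], of c] this]
    show ?thesis unfolding K_def[abs_def] by simp
  qed
  have neg: "c * (Dy i f (t, axis i r) - Dy i f (t, axis i (- r))) - B * (2 * r) \<le> 0"
    if r: "0 \<le> r" "r \<le> \<rho>" for r
  proof (cases "r = 0")
    case False
    with r have "- r < r" by simp
    have "\<exists>\<xi>. - r < \<xi> \<and> \<xi> < r \<and> Dy i f (t, axis i r) - Dy i f (t, axis i (- r))
        = (r - - r) * Dy i (Dy i f) (t, axis i \<xi>)"
      using r \<rho> by (intro MVT2[OF \<open>- r < r\<close>] D smooth_Dy f) auto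
    then obtain \<xi> where \<xi>: "\<bar>\<xi>\<bar> \<le> r" "Dy i f (t, axis i r) - Dy i f (t, axis i (- r))
        = 2 * r * Dy i (Dy i f) (t, axis i \<xi>)" by force
    have "2 * r * (c * Dy i (Dy i f) (t, axis i \<xi>)) \<le> 2 * r * B"
      using B[of \<xi>] \<xi>(1) r by (intro mult_left_mono) auto
    with \<xi>(2) show ?thesis by (simp add: algebra_simps)
  qed simp
  have "K \<rho> \<le> K 0"
  proof (rule DERIV_nonpos_imp_nonincreasing[OF \<rho>(1)])
    fix r assume r: "0 \<le> r" "r \<le> \<rho>"
    show "\<exists>y. (K has_real_derivative y) (at r) \<and> y \<le> 0"
      using K'[of r] neg[OF r] r \<rho>(2) by auto
  qed
  moreover have "axis i 0 = (0 :: real ^ 'n)" by (simp add: axis_def vec_eq_iff)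
  ultimately show ?thesis by (simp add: K_def algebra_simps)
qed

text \<open>To second order \<open>\<phi>\<close> is \<open>(B y + m * t\<^sup>2) / 2\<close>,
  without mixed term because \<open>grad_y (Dt \<phi>)\<close> vanishes, while
  \<open>y \<bullet> grad_y \<phi>\<close> is \<open>B y\<close>. So the radial derivative in
  \<open>y\<close> is \<open>2 * \<phi> - m * t\<^sup>2\<close> up to the error, and the sign of
  \<open>m\<close> discards the last term. The case of interest is
  \<open>\<phi> = Dt u\<close>.\<close>

lemma euler_inequality:
  fixes \<phi> :: "real \<times> (real ^ 'n) \<Rightarrow> real"
  assumes f: "smooth \<phi>" and zero: "\<phi> (0, 0) = 0" "Dt \<phi> (0, 0) = 0" "grad_y \<phi> (0, 0) = 0"
    "grad_y (Dt \<phi>) (0, 0) = 0" and nonneg: "Dt (Dt \<phi>) (0, 0) \<ge> 0" and "e > 0"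
  shows "\<exists>d>0. \<forall>x. norm x < d \<longrightarrow> x \<in> closure Cyl \<longrightarrow>
    snd x \<bullet> grad_y \<phi> x \<le> 2 * \<phi> x + e * (norm x)\<^sup>2"
proof -
  let ?n = "real CARD('n)"
  \<comment> \<open>The denominator adds up the errors: the mean value step costs
    \<open>?n + 1\<close> units, doubled on clearing the factor one half, and replacing the gradient
    by \<open>B\<close> costs \<open>?n\<close> more.\<close>
  define e1 where "e1 = e / (3 * ?n + 2)"
  have "3 * ?n + 2 > 0" by (simp add: add_nonneg_pos)
  with \<open>e > 0\<close> have e1: "e1 > 0" "(3 * ?n + 2) * e1 = e" by (simp_all add: e1_def)
  define m where "m = Dt (Dt \<phi>) (0, 0)"
  define B where "B y = (\<Sum>i\<in>UNIV. y $ i * (y \<bullet> grad_y (Dy i \<phi>) (0, 0)))" for y :: "real ^ 'n"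
  have Dy0: "Dy i \<phi> (0, 0) = 0" "Dt (Dy i \<phi>) (0, 0) = 0" for i
    using zero(3,4) Dt_Dy[OF f zero_mem_closure_Cyl, of i] by (simp_all add: grad_y_def vec_eq_iff)
  obtain d0 where d0: "d0 > 0" "\<And>x. norm x < d0 \<Longrightarrow> x \<in> closure Cyl \<Longrightarrow>
    \<bar>Dt \<phi> x - fst x * m\<bar> \<le> e1 * norm x"
    using first_order_expansion[OF smooth_Dt[OF f] e1(1)] by (auto simp: zero m_def)
  have "\<exists>d>0. \<forall>i x. norm x < d \<longrightarrow> x \<in> closure Cyl \<longrightarrow>
      \<bar>Dy i \<phi> x - snd x \<bullet> grad_y (Dy i \<phi>) (0, 0)\<bar> \<le> e1 * norm x"
  proof (rule finite_uniform_radius)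
    show "\<exists>d>0. \<forall>x. norm x < d \<longrightarrow> x \<in> closure Cyl \<longrightarrow>
      \<bar>Dy i \<phi> x - snd x \<bullet> grad_y (Dy i \<phi>) (0, 0)\<bar> \<le> e1 * norm x" for i
      using first_order_expansion[OF smooth_Dy[OF f] e1(1)] by (simp add: Dy0)
  qed
  then obtain d1 where d1: "d1 > 0" "\<And>i x. norm x < d1 \<Longrightarrow> x \<in> closure Cyl \<Longrightarrow>
    \<bar>Dy i \<phi> x - snd x \<bullet> grad_y (Dy i \<phi>) (0, 0)\<bar> \<le> e1 * norm x" by blast
  have "snd x \<bullet> grad_y \<phi> x \<le> 2 * \<phi> x + e * (norm x)\<^sup>2"
    if x: "norm x < min d0 d1" "x \<in> closure Cyl" for x
  proof -
    obtain t y where xe: "x = (t, y)" by (cases x)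
    have mem: "r *\<^sub>R x \<in> closure Cyl" if "0 \<le> r" "r \<le> 1" for r
      using x(2) that by (auto simp: xe mem_closure_Cyl mult_left_le_one_le mult_le_one)
    have nr: "norm (r *\<^sub>R x) \<le> norm x" if "0 \<le> r" "r \<le> 1" for r
      using that by (simp add: mult_left_le_one_le)
    have t: "\<bar>t * Dt \<phi> (r *\<^sub>R x) - r * (m * t\<^sup>2)\<bar> \<le> e1 * (norm x)\<^sup>2" if r: "0 \<le> r" "r \<le> 1" for r
    proof -
      have "\<bar>Dt \<phi> (r *\<^sub>R x) - r * t * m\<bar> \<le> e1 * norm (r *\<^sub>R x)"
        using d0(2)[of "r *\<^sub>R x"] mem[OF r] nr[OF r] x(1) by (simp add: xe)
      also have "\<dots> \<le> e1 * norm x" using nr[OF r] e1(1) by (intro mult_left_mono) auto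
      finally have "\<bar>t\<bar> * \<bar>Dt \<phi> (r *\<^sub>R x) - r * t * m\<bar> \<le> norm x * (e1 * norm x)"
        using abs_fst_le[of x] by (intro mult_mono) (auto simp: xe)
      moreover have "t * Dt \<phi> (r *\<^sub>R x) - r * (m * t\<^sup>2) = t * (Dt \<phi> (r *\<^sub>R x) - r * t * m)"
        by (simp add: algebra_simps power2_eq_square)
      ultimately have "\<bar>t * Dt \<phi> (r *\<^sub>R x) - r * (m * t\<^sup>2)\<bar> \<le> norm x * (e1 * norm x)"
        by (simp only: abs_mult)
      then show ?thesis by (simp only: power2_eq_square mult.left_commute)
    qed
    have y: "\<bar>y \<bullet> grad_y \<phi> (r *\<^sub>R x) - r * B y\<bar> \<le> ?n * e1 * (norm x)\<^sup>2" if r: "0 \<le> r" "r \<le> 1" for r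
    proof -
      have le: "\<bar>y $ i * (Dy i \<phi> (r *\<^sub>R x) - r * (y \<bullet> grad_y (Dy i \<phi>) (0, 0)))\<bar> \<le> e1 * (norm x)\<^sup>2" for i
      proof -
        have "\<bar>Dy i \<phi> (r *\<^sub>R x) - r * (y \<bullet> grad_y (Dy i \<phi>) (0, 0))\<bar> \<le> e1 * norm (r *\<^sub>R x)"
          using d1(2)[of "r *\<^sub>R x" i] mem[OF r] nr[OF r] x(1) by (simp add: xe)
        also have "\<dots> \<le> e1 * norm x" using nr[OF r] e1(1) by (intro mult_left_mono) auto
        finally have 1: "\<bar>Dy i \<phi> (r *\<^sub>R x) - r * (y \<bullet> grad_y (Dy i \<phi>) (0, 0))\<bar> \<le> e1 * norm x" .
        have "\<bar>y $ i\<bar> \<le> norm x"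
          using component_le_norm_cart[of y i] norm_snd_le[of y t] by (simp add: xe)
        from mult_mono[OF this 1] show ?thesis
          by (simp only: abs_mult power2_eq_square mult.left_commute) simp
      qed
      have "y \<bullet> grad_y \<phi> (r *\<^sub>R x) - r * B y
          = (\<Sum>i\<in>UNIV. y $ i * (Dy i \<phi> (r *\<^sub>R x) - r * (y \<bullet> grad_y (Dy i \<phi>) (0, 0))))"
        unfolding inner_grad_y[of y \<phi>] B_def
        by (simp add: sum_distrib_left sum_subtractf right_diff_distrib mult.left_commute)
      also have "\<bar>\<dots>\<bar> \<le> (\<Sum>i\<in>(UNIV :: 'n set). e1 * (norm x)\<^sup>2)"
        by (intro order_trans[OF sum_abs] sum_mono le)
      finally show ?thesis by simp
    qed
    \<comment> \<open>Along the ray through \<open>x\<close>, \<open>P\<close> is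
      \<open>\<phi>\<close> minus its quadratic model, so its derivative is the sum of the two
      errors just bounded.\<close>
    define P where "P r = \<phi> (r * t, 0 + r *\<^sub>R y) - r\<^sup>2 / 2 * (B y + m * t\<^sup>2)" for r
    have "(P has_derivative (\<lambda>h. (t * Dt \<phi> (r *\<^sub>R x) + y \<bullet> grad_y \<phi> (r *\<^sub>R x)
        - r * (B y + m * t\<^sup>2)) * h)) (at r within {0..1})" if r: "0 \<le> r" "r \<le> 1" for r
    proof -
      have "((\<lambda>r. \<phi> (r * t, 0 + r *\<^sub>R y)) has_real_derivative
          (t * Dt \<phi> (r * t, 0 + r *\<^sub>R y) + y \<bullet> grad_y \<phi> (r * t, 0 + r *\<^sub>R y))) (at r within {0..1})"
        using r mem by (intro DERIV_curve f) (auto simp: xe intro!: derivative_eq_intros)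
      moreover have "((\<lambda>r. r\<^sup>2 / 2 * (B y + m * t\<^sup>2)) has_real_derivative (r * (B y + m * t\<^sup>2))) (at r within {0..1})"
        by (auto intro!: derivative_eq_intros)
      ultimately show ?thesis
        unfolding has_field_derivative_def[symmetric] P_def[abs_def]
        by (intro DERIV_diff) (simp_all add: xe)
    qed
    from mvt_simple[OF zero_less_one this] obtain r where r: "r \<in> {0<..<1}"
      "P 1 - P 0 = (t * Dt \<phi> (r *\<^sub>R x) + y \<bullet> grad_y \<phi> (r *\<^sub>R x) - r * (B y + m * t\<^sup>2)) * (1 - 0)"
      by auto
    have "P 1 - P 0 = \<phi> x - (B y + m * t\<^sup>2) / 2" by (simp add: P_def xe zero)
    moreover have "r * (B y + m * t\<^sup>2) = r * B y + r * (m * t\<^sup>2)" by (rule distrib_left)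
    moreover have "\<bar>t * Dt \<phi> (r *\<^sub>R x) - r * (m * t\<^sup>2)\<bar> \<le> e1 * (norm x)\<^sup>2"
      "\<bar>y \<bullet> grad_y \<phi> (r *\<^sub>R x) - r * B y\<bar> \<le> ?n * e1 * (norm x)\<^sup>2"
      using t[of r] y[of r] r(1) by auto
    moreover have "P 1 - P 0 = t * Dt \<phi> (r *\<^sub>R x) + y \<bullet> grad_y \<phi> (r *\<^sub>R x) - r * (B y + m * t\<^sup>2)"
      using r(2) by simp
    ultimately have 1: "(B y + m * t\<^sup>2) / 2 - \<phi> x \<le> ?n * e1 * (norm x)\<^sup>2 + e1 * (norm x)\<^sup>2"
      by linarith
    have 2: "y \<bullet> grad_y \<phi> x \<le> B y + ?n * e1 * (norm x)\<^sup>2"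
      using y[of 1] by (simp add: abs_le_iff)
    have 3: "m * t\<^sup>2 \<ge> 0" using nonneg by (simp add: m_def)
    have 4: "e * (norm x)\<^sup>2 = 3 * (?n * e1 * (norm x)\<^sup>2) + 2 * (e1 * (norm x)\<^sup>2)"
      unfolding e1(2)[symmetric] by (simp add: algebra_simps)
    have "g \<le> 2 * p + E" if "(b + M) / 2 - p \<le> N1 + N2" "g \<le> b + N1" "M \<ge> 0" "E = 3 * N1 + 2 * N2"
      for g p E b M N1 N2 :: real using that by argo
    from this[OF 1 2 3 4] show ?thesis by (simp add: xe)
  qed
  moreover have "min d0 d1 > 0" using d0(1) d1(1) by simp
  ultimately show ?thesis by blast
qed

lemma second_derivative_local_min:
  fixes k :: "real \<Rightarrow> real"
  assumes "d > 0" and k': "\<And>r. \<bar>r\<bar> < d \<Longrightarrow> (k has_real_derivative k' r) (at r)"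
    and k'': "(k' has_real_derivative k'') (at 0)" and min: "\<And>r. \<bar>r\<bar> < d \<Longrightarrow> k 0 \<le> k r"
  shows "k'' \<ge> 0"
proof (rule ccontr)
  assume "\<not> k'' \<ge> 0"
  then obtain d' where d': "d' > 0" "\<And>h. 0 < h \<Longrightarrow> h < d' \<Longrightarrow> k' h < k' 0"
    using DERIV_neg_dec_right[OF k''] by auto
  have "k' 0 = 0"
    using DERIV_local_min[OF k'[of 0] \<open>d > 0\<close>] \<open>d > 0\<close> min by auto
  define h where "h = min d d' / 2"
  have h: "0 < h" "h < d" "h < d'" using \<open>d > 0\<close> d'(1) by (auto simp: h_def)
  have "\<exists>z. 0 < z \<and> z < h \<and> k h - k 0 = (h - 0) * k' z"
    using h by (intro MVT2 k') auto
  then obtain z where z: "0 < z" "z < h" "k h - k 0 = h * k' z" by auto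
  have "k' z < 0" using d'(2)[of z] z h \<open>k' 0 = 0\<close> by auto
  then have "k h < k 0" using z(3) h(1) by (smt (verit) mult_pos_neg)
  with min[of h] h show False by auto
qed

section \<open>Comparison by sliding\<close>

text \<open>The coefficient \<open>q\<close> is the curvature of a displaced height. It contributes
  \<open>- 2 * q * Dt f\<close>, the term through which a barrier profits from
  \<open>Dt u > 0\<close>. The curve is vertical for \<open>\<zeta> = 0\<close> and moves in one
  \<open>y\<close>-coordinate for \<open>\<zeta> = 1\<close>.\<close>

lemma second_derivative_curve:
  fixes f :: "real \<times> (real ^ 'n) \<Rightarrow> real" and b q \<zeta> :: real and i :: 'n
  assumes f: "smooth f" and mem: "(\<tau>, y) \<in> Cyl"
  defines "\<gamma> \<equiv> \<lambda>r. (\<tau> + b * r - q * r\<^sup>2, y + r *\<^sub>R (\<zeta> *\<^sub>R axis i 1))"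
  shows "\<exists>d>0. \<exists>k'. (\<forall>r. \<bar>r\<bar> < d \<longrightarrow> \<gamma> r \<in> Cyl \<and> ((\<lambda>r. f (\<gamma> r)) has_real_derivative k' r) (at r))
    \<and> (k' has_real_derivative (b\<^sup>2 * Dt (Dt f) (\<tau>, y) - 2 * q * Dt f (\<tau>, y)
        + 2 * b * \<zeta> * Dy i (Dt f) (\<tau>, y) + \<zeta>\<^sup>2 * Dy i (Dy i f) (\<tau>, y))) (at 0)"
proof -
  let ?R = "{r. \<gamma> r \<in> Cyl}"
  have "open (\<gamma> -` Cyl)"
    unfolding \<gamma>_def by (intro open_vimage open_Cyl continuous_intros)
  then have "open ?R" by (simp add: vimage_def)
  moreover have "0 \<in> ?R" using mem by (simp add: \<gamma>_def)
  ultimately obtain d where d: "d > 0" "ball 0 d \<subseteq> ?R" unfolding open_contains_ball by blast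
  have D: "((\<lambda>r. g (\<gamma> r)) has_real_derivative
      (b - 2 * q * r) * Dt g (\<gamma> r) + \<zeta> * Dy i g (\<gamma> r)) (at r)"
    if g: "smooth g" and r: "r \<in> ?R" for g r
  proof -
    have "((\<lambda>r. \<tau> + b * r - q * r\<^sup>2) has_real_derivative (b - 2 * q * r)) (at r within ?R)"
      by (auto intro!: derivative_eq_intros)
    from DERIV_curve[OF g this _ r, of y "\<zeta> *\<^sub>R axis i 1"]
    have "((\<lambda>r. g (\<gamma> r)) has_real_derivative
      (b - 2 * q * r) * Dt g (\<gamma> r) + (\<zeta> *\<^sub>R axis i 1) \<bullet> grad_y g (\<gamma> r)) (at r within ?R)"
      unfolding \<gamma>_def using closure_subset by blast
    then show ?thesis
      using r \<open>open ?R\<close> by (simp add: at_within_open[OF r \<open>open ?R\<close>] inner_axis_grad_y)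
  qed
  let ?k' = "\<lambda>r. (b - 2 * q * r) * Dt f (\<gamma> r) + \<zeta> * Dy i f (\<gamma> r)"
  have 0: "0 \<in> ?R" by fact
  have lin: "((\<lambda>r. b - 2 * q * r) has_real_derivative - (2 * q)) (at 0)"
    by (auto intro!: derivative_eq_intros)
  have \<gamma>0: "\<gamma> 0 = (\<tau>, y)" by (simp add: \<gamma>_def)
  have Dyt: "Dt (Dy i f) (\<tau>, y) = Dy i (Dt f) (\<tau>, y)"
    using closure_subset mem by (intro Dt_Dy f) blast
  from DERIV_add[OF DERIV_mult[OF lin D[OF smooth_Dt[OF f] 0]] DERIV_cmult[OF D[OF smooth_Dy[OF f, of i] 0], of \<zeta>]]
  have "(?k' has_real_derivative (b\<^sup>2 * Dt (Dt f) (\<tau>, y) - 2 * q * Dt f (\<tau>, y)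
        + 2 * b * \<zeta> * Dy i (Dt f) (\<tau>, y) + \<zeta>\<^sup>2 * Dy i (Dy i f) (\<tau>, y))) (at 0)"
    by (simp add: \<gamma>0 Dyt algebra_simps power2_eq_square)
  then show ?thesis using d D[OF f] by (intro exI[of _ d] conjI exI[of _ ?k']) (auto simp: subset_iff)
qed

text \<open>The second derivative test for the difference along paired curves. They share the
  \<open>y\<close>-component but run at different heights, so \<open>f\<close> and \<open>g\<close>
  are compared at different points.\<close>

lemma second_derivative_touching:
  fixes f g :: "real \<times> (real ^ 'n) \<Rightarrow> real"
  assumes f: "smooth f" and g: "smooth g" and mem: "(\<tau>, y) \<in> Cyl" "(s, y) \<in> Cyl"
    and eq: "f (\<tau>, y) = g (s, y)" and "d > 0"
    and le: "\<And>r. \<bar>r\<bar> < d \<Longrightarrow> g (s + a * r, y + r *\<^sub>R (\<zeta> *\<^sub>R axis i 1))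
        \<le> f (\<tau> + b * r - q * r\<^sup>2, y + r *\<^sub>R (\<zeta> *\<^sub>R axis i 1))"
  shows "a\<^sup>2 * Dt (Dt g) (s, y) + 2 * a * \<zeta> * Dy i (Dt g) (s, y) + \<zeta>\<^sup>2 * Dy i (Dy i g) (s, y)
    \<le> b\<^sup>2 * Dt (Dt f) (\<tau>, y) - 2 * q * Dt f (\<tau>, y)
        + 2 * b * \<zeta> * Dy i (Dt f) (\<tau>, y) + \<zeta>\<^sup>2 * Dy i (Dy i f) (\<tau>, y)"
proof -
  let ?w = "\<zeta> *\<^sub>R axis i (1::real)"
  obtain d1 f' where f': "d1 > 0"
    "\<And>r. \<bar>r\<bar> < d1 \<Longrightarrow> ((\<lambda>r. f (\<tau> + b * r - q * r\<^sup>2, y + r *\<^sub>R ?w)) has_real_derivative f' r) (at r)"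
    "(f' has_real_derivative (b\<^sup>2 * Dt (Dt f) (\<tau>, y) - 2 * q * Dt f (\<tau>, y)
        + 2 * b * \<zeta> * Dy i (Dt f) (\<tau>, y) + \<zeta>\<^sup>2 * Dy i (Dy i f) (\<tau>, y))) (at 0)"
    using second_derivative_curve[OF f mem(1), of b q \<zeta> i] by blast
  obtain d2 g' where g': "d2 > 0"
    "\<And>r. \<bar>r\<bar> < d2 \<Longrightarrow> ((\<lambda>r. g (s + a * r - 0 * r\<^sup>2, y + r *\<^sub>R ?w)) has_real_derivative g' r) (at r)"
    "(g' has_real_derivative (a\<^sup>2 * Dt (Dt g) (s, y) - 2 * 0 * Dt g (s, y)
        + 2 * a * \<zeta> * Dy i (Dt g) (s, y) + \<zeta>\<^sup>2 * Dy i (Dy i g) (s, y))) (at 0)"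
    using second_derivative_curve[OF g mem(2), of a 0 \<zeta> i] by blast
  let ?k = "\<lambda>r. f (\<tau> + b * r - q * r\<^sup>2, y + r *\<^sub>R ?w) - g (s + a * r - 0 * r\<^sup>2, y + r *\<^sub>R ?w)"
  have "0 \<le> (b\<^sup>2 * Dt (Dt f) (\<tau>, y) - 2 * q * Dt f (\<tau>, y)
        + 2 * b * \<zeta> * Dy i (Dt f) (\<tau>, y) + \<zeta>\<^sup>2 * Dy i (Dy i f) (\<tau>, y))
      - (a\<^sup>2 * Dt (Dt g) (s, y) - 2 * 0 * Dt g (s, y)
        + 2 * a * \<zeta> * Dy i (Dt g) (s, y) + \<zeta>\<^sup>2 * Dy i (Dy i g) (s, y))"
  proof (rule second_derivative_local_min[of "min d (min d1 d2)" ?k "\<lambda>r. f' r - g' r"])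
    show "(?k has_real_derivative f' r - g' r) (at r)" if "\<bar>r\<bar> < min d (min d1 d2)" for r
      using that by (intro DERIV_diff f' g') auto
    show "?k 0 \<le> ?k r" if "\<bar>r\<bar> < min d (min d1 d2)" for r
      using le[of r] that eq by simp
  qed (use f' g' \<open>d > 0\<close> in \<open>auto intro: DERIV_diff\<close>)
  then show ?thesis by simp
qed

text \<open>Collected here is what holds throughout the cylinder and on its base. Conditions at the
  origin are passed to the individual lemmas, since they differ with the order of contact.\<close>

locale touching =
  fixes u v :: "real \<times> (real ^ 'n) \<Rightarrow> real"
  assumes smooth_u: "smooth u"
    and smooth_v: "smooth v"
    and u_ge_v: "\<And>x. x \<in> Cyl \<Longrightarrow> u x \<ge> v x"
    and v_pos: "\<And>x. x \<in> Cyl \<Longrightarrow> v x > 0"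
    and ut_pos: "\<And>x. x \<in> Cyl \<Longrightarrow> Dt u x > 0"
    and u_zero: "\<And>y. norm y < 1 \<Longrightarrow> u (0, y) = 0"
    and lap_le: "\<And>t s y. 0 < t \<Longrightarrow> t \<le> s \<Longrightarrow> s < 1 \<Longrightarrow> norm y < 1 \<Longrightarrow> u (t, y) = v (s, y)
                   \<Longrightarrow> laplacian u (t, y) \<le> laplacian v (s, y)"
begin

lemma u_continuous: "norm y \<le> 1 \<Longrightarrow> continuous_on {0..1} (\<lambda>t. u (t, y))"
  by (rule continuous_on_compose2[OF smooth_on_set_continuous_on[OF smooth_u]])
    (auto simp: mem_closure_Cyl intro!: continuous_intros)

lemma u_strict_mono:
  assumes "0 \<le> a" "a < b" "b < 1" "norm y < 1"
  shows "u (a, y) < u (b, y)"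
proof (rule DERIV_pos_imp_increasing_open[OF assms(2)])
  show "\<exists>l. ((\<lambda>t. u (t, y)) has_real_derivative l) (at t) \<and> 0 < l" if "a < t" "t < b" for t
    using DERIV_t[OF smooth_u, of t y] ut_pos[of "(t, y)"] that assms by (force simp: mem_Cyl)
  show "continuous_on {a..b} (\<lambda>t. u (t, y))"
    using assms by (intro continuous_on_subset[OF u_continuous]) auto
qed

lemma u_mono: "0 \<le> a \<Longrightarrow> a \<le> b \<Longrightarrow> b < 1 \<Longrightarrow> norm y < 1 \<Longrightarrow> u (a, y) \<le> u (b, y)"
  using u_strict_mono[of a b y] by (cases "a = b") auto

lemma v_zero:
  assumes "norm y < 1"
  shows "v (0, y) = 0"
proof -
  have u0: "((\<lambda>t. u (t, y)) \<longlongrightarrow> 0) (at_right 0)"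
    using tendsto_t[OF smooth_u, of y] u_zero assms by simp
  have "((\<lambda>t. v (t, y)) \<longlongrightarrow> 0) (at_right 0)"
  proof (rule tendsto_sandwich[OF _ _ tendsto_const u0])
    show "\<forall>\<^sub>F t in at_right 0. 0 \<le> v (t, y)"
      using eventually_right_unit
      by eventually_elim (use assms v_pos in \<open>auto simp: mem_Cyl less_imp_le\<close>)
    show "\<forall>\<^sub>F t in at_right 0. v (t, y) \<le> u (t, y)"
      using eventually_right_unit
      by eventually_elim (use assms u_ge_v in \<open>auto simp: mem_Cyl\<close>)
  qed
  moreover have "((\<lambda>t. v (t, y)) \<longlongrightarrow> v (0, y)) (at_right 0)"
    using assms by (intro tendsto_t smooth_v) simp
  ultimately show ?thesis by (intro tendsto_unique[of "at_right (0::real)"]) auto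
qed

lemma v_le_u: "0 \<le> t \<Longrightarrow> t < 1 \<Longrightarrow> norm y < 1 \<Longrightarrow> v (t, y) \<le> u (t, y)"
  using u_ge_v[of "(t, y)"] u_zero v_zero by (cases "t = 0") (auto simp: mem_Cyl)

lemma level_between:
  assumes "0 \<le> a" "a \<le> s" "s < 1" "norm y < 1" "u (a, y) \<le> v (s, y)"
  shows "\<exists>t\<ge>a. t \<le> s \<and> u (t, y) = v (s, y)"
proof -
  have "v (s, y) \<le> u (s, y)" using assms by (intro v_le_u) auto
  moreover have "continuous_on {a..s} (\<lambda>t. u (t, y))"
    using assms by (intro continuous_on_subset[OF u_continuous]) auto
  ultimately show ?thesis using IVT'[of "\<lambda>t. u (t, y)" a "v (s, y)" s] assms by auto
qed

text \<open>This height plays the part of \<open>\<tau>\<close>. It comes from the intermediate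
  value theorem on the vertical segment below \<open>(s, y)\<close>, where \<open>u\<close> runs
  from \<open>0\<close> up to at least \<open>v (s, y)\<close>.\<close>

lemma level_exists:
  assumes "0 < s" "s < 1" "norm y < 1"
  shows "\<exists>t>0. t \<le> s \<and> u (t, y) = v (s, y)"
proof -
  have "v (s, y) > 0" using assms v_pos by (simp add: mem_Cyl)
  then obtain t where "0 \<le> t" "t \<le> s" "u (t, y) = v (s, y)"
    using level_between[of 0 s y] u_zero assms by auto
  moreover have "t \<noteq> 0" using u_zero[OF assms(3)] \<open>u (t, y) = v (s, y)\<close> \<open>v (s, y) > 0\<close> by auto
  ultimately show ?thesis by (intro exI[of _ t]) auto
qed

text \<open>
  The graph of \<open>v\<close> is slid against the graph of \<open>u\<close> displaced by \<open>h - c\<close> in the variable \<open>t\<close>;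
  at the last contact point (the largest \<open>c\<close>) the second derivatives are ordered, which the
  differential inequality in \<open>alt\<close> excludes.
\<close>

lemma comparison:
  fixes D :: "(real \<times> (real ^ 'n)) set" and Pt qt :: _ and Py :: "_ \<Rightarrow> real ^ 'n"
  assumes D: "compact D" and h: "continuous_on UNIV h"
    and dom: "\<And>t y. (t, y) \<in> D \<Longrightarrow> 0 \<le> t \<and> t < 1 \<and> norm y < 1 \<and> 0 \<le> h (t, y) \<and> h (t, y) \<le> t"
    and h_t: "\<And>t y r. h (t + r, y) = h (t, y) + r * Pt (t, y) + r\<^sup>2 * qt"
    and h_y: "\<And>t y r i. h (t, y + r *\<^sub>R axis i 1) = h (t, y) + r * Py (t, y) $ i + r\<^sup>2 * qy i"
    and alt: "\<And>t y. (t, y) \<in> D \<Longrightarrow> v (t, y) \<le> u (t - h (t, y), y) \<or>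
      (t, y) \<in> interior D \<and> (t, y) \<in> Cyl \<and> (\<forall>\<tau>. t - h (t, y) < \<tau> \<and> \<tau> \<le> t \<and> 0 < \<tau> \<longrightarrow>
        0 < Dt u (\<tau>, y) * (2 * (qt + (\<Sum>i\<in>UNIV. qy i)))
          + Dt (Dt u) (\<tau>, y) * (2 * Pt (t, y) - ((Pt (t, y))\<^sup>2 + Py (t, y) \<bullet> Py (t, y)))
          + 2 * (Py (t, y) \<bullet> grad_y (Dt u) (\<tau>, y)))"
    and x: "(t0, y0) \<in> D"
  shows "v (t0, y0) \<le> u (t0 - h (t0, y0), y0)"
proof (rule ccontr)
  assume neg: "\<not> v (t0, y0) \<le> u (t0 - h (t0, y0), y0)"
  \<comment> \<open>The parameter \<open>c\<close> is the amount by which the full displacement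
    \<open>h\<close> is reduced, and \<open>M\<close> collects the reductions at which
    \<open>u\<close> still does not exceed \<open>v\<close>. A violation of the claim yields one
    with \<open>c > 0\<close>, and compactness a largest one.\<close>
  define M1 where "M1 = {p \<in> {0..1} \<times> D. fst p \<le> h (snd p)}"
  define F where "F p = u (fst (snd p) - h (snd p) + fst p, snd (snd p))" for p
  define M where "M = {p \<in> M1. F p \<le> v (snd p)}"
  have conth: "continuous_on A (\<lambda>p. h (snd p))" for A :: "(real \<times> real \<times> (real ^ 'n)) set"
    by (rule continuous_on_compose2[OF h]) (auto intro!: continuous_intros)
  have "compact ({0..1::real} \<times> D)" by (intro compact_Times D) simp
  then have cl: "closed ({0..1::real} \<times> D)" and bd: "bounded ({0..1::real} \<times> D)"
    by (simp_all add: compact_imp_closed compact_imp_bounded)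
  have "closed M1" unfolding M1_def
    by (intro continuous_on_closed_Collect_le cl conth continuous_intros)
  have M1D: "(c, t, y) \<in> M1 \<longleftrightarrow> 0 \<le> c \<and> c \<le> 1 \<and> (t, y) \<in> D \<and> c \<le> h (t, y)" for c t y
    by (auto simp: M1_def)
  have "continuous_on M1 F" unfolding F_def
  proof (rule continuous_on_compose2[OF smooth_on_set_continuous_on[OF smooth_u]])
    show "continuous_on M1 (\<lambda>p. (fst (snd p) - h (snd p) + fst p, snd (snd p)))"
      by (intro continuous_intros conth)
    show "(\<lambda>p. (fst (snd p) - h (snd p) + fst p, snd (snd p))) ` M1 \<subseteq> closure Cyl"
      using dom by (fastforce simp: M1D mem_closure_Cyl)
  qed
  moreover have "continuous_on M1 (\<lambda>p. v (snd p))"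
  proof (rule continuous_on_compose2[OF smooth_on_set_continuous_on[OF smooth_v]])
    show "snd ` M1 \<subseteq> closure Cyl"
      using dom by (fastforce simp: M1D mem_closure_Cyl)
  qed (intro continuous_intros)
  ultimately have "closed M" unfolding M_def
    using \<open>closed M1\<close> by (intro continuous_on_closed_Collect_le)
  moreover have "bounded M" using bd by (rule bounded_subset) (auto simp: M_def M1_def)
  ultimately have "compact M" by (simp add: compact_eq_bounded_closed)
  have M_I: "(c, t, y) \<in> M" if "(t, y) \<in> D" "0 \<le> c" "c \<le> h (t, y)" "u (t - h (t, y) + c, y) \<le> v (t, y)" for c t y
    using that dom[OF that(1)] by (auto simp: M_def M1D F_def)
  note d0 = dom[OF x]
  obtain t1 where t1: "t1 \<ge> t0 - h (t0, y0)" "t1 \<le> t0" "u (t1, y0) = v (t0, y0)"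
    using level_between[of "t0 - h (t0, y0)" t0 y0] d0 neg by auto
  with neg have "t1 \<noteq> t0 - h (t0, y0)" by auto
  with t1 have M0: "(t1 - (t0 - h (t0, y0)), t0, y0) \<in> M" "t1 - (t0 - h (t0, y0)) > 0"
    by (auto intro!: M_I x)
  have "\<exists>p\<in>M. \<forall>q\<in>M. fst q \<le> fst p"
    using M0(1) by (intro continuous_attains_sup[OF \<open>compact M\<close>] continuous_intros) auto
  then obtain p where p: "p \<in> M" "\<And>q. q \<in> M \<Longrightarrow> fst q \<le> fst p" by blast
  obtain c s y where pe: "p = (c, s, y)" by (cases p) auto
  have c: "c > 0" using p(2)[OF M0(1)] M0(2) by (simp add: pe)
  have pM: "(s, y) \<in> D" "c \<le> h (s, y)" "u (s - h (s, y) + c, y) \<le> v (s, y)"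
    using p(1) by (auto simp: pe M_def M1D F_def)
  note ds = dom[OF pM(1)]
  define \<tau> where "\<tau> = s - h (s, y) + c"
  have \<tau>: "s - h (s, y) < \<tau>" "\<tau> \<le> s" "0 < \<tau>" "\<tau> < 1" using ds pM c by (auto simp: \<tau>_def)
  have "u (s - h (s, y), y) < u (\<tau>, y)" using \<tau> ds by (intro u_strict_mono) auto
  with pM(3) have "\<not> v (s, y) \<le> u (s - h (s, y), y)" by (simp add: \<tau>_def)
  with alt[OF pM(1)] \<tau> have int: "(s, y) \<in> interior D" "(s, y) \<in> Cyl" and
    E: "0 < Dt u (\<tau>, y) * (2 * (qt + (\<Sum>i\<in>UNIV. qy i)))
          + Dt (Dt u) (\<tau>, y) * (2 * Pt (s, y) - ((Pt (s, y))\<^sup>2 + Py (s, y) \<bullet> Py (s, y)))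
          + 2 * (Py (s, y) \<bullet> grad_y (Dt u) (\<tau>, y))" by auto
  \<comment> \<open>Maximality of \<open>c\<close> puts the displaced graph of \<open>u\<close>
    above \<open>v\<close>. Where \<open>c \<le> h\<close>, a strict violation would by the
    intermediate value theorem admit a larger \<open>c\<close>; where \<open>c\<close> exceeds
    \<open>h\<close>, the displaced point lies above \<open>(t, z)\<close>, and
    \<open>v \<le> u\<close> with monotonicity suffices.\<close>
  have ge: "v (t, z) \<le> u (t - h (t, z) + c, z)" if tz: "(t, z) \<in> D" "t - h (t, z) + c < 1" for t z
  proof (cases "c \<le> h (t, z)")
    case True
    show ?thesis
    proof (rule ccontr)
      assume less: "\<not> ?thesis"
      obtain t' where t': "t' \<ge> t - h (t, z) + c" "t' \<le> t" "u (t', z) = v (t, z)"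
        using level_between[of "t - h (t, z) + c" t z] dom[OF tz(1)] True c less by auto
      with less have "t' \<noteq> t - h (t, z) + c" by auto
      moreover have "(t' - (t - h (t, z)), t, z) \<in> M" using t' c by (intro M_I tz) auto
      from p(2)[OF this] have "t' - (t - h (t, z)) \<le> c" by (simp add: pe)
      ultimately show False using t' by simp
    qed
  next
    case False
    have "v (t, z) \<le> u (t, z)" using dom[OF tz(1)] by (intro v_le_u) auto
    also have "\<dots> \<le> u (t - h (t, z) + c, z)" using dom[OF tz(1)] tz(2) False by (intro u_mono) auto
    finally show ?thesis .
  qed
  have eq: "u (\<tau>, y) = v (s, y)" using ge[of s y] pM \<tau> by (auto simp: \<tau>_def)
  have lap: "laplacian u (\<tau>, y) \<le> laplacian v (s, y)"
    using \<tau> ds eq by (intro lap_le) auto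
  have mem: "(\<tau>, y) \<in> Cyl" using \<tau> ds by (simp add: mem_Cyl)
  \<comment> \<open>Near the contact point the displaced height stays below \<open>1\<close>, so
    \<open>ge\<close> holds on a full neighbourhood, as the second derivative test requires.\<close>
  define G where "G = interior D \<inter> {x. fst x - h x + c < 1}"
  have "open G" unfolding G_def
    by (intro open_Int open_interior open_Collect_less continuous_intros h)
  moreover have "(s, y) \<in> G" using int(1) \<tau> by (simp add: G_def \<tau>_def)
  ultimately obtain d where d: "d > 0" "ball (s, y) d \<subseteq> G" unfolding open_contains_ball by blast
  have geG: "v (t, z) \<le> u (t - h (t, z) + c, z)" if "(t, z) \<in> ball (s, y) d" for t z
    using that d(2) interior_subset by (intro ge) (auto simp: G_def subset_iff)
  \<comment> \<open>By \<open>h_t\<close> the displaced height along the vertical line is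
    \<open>\<tau> + (1 - Pt) * r - qt * r\<^sup>2\<close>. There is no motion in \<open>y\<close>,
    so the index is immaterial and \<open>undefined\<close> serves.\<close>
  have T: "Dt (Dt v) (s, y) \<le> (1 - Pt (s, y))\<^sup>2 * Dt (Dt u) (\<tau>, y) - 2 * qt * Dt u (\<tau>, y)"
  proof -
    have "1\<^sup>2 * Dt (Dt v) (s, y) + 2 * 1 * 0 * Dy undefined (Dt v) (s, y) + 0\<^sup>2 * Dy undefined (Dy undefined v) (s, y)
      \<le> (1 - Pt (s, y))\<^sup>2 * Dt (Dt u) (\<tau>, y) - 2 * qt * Dt u (\<tau>, y)
        + 2 * (1 - Pt (s, y)) * 0 * Dy undefined (Dt u) (\<tau>, y) + 0\<^sup>2 * Dy undefined (Dy undefined u) (\<tau>, y)"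
    proof (rule second_derivative_touching[OF smooth_u smooth_v mem int(2) eq d(1)])
      fix r :: real assume r: "\<bar>r\<bar> < d"
      then have "(s + r, y) \<in> ball (s, y) d" by (simp add: dist_Pair_Pair dist_real_def)
      from geG[OF this] show "v (s + 1 * r, y + r *\<^sub>R (0 *\<^sub>R axis undefined 1))
        \<le> u (\<tau> + (1 - Pt (s, y)) * r - qt * r\<^sup>2, y + r *\<^sub>R (0 *\<^sub>R axis undefined 1))"
        by (simp add: h_t[where t = s and y = y and r = r] \<tau>_def) (simp add: algebra_simps)
    qed
    then show ?thesis by simp
  qed
  have Y: "Dy i (Dy i v) (s, y) \<le> (Py (s, y) $ i)\<^sup>2 * Dt (Dt u) (\<tau>, y) - 2 * qy i * Dt u (\<tau>, y)
      - 2 * (Py (s, y) $ i * Dy i (Dt u) (\<tau>, y)) + Dy i (Dy i u) (\<tau>, y)" for i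
  proof -
    have "0\<^sup>2 * Dt (Dt v) (s, y) + 2 * 0 * 1 * Dy i (Dt v) (s, y) + 1\<^sup>2 * Dy i (Dy i v) (s, y)
      \<le> (- Py (s, y) $ i)\<^sup>2 * Dt (Dt u) (\<tau>, y) - 2 * qy i * Dt u (\<tau>, y)
        + 2 * (- Py (s, y) $ i) * 1 * Dy i (Dt u) (\<tau>, y) + 1\<^sup>2 * Dy i (Dy i u) (\<tau>, y)"
    proof (rule second_derivative_touching[OF smooth_u smooth_v mem int(2) eq d(1)])
      fix r :: real assume r: "\<bar>r\<bar> < d"
      then have "(s, y + r *\<^sub>R axis i 1) \<in> ball (s, y) d"
        by (simp add: dist_Pair_Pair dist_norm norm_axis_1)
      from geG[OF this] show "v (s + 0 * r, y + r *\<^sub>R (1 *\<^sub>R axis i 1))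
        \<le> u (\<tau> + (- Py (s, y) $ i) * r - qy i * r\<^sup>2, y + r *\<^sub>R (1 *\<^sub>R axis i 1))"
        by (simp add: h_y[where t = s and y = y and r = r and i = i] \<tau>_def) (simp add: algebra_simps)
    qed
    then show ?thesis by simp
  qed
  have "(\<Sum>i\<in>UNIV. Dy i (Dy i v) (s, y)) \<le> (\<Sum>i\<in>UNIV. (Py (s, y) $ i)\<^sup>2 * Dt (Dt u) (\<tau>, y)
      - 2 * qy i * Dt u (\<tau>, y) - 2 * (Py (s, y) $ i * Dy i (Dt u) (\<tau>, y)) + Dy i (Dy i u) (\<tau>, y))"
    by (intro sum_mono Y)
  also have "\<dots> = (Py (s, y) \<bullet> Py (s, y)) * Dt (Dt u) (\<tau>, y) - 2 * (\<Sum>i\<in>UNIV. qy i) * Dt u (\<tau>, y)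
      - 2 * (Py (s, y) \<bullet> grad_y (Dt u) (\<tau>, y)) + (\<Sum>i\<in>UNIV. Dy i (Dy i u) (\<tau>, y))"
    by (simp add: inner_grad_y inner_vec_def[of "Py (s, y)" "Py (s, y)"] sum.distrib sum_subtractf
        sum_distrib_left sum_distrib_right power2_eq_square)
  finally have "laplacian v (s, y) \<le> laplacian u (\<tau>, y)
     - (Dt u (\<tau>, y) * (2 * (qt + (\<Sum>i\<in>UNIV. qy i)))
          + Dt (Dt u) (\<tau>, y) * (2 * Pt (s, y) - ((Pt (s, y))\<^sup>2 + Py (s, y) \<bullet> Py (s, y)))
          + 2 * (Py (s, y) \<bullet> grad_y (Dt u) (\<tau>, y)))"
    using T unfolding laplacian_def by (simp add: algebra_simps power2_eq_square)
  with lap E show False by linarith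
qed

end

section \<open>Hopf barriers and the strong maximum principle\<close>

text \<open>A polynomial stand-in for Hopf's exponential barrier. It vanishes at \<open>z\<close>
  with gradient \<open>\<nu>\<close>; the \<open>N\<close>-term raises the Laplacian by convexity in
  the single direction \<open>\<nu>\<close>; and for \<open>K > 0\<close> the region where it is
  nonnegative meets the hyperplane through \<open>z\<close> orthogonal to \<open>\<nu>\<close> only
  at \<open>z\<close>.\<close>

definition barrier :: "'a::real_inner \<Rightarrow> 'a \<Rightarrow> real \<Rightarrow> real \<Rightarrow> 'a \<Rightarrow> real" where
  "barrier z \<nu> N K x = (x - z) \<bullet> \<nu> + N * ((x - z) \<bullet> \<nu>)\<^sup>2 - K * (norm (x - z))\<^sup>2"

definition barrier_grad :: "'a::real_inner \<Rightarrow> 'a \<Rightarrow> real \<Rightarrow> real \<Rightarrow> 'a \<Rightarrow> 'a" where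
  "barrier_grad z \<nu> N K x = (1 + 2 * N * ((x - z) \<bullet> \<nu>)) *\<^sub>R \<nu> - (2 * K) *\<^sub>R (x - z)"

text \<open>In coordinate directions this exact expansion supplies the conditions \<open>h_t\<close>
  and \<open>h_y\<close> of \<open>comparison\<close>.\<close>

lemma barrier_add:
  "barrier z \<nu> N K (x + r *\<^sub>R b) = barrier z \<nu> N K x + r * (barrier_grad z \<nu> N K x \<bullet> b)
     + r\<^sup>2 * (N * (\<nu> \<bullet> b)\<^sup>2 - K * (b \<bullet> b))"
proof -
  define w where "w = x - z"
  have w: "x + r *\<^sub>R b - z = w + r *\<^sub>R b" by (simp add: w_def)
  have 1: "(w + r *\<^sub>R b) \<bullet> \<nu> = w \<bullet> \<nu> + r * (\<nu> \<bullet> b)"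
    by (simp add: inner_add_left inner_commute[of b \<nu>])
  have 2: "(w + r *\<^sub>R b) \<bullet> (w + r *\<^sub>R b) = w \<bullet> w + 2 * r * (w \<bullet> b) + r\<^sup>2 * (b \<bullet> b)"
    by (simp add: inner_add_left inner_add_right inner_commute[of b w] power2_eq_square algebra_simps)
  have 3: "((1 + 2 * N * (w \<bullet> \<nu>)) *\<^sub>R \<nu> - (2 * K) *\<^sub>R w) \<bullet> b = (1 + 2 * N * (w \<bullet> \<nu>)) * (\<nu> \<bullet> b) - 2 * K * (w \<bullet> b)"
    by (simp add: inner_diff_left)
  show ?thesis
    unfolding barrier_def barrier_grad_def power2_norm_eq_inner w w_def[symmetric] 1 2 3
    by (simp add: algebra_simps power2_eq_square)
qed

lemma continuous_on_barrier: "continuous_on A (barrier z \<nu> N K)"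
  unfolding barrier_def by (intro continuous_intros)

context touching
begin

text \<open>The boundary of the cap \<open>D\<close> has two parts. Where the barrier vanishes there
  is no displacement and \<open>v \<le> u\<close> suffices; on the face at distance
  \<open>\<delta>\<close> the gap \<open>u - v\<close> is bounded below, and a small displacement
  cannot use it up. Elsewhere \<open>sub\<close> is the differential inequality of
  \<open>comparison\<close> divided by \<open>\<epsilon>\<close>. It is required for every
  \<open>\<epsilon> \<le> \<epsilon>0\<close> because the final \<open>\<epsilon>\<close> depends on
  the gap.\<close>

lemma hopf_barrier:
  fixes z \<nu> :: "real \<times> (real ^ 'n)" and N K \<delta> \<epsilon>0 :: real
  defines "D \<equiv> {x. 0 \<le> (x - z) \<bullet> \<nu> \<and> (x - z) \<bullet> \<nu> \<le> \<delta> \<and> 0 \<le> barrier z \<nu> N K x}"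
  assumes \<nu>: "norm \<nu> = 1" and K: "K > 0" and N: "N \<ge> 0" and \<delta>: "\<delta> > 0" and \<epsilon>0: "\<epsilon>0 > 0"
    and z: "0 \<le> fst z" "fst z < 1" "norm (snd z) < 1"
    and D: "\<And>x. x \<in> D \<Longrightarrow> x \<noteq> z \<Longrightarrow> x \<in> Cyl \<and> v x < u x"
    and small: "\<And>x. x \<in> D \<Longrightarrow> \<epsilon>0 * barrier z \<nu> N K x \<le> fst x"
    and sub: "\<And>\<epsilon> t y \<tau>. 0 < \<epsilon> \<Longrightarrow> \<epsilon> \<le> \<epsilon>0 \<Longrightarrow> (t, y) \<in> D \<Longrightarrow> (t, y) \<noteq> z \<Longrightarrow>
      t - \<epsilon> * barrier z \<nu> N K (t, y) \<le> \<tau> \<Longrightarrow> \<tau> \<le> t \<Longrightarrow> 0 < \<tau> \<Longrightarrow>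
      0 < Dt u (\<tau>, y) * (2 * (N - (real CARD('n) + 1) * K))
        + Dt (Dt u) (\<tau>, y) * (2 * fst (barrier_grad z \<nu> N K (t, y)) - \<epsilon> * (norm (barrier_grad z \<nu> N K (t, y)))\<^sup>2)
        + 2 * (snd (barrier_grad z \<nu> N K (t, y)) \<bullet> grad_y (Dt u) (\<tau>, y))"
  shows "\<exists>\<epsilon>>0. \<epsilon> \<le> \<epsilon>0 \<and> (\<forall>t y. (t, y) \<in> D \<longrightarrow> v (t, y) \<le> u (t - \<epsilon> * barrier z \<nu> N K (t, y), y))"
proof -
  let ?b = "barrier z \<nu> N K" and ?G = "barrier_grad z \<nu> N K"
  define B where "B = \<delta> + N * \<delta>\<^sup>2"
  have "B > 0" using \<delta> N by (simp add: B_def add_pos_nonneg)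
  have bB: "?b x \<le> B - K * (norm (x - z))\<^sup>2" if "x \<in> D" for x
  proof -
    have "0 \<le> (x - z) \<bullet> \<nu>" "(x - z) \<bullet> \<nu> \<le> \<delta>" using that by (auto simp: D_def)
    then have "((x - z) \<bullet> \<nu>)\<^sup>2 \<le> \<delta>\<^sup>2" by (intro power_mono)
    from mult_left_mono[OF this N] show ?thesis
      using \<open>(x - z) \<bullet> \<nu> \<le> \<delta>\<close> by (simp add: barrier_def B_def)
  qed
  have bB': "?b x \<le> B" if "x \<in> D" for x
    using bB[OF that] K by (smt (verit) mult_nonneg_nonneg zero_le_power2)
  have "closed D"
  proof -
    have "D = {x. 0 \<le> (x - z) \<bullet> \<nu>} \<inter> {x. (x - z) \<bullet> \<nu> \<le> \<delta>} \<inter> {x. 0 \<le> ?b x}"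
      by (auto simp: D_def)
    then show ?thesis
      by (auto intro!: closed_Int closed_Collect_le continuous_intros continuous_on_barrier)
  qed
  moreover have "bounded D"
  proof (rule bounded_subset[OF bounded_cball[of z "sqrt (B / K)"]], rule subsetI)
    fix x assume "x \<in> D"
    then have "0 \<le> ?b x" by (simp add: D_def)
    with bB[OF \<open>x \<in> D\<close>] have "(norm (x - z))\<^sup>2 \<le> B / K"
      using K by (simp add: field_simps)
    then have "norm (x - z) \<le> sqrt (B / K)" by (rule real_le_rsqrt)
    then show "x \<in> cball z (sqrt (B / K))" by (simp add: dist_norm norm_minus_commute)
  qed
  ultimately have "compact D" by (simp add: compact_eq_bounded_closed)
  have bz: "?b z = 0" by (simp add: barrier_def)
  have Dz: "0 \<le> fst x \<and> fst x < 1 \<and> norm (snd x) < 1 \<and> v x \<le> u x" if "x \<in> D" for x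
  proof (cases "x = z")
    case True
    then show ?thesis using z v_le_u[of "fst z" "snd z"] by simp
  next
    case False
    then show ?thesis using D[OF that] by (cases x) (auto simp: mem_Cyl)
  qed
  have DCC: "D \<subseteq> closure Cyl"
    using Dz by (force simp: mem_closure_Cyl)
  define T where "T = {x \<in> D. \<delta> \<le> (x - z) \<bullet> \<nu>}"
  have "closed T" unfolding T_def
    by (intro continuous_on_closed_Collect_le compact_imp_closed[OF \<open>compact D\<close>] continuous_intros)
  then have "compact (D \<inter> T)" by (intro compact_Int_closed \<open>compact D\<close>)
  moreover have "D \<inter> T = T" by (auto simp: T_def)
  ultimately have "compact T" by simp
  have Tpos: "v x < u x" if "x \<in> T" for x
    using that D[of x] \<delta> by (cases "x = z") (auto simp: T_def)
  obtain c where c: "c > 0" "\<And>x. x \<in> T \<Longrightarrow> c \<le> u x - v x"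
  proof (cases "T = {}")
    case True
    then show ?thesis using that[of 1] by simp
  next
    case False
    have TCC: "T \<subseteq> closure Cyl" using DCC by (auto simp: T_def)
    have "\<exists>x\<in>T. \<forall>y\<in>T. u x - v x \<le> u y - v y"
      by (intro continuous_attains_inf \<open>compact T\<close> False continuous_on_diff
          continuous_on_subset[OF smooth_on_set_continuous_on TCC] smooth_u smooth_v)
    then obtain x where "x \<in> T" "\<And>y. y \<in> T \<Longrightarrow> u x - v x \<le> u y - v y" by blast
    then show ?thesis using that[of "u x - v x"] Tpos by simp
  qed
  have "compact (closure Cyl :: (real \<times> (real ^ 'n)) set)"
    unfolding closure_Cyl by (intro compact_Times) auto
  then have "uniformly_continuous_on (closure Cyl) u"
    by (intro compact_uniformly_continuous smooth_on_set_continuous_on smooth_u)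
  then obtain d where d: "d > 0" "\<And>x x'. x \<in> closure Cyl \<Longrightarrow> x' \<in> closure Cyl \<Longrightarrow> dist x' x < d \<Longrightarrow> dist (u x') (u x) < c"
    unfolding uniformly_continuous_on_def using c(1) by blast
  \<comment> \<open>The second bound keeps the displacement at most \<open>d / 2\<close>, so on
    \<open>T\<close> the value of \<open>u\<close> drops by less than the gap
    \<open>c\<close>.\<close>
  define \<epsilon> where "\<epsilon> = min \<epsilon>0 (d / (2 * B))"
  have \<epsilon>: "\<epsilon> > 0" "\<epsilon> \<le> \<epsilon>0" "\<epsilon> * B < d"
  proof -
    show "\<epsilon> > 0" "\<epsilon> \<le> \<epsilon>0" using \<epsilon>0 d(1) \<open>B > 0\<close> by (auto simp: \<epsilon>_def)
    have "\<epsilon> * B \<le> d / (2 * B) * B" using \<open>B > 0\<close> by (intro mult_right_mono) (auto simp: \<epsilon>_def)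
    also have "\<dots> < d" using \<open>B > 0\<close> d(1) by simp
    finally show "\<epsilon> * B < d" .
  qed
  have \<epsilon>b: "0 \<le> \<epsilon> * ?b x" "\<epsilon> * ?b x \<le> fst x" "\<epsilon> * ?b x \<le> \<epsilon> * B" if "x \<in> D" for x
  proof -
    have "0 \<le> ?b x" using that by (simp add: D_def)
    then show "0 \<le> \<epsilon> * ?b x" using \<epsilon> by simp
    show "\<epsilon> * ?b x \<le> fst x"
      using mult_right_mono[OF \<epsilon>(2) \<open>0 \<le> ?b x\<close>] small[OF that] by linarith
    show "\<epsilon> * ?b x \<le> \<epsilon> * B" using \<epsilon> bB'[OF that] by (intro mult_left_mono) auto
  qed
  have "v (t, y) \<le> u (t - \<epsilon> * ?b (t, y), y)" if x: "(t, y) \<in> D" for t y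
  proof (rule comparison[OF \<open>compact D\<close>, where h = "\<lambda>x. \<epsilon> * ?b x"
        and Pt = "\<lambda>x. \<epsilon> * fst (?G x)" and qt = "\<epsilon> * (N * (fst \<nu>)\<^sup>2 - K)"
        and Py = "\<lambda>x. \<epsilon> *\<^sub>R snd (?G x)" and qy = "\<lambda>i. \<epsilon> * (N * (snd \<nu> $ i)\<^sup>2 - K)"])
    show "(t, y) \<in> D" by (rule x)
    show "continuous_on UNIV (\<lambda>x. \<epsilon> * ?b x)" by (intro continuous_intros continuous_on_barrier)
    show "0 \<le> t \<and> t < 1 \<and> norm y < 1 \<and> 0 \<le> \<epsilon> * ?b (t, y) \<and> \<epsilon> * ?b (t, y) \<le> t" if "(t, y) \<in> D" for t y
      using Dz[OF that] \<epsilon>b[OF that] by simp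
    show "\<epsilon> * ?b (t + r, y) = \<epsilon> * ?b (t, y) + r * (\<epsilon> * fst (?G (t, y))) + r\<^sup>2 * (\<epsilon> * (N * (fst \<nu>)\<^sup>2 - K))" for t y r
    proof -
      have "?b (t + r, y) = ?b (t, y) + r * fst (?G (t, y)) + r\<^sup>2 * (N * (fst \<nu>)\<^sup>2 - K)"
        using barrier_add[of z \<nu> N K "(t, y)" r "(1, 0)"] by (simp add: inner_prod_def)
      then show ?thesis by (simp only:) (simp add: algebra_simps)
    qed
    show "\<epsilon> * ?b (t, y + r *\<^sub>R axis i 1) = \<epsilon> * ?b (t, y) + r * (\<epsilon> *\<^sub>R snd (?G (t, y))) $ i
        + r\<^sup>2 * (\<epsilon> * (N * (snd \<nu> $ i)\<^sup>2 - K))" for t y r i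
    proof -
      have "?b (t, y + r *\<^sub>R axis i 1) = ?b (t, y) + r * snd (?G (t, y)) $ i + r\<^sup>2 * (N * (snd \<nu> $ i)\<^sup>2 - K)"
        using barrier_add[of z \<nu> N K "(t, y)" r "(0, axis i 1)"] by (simp add: inner_prod_def inner_axis)
      then show ?thesis by (simp only:) (simp add: algebra_simps)
    qed
    fix t y assume x: "(t, y) \<in> D"
    let ?l = "((t, y) - z) \<bullet> \<nu>"
    show "v (t, y) \<le> u (t - \<epsilon> * ?b (t, y), y) \<or>
      (t, y) \<in> interior D \<and> (t, y) \<in> Cyl \<and> (\<forall>\<tau>. t - \<epsilon> * ?b (t, y) < \<tau> \<and> \<tau> \<le> t \<and> 0 < \<tau> \<longrightarrow>
        0 < Dt u (\<tau>, y) * (2 * (\<epsilon> * (N * (fst \<nu>)\<^sup>2 - K) + (\<Sum>i\<in>UNIV. \<epsilon> * (N * (snd \<nu> $ i)\<^sup>2 - K))))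
          + Dt (Dt u) (\<tau>, y) * (2 * (\<epsilon> * fst (?G (t, y)))
            - ((\<epsilon> * fst (?G (t, y)))\<^sup>2 + (\<epsilon> *\<^sub>R snd (?G (t, y))) \<bullet> (\<epsilon> *\<^sub>R snd (?G (t, y)))))
          + 2 * ((\<epsilon> *\<^sub>R snd (?G (t, y))) \<bullet> grad_y (Dt u) (\<tau>, y)))"
    proof (cases "?b (t, y) = 0 \<or> \<delta> \<le> ?l")
      case True
      then have "v (t, y) \<le> u (t - \<epsilon> * ?b (t, y), y)"
      proof
        assume "?b (t, y) = 0"
        then show ?thesis using Dz[OF x] by simp
      next
        assume "\<delta> \<le> ?l"
        then have T: "(t, y) \<in> T" using x by (simp add: T_def)
        have "dist (t - \<epsilon> * ?b (t, y), y) (t, y) < d"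
          using \<epsilon>b[OF x] \<epsilon>(3) by (simp add: dist_Pair_Pair dist_real_def)
        moreover have "(t - \<epsilon> * ?b (t, y), y) \<in> closure Cyl"
          using \<epsilon>b[OF x] Dz[OF x] by (simp add: mem_closure_Cyl)
        ultimately have "dist (u (t - \<epsilon> * ?b (t, y), y)) (u (t, y)) < c"
          using x DCC by (intro d(2)) auto
        then show ?thesis using c(2)[OF T] by (simp add: dist_real_def)
      qed
      then show ?thesis ..
    next
      case False
      then have b: "0 < ?b (t, y)" and l1: "?l < \<delta>" using x by (auto simp: D_def)
      then have xz: "(t, y) \<noteq> z" using bz by auto
      have l0: "0 < ?l"
      proof (rule ccontr)
        assume "\<not> 0 < ?l"
        then have "?l = 0" using x by (simp add: D_def)
        then have "?b (t, y) \<le> 0" using K by (simp add: barrier_def)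
        with b show False by simp
      qed
      have "open ({x. 0 < (x - z) \<bullet> \<nu>} \<inter> {x. (x - z) \<bullet> \<nu> < \<delta>} \<inter> {x. 0 < ?b x})"
        by (intro open_Int open_Collect_less continuous_intros continuous_on_barrier)
      then have int: "(t, y) \<in> interior D"
        by (rule interiorI) (use b l0 l1 in \<open>auto simp: D_def\<close>)
      have "0 < Dt u (\<tau>, y) * (2 * (\<epsilon> * (N * (fst \<nu>)\<^sup>2 - K) + (\<Sum>i\<in>UNIV. \<epsilon> * (N * (snd \<nu> $ i)\<^sup>2 - K))))
          + Dt (Dt u) (\<tau>, y) * (2 * (\<epsilon> * fst (?G (t, y)))
            - ((\<epsilon> * fst (?G (t, y)))\<^sup>2 + (\<epsilon> *\<^sub>R snd (?G (t, y))) \<bullet> (\<epsilon> *\<^sub>R snd (?G (t, y)))))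
          + 2 * ((\<epsilon> *\<^sub>R snd (?G (t, y))) \<bullet> grad_y (Dt u) (\<tau>, y))"
        if \<tau>: "t - \<epsilon> * ?b (t, y) < \<tau>" "\<tau> \<le> t" "0 < \<tau>" for \<tau>
      proof -
        \<comment> \<open>As \<open>\<nu>\<close> is a unit vector, the quadratic coefficients in
          the \<open>t\<close>-direction and all \<open>y\<close>-directions add up to
          \<open>\<epsilon> * N\<close> minus one \<open>\<epsilon> * K\<close> per
          direction.\<close>
        have "\<nu> \<bullet> \<nu> = 1" using \<nu> by (simp add: norm_eq_1)
        then have \<nu>2: "(\<Sum>i\<in>UNIV. (snd \<nu> $ i)\<^sup>2) = 1 - (fst \<nu>)\<^sup>2"
          by (simp add: inner_prod_def inner_vec_def power2_eq_square)
        have "(\<Sum>i\<in>UNIV. \<epsilon> * (N * (snd \<nu> $ i)\<^sup>2 - K))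
            = \<epsilon> * (N * (\<Sum>i\<in>UNIV. (snd \<nu> $ i)\<^sup>2) - real CARD('n) * K)"
          by (simp add: sum_subtractf sum_distrib_left right_diff_distrib)
        then have q: "\<epsilon> * (N * (fst \<nu>)\<^sup>2 - K) + (\<Sum>i\<in>UNIV. \<epsilon> * (N * (snd \<nu> $ i)\<^sup>2 - K))
            = \<epsilon> * (N - (real CARD('n) + 1) * K)"
          unfolding \<nu>2 by (simp add: algebra_simps)
        have n: "(norm (?G (t, y)))\<^sup>2 = (fst (?G (t, y)))\<^sup>2 + snd (?G (t, y)) \<bullet> snd (?G (t, y))"
          by (simp only: power2_norm_eq_inner inner_prod_def) (simp add: power2_eq_square)
        have "0 < \<epsilon> * (Dt u (\<tau>, y) * (2 * (N - (real CARD('n) + 1) * K))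
          + Dt (Dt u) (\<tau>, y) * (2 * fst (?G (t, y)) - \<epsilon> * (norm (?G (t, y)))\<^sup>2)
          + 2 * (snd (?G (t, y)) \<bullet> grad_y (Dt u) (\<tau>, y)))"
          using sub[OF \<epsilon>(1,2) x xz _ \<tau>(2,3)] \<tau>(1) \<epsilon>(1) by simp
        then show ?thesis unfolding q n by (simp add: algebra_simps power2_eq_square)
      qed
      then show ?thesis using int D[OF x xz] by blast
    qed
  qed
  with \<epsilon>(1,2) show ?thesis by blast
qed

text \<open>Hopf's lemma at a boundary point of a ball on which \<open>v < u\<close>. Inside the
  cylinder \<open>Dt u\<close> has a positive lower bound near \<open>z\<close>, so the usual large
  \<open>N\<close> works. At \<open>z\<close> the difference \<open>u - v\<close> is minimal, so the
  derivatives along \<open>\<nu>\<close> agree, whereas the barrier would separate them by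
  \<open>\<epsilon> * Dt u z\<close>.\<close>

lemma interior_touching_False:
  assumes zC: "z \<in> Cyl" and ball: "cball x0 R \<subseteq> Cyl" and dist: "dist z x0 = R" and R: "R > 0"
    and less: "\<And>x. x \<in> ball x0 R \<Longrightarrow> v x < u x" and uz: "u z = v z"
  shows False
proof -
  define \<nu> where "\<nu> = (1 / R) *\<^sub>R (x0 - z)"
  have \<nu>: "norm \<nu> = 1" "x0 - z = R *\<^sub>R \<nu>"
    using R dist by (simp_all add: \<nu>_def dist_norm norm_minus_commute)
  \<comment> \<open>Let \<open>l\<close> be the distance of \<open>x\<close> from the tangent
    hyperplane. With \<open>N * l \<le> 1\<close>, nonnegativity of the barrier gives
    \<open>K * (norm (x - z))\<^sup>2 \<le> 2 * l\<close>, that is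
    \<open>(norm (x - z))\<^sup>2 \<le> R * l\<close>. The ball is described by the bound
    \<open>2 * R * l\<close>, so the cap without \<open>z\<close> lies strictly inside.\<close>
  define K where "K = 2 / R"
  have K: "K > 0" using R by (simp add: K_def)
  obtain r where r: "r > 0" "cball z r \<subseteq> Cyl" using open_contains_cball zC open_Cyl by blast
  have CC: "cball z r \<subseteq> closure Cyl" using r(2) closure_subset by blast
  have cont: "continuous_on (cball z r) f" if "smooth f" for f
    by (rule continuous_on_subset[OF smooth_on_set_continuous_on[OF that] CC])
  have "\<exists>x\<in>cball z r. \<forall>y\<in>cball z r. Dt u x \<le> Dt u y"
    using r(1) by (intro continuous_attains_inf cont smooth_Dt smooth_u) auto
  then obtain c0 where c0: "c0 > 0" "\<And>x. x \<in> cball z r \<Longrightarrow> c0 \<le> Dt u x"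
    using r(2) ut_pos by blast
  have "continuous_on (cball z r) (\<lambda>x. \<bar>Dt (Dt u) x\<bar> + norm (grad_y (Dt u) x))"
    unfolding grad_y_def
    by (intro continuous_intros continuous_on_vec_lambda cont smooth_Dt smooth_Dy smooth_u)
  then have "\<exists>x\<in>cball z r. \<forall>y\<in>cball z r. \<bar>Dt (Dt u) y\<bar> + norm (grad_y (Dt u) y)
      \<le> \<bar>Dt (Dt u) x\<bar> + norm (grad_y (Dt u) x)"
    using r(1) by (intro continuous_attains_sup) auto
  then obtain C where C: "\<And>x. x \<in> cball z r \<Longrightarrow> \<bar>Dt (Dt u) x\<bar> + norm (grad_y (Dt u) x) \<le> C"
    by blast
  have C_bounds: "\<bar>Dt (Dt u) x\<bar> \<le> C" "norm (grad_y (Dt u) x) \<le> C" if "x \<in> cball z r" for x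
    using C[OF that] by (smt (verit) norm_ge_zero)+
  have "C \<ge> 0" using C_bounds(1)[of z] r(1) by (smt (verit) centre_in_cball)
  \<comment> \<open>\<open>\<Gamma>\<close> bounds the barrier gradient, its
    \<open>\<nu>\<close>-part by \<open>3\<close> since \<open>N * l \<le> 1\<close>. Next,
    \<open>A\<close> bounds all terms free of \<open>Dt u\<close>, and \<open>N\<close> makes the
    term with \<open>Dt u\<close> at least \<open>2 * (A + 1)\<close>.\<close>
  define \<Gamma> where "\<Gamma> = 3 + 2 * K * r"
  have \<Gamma>: "\<Gamma> > 0" using K r(1) by (simp add: \<Gamma>_def add_pos_pos)
  let ?n1 = "real CARD('n) + 1"
  define A where "A = C * (2 * \<Gamma> + \<Gamma>\<^sup>2) + 2 * (\<Gamma> * C)"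
  have "A \<ge> 0" using \<open>C \<ge> 0\<close> \<Gamma> by (simp add: A_def)
  define N where "N = ?n1 * K + (A + 1) / c0"
  have "?n1 * K \<ge> K" using K by (simp add: algebra_simps)
  then have NK: "N \<ge> K" using \<open>A \<ge> 0\<close> c0(1) by (simp add: N_def add_increasing2)
  have N: "c0 * (2 * (N - ?n1 * K)) > A" "N \<ge> 0"
    using c0(1) \<open>A \<ge> 0\<close> NK K by (simp_all add: N_def)
  \<comment> \<open>The first bound ensures \<open>N * l \<le> 1\<close>; the second keeps the cap
    within \<open>r / 2\<close> of \<open>z\<close>. The other half of the radius is left for the
    displacement, through \<open>\<epsilon>0\<close>.\<close>
  define \<delta> where "\<delta> = min (1 / (N + 1)) ((r / 2)\<^sup>2 / R)"
  have \<delta>: "\<delta> > 0" "N * \<delta> \<le> 1" "R * \<delta> \<le> (r / 2)\<^sup>2"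
  proof -
    show "\<delta> > 0" using N(2) r(1) R by (auto simp: \<delta>_def)
    have "N * \<delta> \<le> N * (1 / (N + 1))" using N(2) by (intro mult_left_mono) (auto simp: \<delta>_def)
    also have "\<dots> \<le> 1" using N(2) by (simp add: field_simps)
    finally show "N * \<delta> \<le> 1" .
    have "R * \<delta> \<le> R * ((r / 2)\<^sup>2 / R)" using R by (intro mult_left_mono) (auto simp: \<delta>_def)
    then show "R * \<delta> \<le> (r / 2)\<^sup>2" using R by simp
  qed
  define \<epsilon>0 where "\<epsilon>0 = min 1 (r / (4 * \<delta>))"
  have \<epsilon>0: "\<epsilon>0 > 0" "\<epsilon>0 \<le> 1" "\<epsilon>0 * (2 * \<delta>) \<le> r / 2"
  proof -
    show "\<epsilon>0 > 0" "\<epsilon>0 \<le> 1" using r(1) \<delta>(1) by (auto simp: \<epsilon>0_def)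
    have "\<epsilon>0 * (2 * \<delta>) \<le> r / (4 * \<delta>) * (2 * \<delta>)" using \<delta>(1) by (intro mult_right_mono) (auto simp: \<epsilon>0_def)
    then show "\<epsilon>0 * (2 * \<delta>) \<le> r / 2" using \<delta>(1) by simp
  qed
  let ?b = "barrier z \<nu> N K" and ?G = "barrier_grad z \<nu> N K"
  let ?D = "{x. 0 \<le> (x - z) \<bullet> \<nu> \<and> (x - z) \<bullet> \<nu> \<le> \<delta> \<and> 0 \<le> ?b x}"
  have Nl: "N * ((x - z) \<bullet> \<nu>) \<le> 1" if "x \<in> ?D" for x
    using mult_left_mono[of "(x - z) \<bullet> \<nu>" \<delta> N] that N(2) \<delta>(2) by auto
  have b_le: "?b x + K * (norm (x - z))\<^sup>2 \<le> 2 * ((x - z) \<bullet> \<nu>)" if "x \<in> ?D" for x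
  proof -
    have "N * ((x - z) \<bullet> \<nu>) * ((x - z) \<bullet> \<nu>) \<le> 1 * ((x - z) \<bullet> \<nu>)"
      using Nl[OF that] that by (intro mult_right_mono) auto
    then show ?thesis by (simp add: barrier_def power2_eq_square algebra_simps)
  qed
  have sq: "(norm (x - z))\<^sup>2 \<le> R * ((x - z) \<bullet> \<nu>)" if "x \<in> ?D" for x
  proof -
    have "K * (norm (x - z))\<^sup>2 \<le> 2 * ((x - z) \<bullet> \<nu>)" using b_le[OF that] that by auto
    then show ?thesis using R by (simp add: K_def field_simps)
  qed
  have near: "norm (x - z) \<le> r / 2" if "x \<in> ?D" for x
  proof -
    have "R * ((x - z) \<bullet> \<nu>) \<le> R * \<delta>" using that R by (intro mult_left_mono) auto
    with sq[OF that] \<delta>(3) have "(norm (x - z))\<^sup>2 \<le> (r / 2)\<^sup>2" by linarith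
    then show ?thesis using r(1) by (simp add: power2_le_iff_abs_le)
  qed
  have b2: "0 \<le> ?b x" "?b x \<le> 2 * \<delta>" if "x \<in> ?D" for x
  proof -
    show "0 \<le> ?b x" using that by simp
    have "0 \<le> K * (norm (x - z))\<^sup>2" using K by simp
    with b_le[OF that] that show "?b x \<le> 2 * \<delta>" by auto
  qed
  have shift: "(\<tau>, y) \<in> cball z r" if x: "(t, y) \<in> ?D" and \<tau>: "t - \<epsilon> * ?b (t, y) \<le> \<tau>" "\<tau> \<le> t" "0 \<le> \<epsilon>" "\<epsilon> \<le> \<epsilon>0" for \<epsilon> t y \<tau>
  proof -
    have "\<epsilon> * ?b (t, y) \<le> \<epsilon>0 * (2 * \<delta>)" using b2[OF x] \<tau> by (intro mult_mono) auto
    then have "\<bar>t - \<tau>\<bar> \<le> r / 2" using \<epsilon>0(3) \<tau> by linarith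
    then have "dist (t, y) (\<tau>, y) \<le> r / 2" by (simp add: dist_Pair_Pair dist_real_def)
    moreover have "dist z (t, y) \<le> r / 2" using near[OF x] by (simp add: dist_norm norm_minus_commute)
    ultimately show ?thesis using dist_triangle[of z "(\<tau>, y)" "(t, y)"] by simp
  qed
  have "\<exists>\<epsilon>>0. \<epsilon> \<le> \<epsilon>0 \<and> (\<forall>t y. (t, y) \<in> ?D \<longrightarrow> v (t, y) \<le> u (t - \<epsilon> * ?b (t, y), y))"
  proof (rule hopf_barrier[OF \<nu>(1) K N(2) \<delta>(1) \<epsilon>0(1)])
    show "0 \<le> fst z" "fst z < 1" "norm (snd z) < 1"
      using zC by (cases z; simp add: mem_Cyl)+
    show "x \<in> Cyl \<and> v x < u x" if x: "x \<in> ?D" "x \<noteq> z" for x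
    proof -
      have "0 < (norm (x - z))\<^sup>2" using x(2) by simp
      with sq[OF x(1)] have l: "0 < R * ((x - z) \<bullet> \<nu>)" by linarith
      have xx0: "x - x0 = (x - z) - R *\<^sub>R \<nu>" using \<nu>(2) by (simp add: algebra_simps)
      have norm_diff: "(norm (w - R *\<^sub>R \<nu>))\<^sup>2 = (norm w)\<^sup>2 - 2 * (R * (w \<bullet> \<nu>)) + R\<^sup>2 * (\<nu> \<bullet> \<nu>)" for w
        unfolding power2_norm_eq_inner
        by (simp add: inner_diff_left inner_diff_right inner_commute[of \<nu> w] power2_eq_square algebra_simps)
      have "(norm (x - x0))\<^sup>2 = (norm (x - z))\<^sup>2 - 2 * (R * ((x - z) \<bullet> \<nu>)) + R\<^sup>2 * (\<nu> \<bullet> \<nu>)"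
        unfolding xx0 norm_diff ..
      also have "\<nu> \<bullet> \<nu> = 1" using \<nu>(1) by (simp add: norm_eq_1)
      finally have "(norm (x - x0))\<^sup>2 < R\<^sup>2" using sq[OF x(1)] l by simp
      then have "norm (x - x0) < R" using R by (simp add: power2_less_imp_less)
      then have "x \<in> ball x0 R" by (simp add: dist_norm norm_minus_commute)
      then show ?thesis using less ball by auto
    qed
    show "\<epsilon>0 * ?b x \<le> fst x" if "x \<in> ?D" for x
    proof -
      obtain t y where xe: "x = (t, y)" by (cases x)
      have "\<epsilon>0 * ?b x \<ge> 0" using b2[OF that] \<epsilon>0 by simp
      then have "(t - \<epsilon>0 * ?b (t, y), y) \<in> Cyl"
        using shift[of t y \<epsilon>0 "t - \<epsilon>0 * ?b (t, y)"] that \<epsilon>0(1) r(2) by (auto simp: xe)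
      then show ?thesis by (simp add: xe mem_Cyl)
    qed
    fix \<epsilon> t y \<tau>
    assume \<epsilon>: "0 < \<epsilon>" "\<epsilon> \<le> \<epsilon>0" and x: "(t, y) \<in> ?D"
      and \<tau>: "t - \<epsilon> * ?b (t, y) \<le> \<tau>" "\<tau> \<le> t"
    have mem: "(\<tau>, y) \<in> cball z r" using shift[OF x \<tau>] \<epsilon> by simp
    define G where "G = ?G (t, y)"
    let ?l = "((t, y) - z) \<bullet> \<nu>"
    have "norm G \<le> norm ((1 + 2 * N * ?l) *\<^sub>R \<nu>) + norm ((2 * K) *\<^sub>R ((t, y) - z))"
      unfolding G_def barrier_grad_def by (rule norm_triangle_ineq4)
    also have "\<dots> \<le> 3 + 2 * K * r"
    proof (rule add_mono)
      have "0 \<le> N * ?l" using N(2) x by simp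
      then show "norm ((1 + 2 * N * ?l) *\<^sub>R \<nu>) \<le> 3" using Nl[OF x] \<nu>(1) by simp
      show "norm ((2 * K) *\<^sub>R ((t, y) - z)) \<le> 2 * K * r"
        using near[OF x] K r(1) by simp
    qed
    finally have G: "norm G \<le> \<Gamma>" by (simp add: \<Gamma>_def)
    have "\<bar>2 * fst G - \<epsilon> * (norm G)\<^sup>2\<bar> \<le> 2 * \<Gamma> + \<Gamma>\<^sup>2"
    proof -
      have "\<bar>fst G\<bar> \<le> \<Gamma>" using abs_fst_le[of G] G by linarith
      moreover have "\<epsilon> * (norm G)\<^sup>2 \<le> 1 * \<Gamma>\<^sup>2"
        using \<epsilon> \<epsilon>0(2) G by (intro mult_mono power_mono) auto
      moreover have "0 \<le> \<epsilon> * (norm G)\<^sup>2" using \<epsilon> by simp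
      ultimately show ?thesis by argo
    qed
    then have "\<bar>Dt (Dt u) (\<tau>, y) * (2 * fst G - \<epsilon> * (norm G)\<^sup>2)\<bar> \<le> C * (2 * \<Gamma> + \<Gamma>\<^sup>2)"
      unfolding abs_mult using C_bounds[OF mem] \<open>C \<ge> 0\<close> by (intro mult_mono) auto
    moreover have "\<bar>snd G \<bullet> grad_y (Dt u) (\<tau>, y)\<bar> \<le> \<Gamma> * C"
      using C_bounds(2)[OF mem] G \<Gamma>
      by (intro order_trans[OF abs_inner_snd_le] mult_mono) auto
    moreover have "c0 * (2 * (N - ?n1 * K)) \<le> Dt u (\<tau>, y) * (2 * (N - ?n1 * K))"
    proof (rule mult_right_mono[OF c0(2)[OF mem]])
      show "0 \<le> 2 * (N - ?n1 * K)" using \<open>A \<ge> 0\<close> c0(1) by (simp add: N_def)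
    qed
    ultimately have "0 < Dt u (\<tau>, y) * (2 * (N - ?n1 * K))
        + Dt (Dt u) (\<tau>, y) * (2 * fst G - \<epsilon> * (norm G)\<^sup>2) + 2 * (snd G \<bullet> grad_y (Dt u) (\<tau>, y))"
      using N(1) unfolding A_def by linarith
    then show "0 < Dt u (\<tau>, y) * (2 * (N - ?n1 * K))
        + Dt (Dt u) (\<tau>, y) * (2 * fst (?G (t, y)) - \<epsilon> * (norm (?G (t, y)))\<^sup>2)
        + 2 * (snd (?G (t, y)) \<bullet> grad_y (Dt u) (\<tau>, y))" by (simp add: G_def)
  qed
  then obtain \<epsilon> where \<epsilon>: "\<epsilon> > 0" "\<epsilon> \<le> \<epsilon>0"
    "\<And>t y. (t, y) \<in> ?D \<Longrightarrow> v (t, y) \<le> u (t - \<epsilon> * ?b (t, y), y)" by blast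
  obtain tz yz where ze: "z = (tz, yz)" by (cases z)
  obtain nt ny where ne: "\<nu> = (nt, ny)" by (cases \<nu>)
  have D: "((\<lambda>\<sigma>. f (tz + a * \<sigma>, yz + \<sigma> *\<^sub>R ny)) has_real_derivative a * Dt f z + ny \<bullet> grad_y f z) (at 0)"
    if f: "smooth f" for f a
  proof -
    let ?R = "(\<lambda>\<sigma>. (tz + a * \<sigma>, yz + \<sigma> *\<^sub>R ny)) -` Cyl"
    have "open ?R" by (intro open_vimage open_Cyl continuous_intros)
    have 0: "0 \<in> ?R" using zC by (simp add: ze)
    have "((\<lambda>\<sigma>. tz + a * \<sigma>) has_real_derivative a) (at 0 within ?R)"
      by (auto intro!: derivative_eq_intros)
    from DERIV_curve[OF f this _ 0, of yz ny] closure_subset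
    have "((\<lambda>\<sigma>. f (tz + a * \<sigma>, yz + \<sigma> *\<^sub>R ny)) has_real_derivative a * Dt f z + ny \<bullet> grad_y f z) (at 0 within ?R)"
      by (auto simp: ze)
    then show ?thesis by (simp add: at_within_open[OF 0 \<open>open ?R\<close>])
  qed
  have same: "nt * Dt u z + ny \<bullet> grad_y u z = nt * Dt v z + ny \<bullet> grad_y v z"
  proof -
    have "((\<lambda>\<sigma>. u (tz + nt * \<sigma>, yz + \<sigma> *\<^sub>R ny) - v (tz + nt * \<sigma>, yz + \<sigma> *\<^sub>R ny)) has_real_derivative
      (nt * Dt u z + ny \<bullet> grad_y u z) - (nt * Dt v z + ny \<bullet> grad_y v z)) (at 0)"
      by (intro DERIV_diff D smooth_u smooth_v)
    moreover have "\<forall>\<sigma>. \<bar>0 - \<sigma>\<bar> < r \<longrightarrow> u (tz + nt * 0, yz + 0 *\<^sub>R ny) - v (tz + nt * 0, yz + 0 *\<^sub>R ny)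
      \<le> u (tz + nt * \<sigma>, yz + \<sigma> *\<^sub>R ny) - v (tz + nt * \<sigma>, yz + \<sigma> *\<^sub>R ny)"
    proof (intro allI impI)
      fix \<sigma> :: real assume "\<bar>0 - \<sigma>\<bar> < r"
      then have "norm (\<sigma> *\<^sub>R \<nu>) < r" using \<nu>(1) by simp
      then have "z + \<sigma> *\<^sub>R \<nu> \<in> cball z r" by (simp add: dist_norm)
      then have "(tz + nt * \<sigma>, yz + \<sigma> *\<^sub>R ny) \<in> Cyl" using r(2) by (auto simp: ze ne mult.commute)
      from u_ge_v[OF this] uz
      show "u (tz + nt * 0, yz + 0 *\<^sub>R ny) - v (tz + nt * 0, yz + 0 *\<^sub>R ny)
        \<le> u (tz + nt * \<sigma>, yz + \<sigma> *\<^sub>R ny) - v (tz + nt * \<sigma>, yz + \<sigma> *\<^sub>R ny)" by (simp add: ze)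
    qed
    ultimately have "(nt * Dt u z + ny \<bullet> grad_y u z) - (nt * Dt v z + ny \<bullet> grad_y v z) = 0"
      by (rule DERIV_local_min[OF _ r(1)])
    then show ?thesis by simp
  qed
  \<comment> \<open>\<open>?F\<close> moves along \<open>\<nu>\<close> while the height in
    \<open>u\<close> is lowered at rate \<open>\<epsilon>\<close>, so its derivative at
    \<open>0\<close> is negative. The barrier estimate nevertheless keeps it nonnegative, because
    \<open>N \<ge> K\<close> makes the barrier at least \<open>\<sigma>\<close> at distance
    \<open>\<sigma>\<close> along \<open>\<nu>\<close>.\<close>
  let ?F = "\<lambda>\<sigma>. u (tz + (nt - \<epsilon>) * \<sigma>, yz + \<sigma> *\<^sub>R ny) - v (tz + nt * \<sigma>, yz + \<sigma> *\<^sub>R ny)"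
  have "(?F has_real_derivative
      ((nt - \<epsilon>) * Dt u z + ny \<bullet> grad_y u z) - (nt * Dt v z + ny \<bullet> grad_y v z)) (at 0)"
    by (intro DERIV_diff D smooth_u smooth_v)
  also have "((nt - \<epsilon>) * Dt u z + ny \<bullet> grad_y u z) - (nt * Dt v z + ny \<bullet> grad_y v z) = - (\<epsilon> * Dt u z)"
    using same by (simp add: algebra_simps)
  finally have F': "(?F has_real_derivative - (\<epsilon> * Dt u z)) (at 0)" .
  have "- (\<epsilon> * Dt u z) < 0" using \<epsilon>(1) ut_pos[OF zC] by simp
  from DERIV_neg_dec_right[OF F' this]
  obtain d where d: "d > 0" "\<And>h. 0 < h \<Longrightarrow> h < d \<Longrightarrow> ?F h < ?F 0" by auto
  define \<sigma> where "\<sigma> = min (d / 2) \<delta>"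
  have \<sigma>: "0 < \<sigma>" "\<sigma> < d" "\<sigma> \<le> \<delta>" using d(1) \<delta>(1) by (auto simp: \<sigma>_def)
  have "\<nu> \<bullet> \<nu> = 1" using \<nu>(1) by (simp add: norm_eq_1)
  then have b\<sigma>: "?b (z + \<sigma> *\<^sub>R \<nu>) = \<sigma> + (N - K) * \<sigma>\<^sup>2"
    using \<nu>(1) \<sigma>(1) by (simp add: barrier_def algebra_simps)
  have "0 \<le> (N - K) * \<sigma>\<^sup>2" using NK by simp
  then have b\<sigma>': "\<sigma> \<le> ?b (z + \<sigma> *\<^sub>R \<nu>)" unfolding b\<sigma> by simp
  have mem: "z + \<sigma> *\<^sub>R \<nu> \<in> ?D" using \<sigma> b\<sigma>' \<open>\<nu> \<bullet> \<nu> = 1\<close> by simp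
  have e: "z + \<sigma> *\<^sub>R \<nu> = (tz + nt * \<sigma>, yz + \<sigma> *\<^sub>R ny)" by (simp add: ze ne mult.commute)
  have le: "v (tz + nt * \<sigma>, yz + \<sigma> *\<^sub>R ny) \<le> u (tz + nt * \<sigma> - \<epsilon> * ?b (z + \<sigma> *\<^sub>R \<nu>), yz + \<sigma> *\<^sub>R ny)"
    using \<epsilon>(3) mem unfolding e by blast
  have \<epsilon>\<sigma>: "\<epsilon> * \<sigma> \<le> \<epsilon> * ?b (z + \<sigma> *\<^sub>R \<nu>)" "0 \<le> \<epsilon> * \<sigma>" using b\<sigma>' \<epsilon>(1) \<sigma>(1) by auto
  have s: "(\<tau>, yz + \<sigma> *\<^sub>R ny) \<in> Cyl"
    if "tz + nt * \<sigma> - \<epsilon> * ?b (z + \<sigma> *\<^sub>R \<nu>) \<le> \<tau>" "\<tau> \<le> tz + nt * \<sigma>" for \<tau>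
    using shift[of "tz + nt * \<sigma>" "yz + \<sigma> *\<^sub>R ny" \<epsilon> \<tau>] mem that \<epsilon>(1,2) r(2) unfolding e by auto
  have "u (tz + nt * \<sigma> - \<epsilon> * ?b (z + \<sigma> *\<^sub>R \<nu>), yz + \<sigma> *\<^sub>R ny) \<le> u (tz + nt * \<sigma> - \<epsilon> * \<sigma>, yz + \<sigma> *\<^sub>R ny)"
    using s[of "tz + nt * \<sigma> - \<epsilon> * ?b (z + \<sigma> *\<^sub>R \<nu>)"] s[of "tz + nt * \<sigma> - \<epsilon> * \<sigma>"] \<epsilon>\<sigma>
    by (intro u_mono) (auto simp: mem_Cyl)
  with le have "?F \<sigma> \<ge> 0" by (simp add: algebra_simps)
  moreover have "?F 0 = 0" using uz by (simp add: ze)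
  ultimately show False using d(2)[OF \<sigma>(1,2)] by simp
qed

text \<open>The contact set is closed in the connected cylinder. If it were not open, some ball free
  of contact would touch it at a boundary point, which \<open>interior_touching_False\<close>
  excludes.\<close>

lemma strong_maximum_principle:
  assumes "x1 \<in> Cyl" "u x1 = v x1" "x \<in> Cyl"
  shows "u x = v x"
proof (rule ccontr)
  assume neq: "u x \<noteq> v x"
  define Z where "Z = {x \<in> Cyl. u x = v x}"
  have cont: "continuous_on A (\<lambda>x. u x - v x)" if "A \<subseteq> Cyl" for A
  proof -
    have sub: "A \<subseteq> closure Cyl" using that closure_subset by (rule order_trans)
    show ?thesis
      by (intro continuous_on_diff continuous_on_subset[OF smooth_on_set_continuous_on sub] smooth_u smooth_v)
  qed
  have "\<exists>z0\<in>Z. \<forall>d>0. \<exists>x0\<in>Cyl - Z. dist z0 x0 < d"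
  proof (rule ccontr)
    assume "\<not> ?thesis"
    then have "\<forall>z0\<in>Z. \<exists>d>0. \<forall>x0\<in>Cyl. dist x0 z0 < d \<longrightarrow> x0 \<in> Z"
      by (metis Diff_iff dist_commute)
    then have "openin (top_of_set Cyl) Z" unfolding openin_euclidean_subtopology_iff Z_def by auto
    moreover have "closedin (top_of_set Cyl) Z"
    proof -
      have "Z = Cyl \<inter> (\<lambda>x. u x - v x) -` {0}" by (auto simp: Z_def)
      then show ?thesis by (simp add: continuous_closedin_preimage cont)
    qed
    moreover have "connected (Cyl :: (real \<times> (real ^ 'n)) set)"
      by (intro convex_connected convex_Cyl)
    ultimately have "Z = {} \<or> Z = Cyl" using connected_clopen by blast
    moreover have "x1 \<in> Z" "x \<notin> Z" using assms neq by (auto simp: Z_def)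
    ultimately show False using assms(3) by blast
  qed
  then obtain z0 where z0: "z0 \<in> Z" "\<And>d. d > 0 \<Longrightarrow> \<exists>x0\<in>Cyl - Z. dist z0 x0 < d" by blast
  obtain r where r: "r > 0" "cball z0 r \<subseteq> Cyl"
    using z0(1) open_contains_cball open_Cyl unfolding Z_def by blast
  \<comment> \<open>Half the radius is enough: the contact point nearest to \<open>x0\<close> is
    closer than \<open>r / 2\<close>, so the ball around \<open>x0\<close> that reaches it stays in
    \<open>cball z0 r\<close>.\<close>
  obtain x0 where x0: "x0 \<in> Cyl" "x0 \<notin> Z" "dist z0 x0 < r / 2" using z0(2)[of "r / 2"] r(1) by auto
  let ?S = "cball z0 r \<inter> (\<lambda>x. u x - v x) -` {0}"
  have "closed ?S" by (intro continuous_closed_preimage cont r) auto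
  moreover have "z0 \<in> ?S" using z0(1) r(1) by (simp add: Z_def)
  ultimately obtain z where z: "z \<in> ?S" "\<And>y. y \<in> ?S \<Longrightarrow> dist x0 z \<le> dist x0 y"
    using distance_attains_inf[of ?S x0] by blast
  define R where "R = dist z x0"
  have R2: "R < r / 2" using z(2)[OF \<open>z0 \<in> ?S\<close>] x0(3) by (simp add: R_def dist_commute)
  have sub: "cball x0 R \<subseteq> cball z0 r"
  proof
    fix y assume "y \<in> cball x0 R"
    then show "y \<in> cball z0 r"
      using dist_triangle[of z0 y x0] x0(3) R2 by simp
  qed
  have zC: "z \<in> Cyl" "u z = v z" using z(1) r(2) by auto
  have "R > 0" using x0 zC by (auto simp: R_def Z_def)
  show False
  proof (rule interior_touching_False[OF zC(1) _ R_def[symmetric] \<open>R > 0\<close> _ zC(2)])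
    show "cball x0 R \<subseteq> Cyl" using sub r(2) by blast
    show "v y < u y" if "y \<in> ball x0 R" for y
    proof -
      have y: "y \<in> cball z0 r" using that sub ball_subset_cball by blast
      have "u y \<noteq> v y"
        using z(2)[of y] y that by (auto simp: R_def dist_commute)
      then show ?thesis using u_ge_v[of y] y r(2) by force
    qed
  qed
qed

text \<open>The barrier has its vertex at the origin and points along the axis; its cap lies in the
  paraboloid \<open>K * (norm y)\<^sup>2 \<le> 2 * t\<close>. The term
  \<open>4 * K * (y \<bullet> grad_y (Dt u) (\<tau>, y))\<close> stems from the
  \<open>y\<close>-part of the barrier gradient, and \<open>0 \<le> Dt (Dt u)\<close> allows the
  coefficient of \<open>Dt (Dt u)\<close> to be replaced by its lower bound \<open>1\<close>. On the
  axis the barrier is at least \<open>s\<close>, whence the factor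
  \<open>1 - \<epsilon>\<close>.\<close>

lemma hopf_origin:
  assumes strict: "\<And>x. x \<in> Cyl \<Longrightarrow> v x < u x"
    and K: "K > 0" and N: "N \<ge> K" and \<delta>: "\<delta> > 0"
    and sub: "\<And>t y \<tau>. 0 < t \<Longrightarrow> t \<le> \<delta> \<Longrightarrow> K * (norm y)\<^sup>2 \<le> 2 * t \<Longrightarrow> t / 2 \<le> \<tau> \<Longrightarrow> \<tau> \<le> t \<Longrightarrow>
      0 \<le> Dt (Dt u) (\<tau>, y) \<and>
      0 < Dt u (\<tau>, y) * (2 * (N - (real CARD('n) + 1) * K)) + Dt (Dt u) (\<tau>, y)
        - 4 * K * (y \<bullet> grad_y (Dt u) (\<tau>, y))"
  shows "\<exists>\<epsilon>>0. \<epsilon> < 1 \<and> (\<exists>d>0. \<forall>s. 0 < s \<and> s < d \<longrightarrow> v (s, 0) \<le> u ((1 - \<epsilon>) * s, 0))"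
proof -
  \<comment> \<open>The bound \<open>1 / (N - K + 1)\<close> makes the barrier at most
    \<open>2 * t\<close>, \<open>1 / (8 * K)\<close> bounds the \<open>y\<close>-part of its
    gradient by \<open>1\<close>, and the last two keep the cap inside the cylinder.\<close>
  define \<delta>' where "\<delta>' = Min {\<delta>, 1 / (N - K + 1), 1 / (8 * K), 1 / 2, K / 4}"
  have \<delta>': "\<delta>' > 0" "\<delta>' \<le> \<delta>" "(N - K) * \<delta>' \<le> 1" "8 * K * \<delta>' \<le> 1" "\<delta>' \<le> 1 / 2" "\<delta>' \<le> K / 4"
  proof -
    have le: "\<delta>' \<le> \<delta>" "\<delta>' \<le> 1 / (N - K + 1)" "\<delta>' \<le> 1 / (8 * K)" "\<delta>' \<le> 1 / 2" "\<delta>' \<le> K / 4"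
      unfolding \<delta>'_def by (rule Min_le; simp)+
    then show "\<delta>' \<le> \<delta>" "\<delta>' \<le> 1 / 2" "\<delta>' \<le> K / 4" by simp_all
    show "\<delta>' > 0" unfolding \<delta>'_def using \<delta> N K by (subst Min_gr_iff) auto
    have "(N - K) * \<delta>' \<le> (N - K) * (1 / (N - K + 1))" using N le by (intro mult_left_mono) auto
    also have "\<dots> \<le> 1" using N by (simp add: field_simps)
    finally show "(N - K) * \<delta>' \<le> 1" .
    have "8 * K * \<delta>' \<le> 8 * K * (1 / (8 * K))" using K le by (intro mult_left_mono) auto
    then show "8 * K * \<delta>' \<le> 1" using K by simp
  qed
  let ?z = "(0, 0) :: real \<times> (real ^ 'n)" and ?e = "(1, 0) :: real \<times> (real ^ 'n)"
  let ?b = "barrier ?z ?e N K" and ?G = "barrier_grad ?z ?e N K"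
  let ?D = "{x. 0 \<le> (x - ?z) \<bullet> ?e \<and> (x - ?z) \<bullet> ?e \<le> \<delta>' \<and> 0 \<le> ?b x}"
  have l: "((t, y) - ?z) \<bullet> ?e = t" for t y by (simp add: inner_prod_def)
  have b: "?b (t, y) = t + (N - K) * t\<^sup>2 - K * (norm y)\<^sup>2" for t y
    unfolding barrier_def l by (simp add: norm_Pair algebra_simps)
  have G: "?G (t, y) = (1 + 2 * (N - K) * t, - (2 * K) *\<^sub>R y)" for t y
    unfolding barrier_grad_def l by (simp add: algebra_simps)
  have mem: "(t, y) \<in> ?D \<longleftrightarrow> 0 \<le> t \<and> t \<le> \<delta>' \<and> 0 \<le> ?b (t, y)" for t y unfolding mem_Collect_eq l ..
  have Nt: "0 \<le> (N - K) * t \<and> (N - K) * t \<le> 1" if "0 \<le> t" "t \<le> \<delta>'" for t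
  proof
    show "0 \<le> (N - K) * t" using N that by simp
    have "(N - K) * t \<le> (N - K) * \<delta>'" using N that by (intro mult_left_mono) auto
    with \<delta>'(3) show "(N - K) * t \<le> 1" by linarith
  qed
  have b2: "?b (t, y) + K * (norm y)\<^sup>2 \<le> 2 * t" if "0 \<le> t" "t \<le> \<delta>'" for t y
    using mult_right_mono[OF conjunct2[OF Nt[OF that]] that(1)] by (simp add: b power2_eq_square algebra_simps)
  have y2: "K * (norm y)\<^sup>2 \<le> 2 * t" if "(t, y) \<in> ?D" for t y
  proof -
    from that have "0 \<le> t" "t \<le> \<delta>'" "0 \<le> ?b (t, y)" unfolding mem by auto
    with b2[of t y] show ?thesis by linarith
  qed
  have pos: "0 < t" if "(t, y) \<in> ?D" "(t, y) \<noteq> ?z" for t y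
  proof (rule ccontr)
    assume "\<not> 0 < t"
    then have "t = 0" using that(1) unfolding mem by simp
    then have "K * (norm y)\<^sup>2 \<le> 0" using y2[OF that(1)] by simp
    then have "y = 0" using K by (simp add: mult_le_0_iff)
    with \<open>t = 0\<close> that(2) show False by simp
  qed
  \<comment> \<open>The value \<open>1 / 10\<close> serves twice. The squared gradient is at most
    \<open>9 + 1\<close>, so the coefficient of \<open>Dt (Dt u)\<close> is at least
    \<open>2 - 1\<close>; and the displacement is at most \<open>t / 5\<close>, so
    \<open>\<tau>\<close> stays above \<open>t / 2\<close>.\<close>
  have "\<exists>\<epsilon>>0. \<epsilon> \<le> 1 / 10 \<and> (\<forall>t y. (t, y) \<in> ?D \<longrightarrow> v (t, y) \<le> u (t - \<epsilon> * ?b (t, y), y))"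
  proof (rule hopf_barrier[OF _ K _ \<delta>'(1)])
    show "norm ?e = 1" by (simp add: norm_Pair)
    show "N \<ge> 0" using K N by simp
    show "x \<in> Cyl \<and> v x < u x" if x: "x \<in> ?D" "x \<noteq> ?z" for x
    proof -
      obtain t y where xe: "x = (t, y)" by (cases x)
      have t: "0 < t" "t \<le> \<delta>'" using pos x mem unfolding xe by blast+
      have "K * (norm y)\<^sup>2 \<le> 2 * t" using y2 x unfolding xe by blast
      also have "\<dots> \<le> 2 * (K / 4)" using t \<delta>'(6) by linarith
      finally have "K * (norm y)\<^sup>2 < K * 1" using K by simp
      then have "(norm y)\<^sup>2 < 1\<^sup>2" using K by simp
      then have "norm y < 1" by (rule power2_less_imp_less) simp
      then have "x \<in> Cyl" using t \<delta>'(5) by (simp add: xe mem_Cyl)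
      then show ?thesis using strict by blast
    qed
    show "1 / 10 * ?b x \<le> fst x" if "x \<in> ?D" for x
    proof -
      obtain t y where xe: "x = (t, y)" by (cases x)
      have t: "0 \<le> t" "t \<le> \<delta>'" using that mem unfolding xe by blast+
      have "0 \<le> K * (norm y)\<^sup>2" using K by simp
      with b2[OF t, of y] t show ?thesis by (simp add: xe)
    qed
    fix \<epsilon> t y \<tau>
    assume \<epsilon>: "0 < \<epsilon>" "\<epsilon> \<le> 1 / 10" and x: "(t, y) \<in> ?D" "(t, y) \<noteq> ?z"
      and \<tau>: "t - \<epsilon> * ?b (t, y) \<le> \<tau>" "\<tau> \<le> t"
    have t: "0 < t" "t \<le> \<delta>'" "0 \<le> ?b (t, y)" using pos x mem by blast+
    have Ky: "K * (norm y)\<^sup>2 \<le> 2 * t" by (rule y2[OF x(1)])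
    have "0 \<le> K * (norm y)\<^sup>2" using K by simp
    then have "?b (t, y) \<le> 2 * t" using b2[of t y] t by linarith
    then have "\<epsilon> * ?b (t, y) \<le> 1 / 10 * (2 * t)" using \<epsilon> t by (intro mult_mono) auto
    then have "t / 2 \<le> \<tau>" using \<tau> t by linarith
    from sub[OF t(1) _ Ky this \<tau>(2)] t(2) \<delta>'(2)
    have s: "0 \<le> Dt (Dt u) (\<tau>, y)"
      "0 < Dt u (\<tau>, y) * (2 * (N - (real CARD('n) + 1) * K)) + Dt (Dt u) (\<tau>, y)
        - 4 * K * (y \<bullet> grad_y (Dt u) (\<tau>, y))" by auto
    have g: "1 \<le> fst (?G (t, y))" "fst (?G (t, y)) \<le> 3"
      using Nt[of t] t unfolding G fst_conv mult.assoc by linarith+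
    have "(norm (?G (t, y)))\<^sup>2 \<le> 10"
    proof -
      have "(norm (?G (t, y)))\<^sup>2 = (fst (?G (t, y)))\<^sup>2 + 4 * K * (K * (norm y)\<^sup>2)"
        by (simp add: G norm_Pair power2_eq_square)
      moreover have "(fst (?G (t, y)))\<^sup>2 \<le> 3\<^sup>2" using g by (intro power_mono) auto
      moreover have "4 * K * (K * (norm y)\<^sup>2) \<le> 4 * K * (2 * \<delta>')"
        using K Ky t by (intro mult_left_mono) auto
      ultimately show ?thesis using \<delta>'(4) by simp
    qed
    then have "\<epsilon> * (norm (?G (t, y)))\<^sup>2 \<le> 1 / 10 * 10" using \<epsilon> by (intro mult_mono) auto
    with g(1) have "1 \<le> 2 * fst (?G (t, y)) - \<epsilon> * (norm (?G (t, y)))\<^sup>2" by simp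
    from mult_left_mono[OF this s(1)]
    have "Dt (Dt u) (\<tau>, y) \<le> Dt (Dt u) (\<tau>, y) * (2 * fst (?G (t, y)) - \<epsilon> * (norm (?G (t, y)))\<^sup>2)" by simp
    moreover have "2 * (snd (?G (t, y)) \<bullet> grad_y (Dt u) (\<tau>, y)) = - (4 * K * (y \<bullet> grad_y (Dt u) (\<tau>, y)))"
      by (simp add: G)
    ultimately show "0 < Dt u (\<tau>, y) * (2 * (N - (real CARD('n) + 1) * K))
        + Dt (Dt u) (\<tau>, y) * (2 * fst (?G (t, y)) - \<epsilon> * (norm (?G (t, y)))\<^sup>2)
        + 2 * (snd (?G (t, y)) \<bullet> grad_y (Dt u) (\<tau>, y))"
      using s(2) by linarith
  qed simp_all
  then obtain \<epsilon> where \<epsilon>: "\<epsilon> > 0" "\<epsilon> \<le> 1 / 10"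
    "\<And>t y. (t, y) \<in> ?D \<Longrightarrow> v (t, y) \<le> u (t - \<epsilon> * ?b (t, y), y)" by blast
  have "v (s, 0) \<le> u ((1 - \<epsilon>) * s, 0)" if s: "0 < s" "s < \<delta>'" for s
  proof -
    have bs: "?b (s, 0) = s + (N - K) * s\<^sup>2" by (simp add: b)
    have "0 \<le> (N - K) * s\<^sup>2" using N by simp
    then have bs': "s \<le> ?b (s, 0)" unfolding bs by simp
    have "?b (s, 0) \<le> 2 * s" using b2[of s 0] s by simp
    then have "\<epsilon> * ?b (s, 0) \<le> 1 / 10 * (2 * s)" using \<epsilon> bs' s by (intro mult_mono) auto
    moreover have "\<epsilon> * s \<le> \<epsilon> * ?b (s, 0)" using \<epsilon>(1) bs' by simp
    moreover have "0 \<le> \<epsilon> * s" using \<epsilon>(1) s by simp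
    ultimately have "u (s - \<epsilon> * ?b (s, 0), 0) \<le> u (s - \<epsilon> * s, 0)"
      using s \<delta>'(5) by (intro u_mono) auto
    moreover have "(s, 0) \<in> ?D" using mem s bs' by auto
    ultimately show ?thesis using \<epsilon>(3)[of s 0] by (simp add: algebra_simps)
  qed
  with \<epsilon> \<delta>'(1) show ?thesis by (intro exI[of _ \<epsilon>] conjI exI[of _ \<delta>']) auto
qed

end

section \<open>Behaviour at the origin\<close>

lemma Dy_cong:
  assumes "\<And>y. y \<in> closure Cyl \<Longrightarrow> f y = g y" "x \<in> closure Cyl"
  shows "Dy i f x = Dy i g x"
  unfolding Dy_def using assms by (rule dderiv_cong)

lemma Dy_zero:
  assumes f: "smooth f" and zero: "\<And>y. norm y < 1 \<Longrightarrow> f (0, y) = 0" and y: "norm y < 1"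
  shows "Dy i f (0, y) = 0"
proof -
  have "((\<lambda>r. f (0, y + r *\<^sub>R axis i 1)) has_real_derivative axis i 1 \<bullet> grad_y f (0, y + 0 *\<^sub>R axis i 1)) (at 0)"
    using y by (intro DERIV_y f) auto
  then have D: "((\<lambda>r. f (0, y + r *\<^sub>R axis i 1)) has_real_derivative Dy i f (0, y)) (at 0)"
    by (simp add: inner_axis_grad_y)
  have "f (0, y + r *\<^sub>R axis i 1) = 0" if "\<bar>0 - r\<bar> < 1 - norm y" for r
    using norm_triangle_ineq[of y "r *\<^sub>R axis i 1"] that by (intro zero) (simp add: norm_axis_1)
  then show ?thesis
    using y zero[OF y] by (intro DERIV_local_const[OF D, of "1 - norm y"]) auto
qed

text \<open>Differentiation along the base preserves vanishing there. Hence near the origin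
  \<open>Dy i (Dy i f)\<close> is a multiple of \<open>t\<close> up to
  \<open>o (norm x)\<close>.\<close>

lemma grad_y_Dy_Dy_zero:
  assumes f: "smooth f" and zero: "\<And>y. norm y < 1 \<Longrightarrow> f (0, y) = 0"
  shows "norm y < 1 \<Longrightarrow> Dy i (Dy i f) (0, y) = 0" "grad_y (Dy i (Dy i f)) (0, 0) = 0"
proof -
  have 1: "Dy i (Dy i f) (0, y) = 0" if "norm y < 1" for y
    by (rule Dy_zero[OF smooth_Dy[OF f] Dy_zero[OF f zero] that])
  then show "norm y < 1 \<Longrightarrow> Dy i (Dy i f) (0, y) = 0" .
  show "grad_y (Dy i (Dy i f)) (0, 0) = 0"
    using Dy_zero[OF smooth_Dy[OF smooth_Dy[OF f]] 1, where y = 0] by (simp add: grad_y_def vec_eq_iff)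
qed

lemma tendsto_laplacian:
  assumes "smooth f" "norm y \<le> 1"
  shows "((\<lambda>t. laplacian f (t, y)) \<longlongrightarrow> laplacian f (0, y)) (at_right 0)"
  unfolding laplacian_def
  using assms by (intro tendsto_add tendsto_sum tendsto_t smooth_Dt smooth_Dy)

text \<open>The error is measured by \<open>norm y\<close> alone, not by the norm of
  \<open>(s, y)\<close>: it must be small against the width of the ball in \<open>y\<close>, however
  large \<open>s\<close> is by comparison.\<close>

lemma increment_y:
  assumes f: "smooth f" and grad: "grad_y f (0, 0) = 0" and "e > 0"
  shows "\<exists>d>0. \<forall>s y. norm (s, y) < d \<longrightarrow> (s, y) \<in> closure Cyl \<longrightarrow> \<bar>f (s, y) - f (s, 0)\<bar> \<le> e * norm y"
proof -
  have "continuous_on (closure Cyl) (grad_y f)"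
    unfolding grad_y_def[abs_def]
    by (intro continuous_on_vec_lambda smooth_on_set_continuous_on smooth_Dy f)
  then obtain d where d: "d > 0" "\<And>x. x \<in> closure Cyl \<Longrightarrow> dist x (0, 0) < d \<Longrightarrow> dist (grad_y f x) (grad_y f (0, 0)) < e"
    unfolding continuous_on_iff using zero_mem_closure_Cyl \<open>e > 0\<close> by metis
  have "\<bar>f (s, y) - f (s, 0)\<bar> \<le> e * norm y" if x: "norm (s, y) < d" "(s, y) \<in> closure Cyl" for s y
  proof -
    have "(s, 0) \<in> closure Cyl" using x(2) by (simp add: mem_closure_Cyl)
    from mvt_cylinder[OF f this x(2)] obtain r where r: "0 < r" "r < 1"
      "(s, 0) + r *\<^sub>R ((s, y) - (s, 0)) \<in> closure Cyl"
      "f (s, y) - f (s, 0) = fst ((s, y) - (s, 0)) * Dt f ((s, 0) + r *\<^sub>R ((s, y) - (s, 0)))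
         + snd ((s, y) - (s, 0)) \<bullet> grad_y f ((s, 0) + r *\<^sub>R ((s, y) - (s, 0)))" by blast
    then have mem: "(s, r *\<^sub>R y) \<in> closure Cyl" and eq: "f (s, y) - f (s, 0) = y \<bullet> grad_y f (s, r *\<^sub>R y)"
      by simp_all
    have "norm (r *\<^sub>R y) \<le> norm y" using r by (simp add: mult_left_le_one_le)
    then have "norm (s, r *\<^sub>R y) \<le> norm (s, y)" by (simp add: norm_Pair power_mono)
    then have "norm (grad_y f (s, r *\<^sub>R y)) < e"
      using d(2)[OF mem, unfolded grad] x(1) by (simp add: dist_norm flip: zero_prod_def)
    then have "norm y * norm (grad_y f (s, r *\<^sub>R y)) \<le> norm y * e" by (intro mult_left_mono) auto
    with Cauchy_Schwarz_ineq2[of y "grad_y f (s, r *\<^sub>R y)"] show ?thesis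
      unfolding eq by (simp add: mult.commute)
  qed
  with d(1) show ?thesis by blast
qed

lemma continuous_pos_near_origin:
  fixes F :: "real \<times> (real ^ 'n) \<Rightarrow> real"
  assumes "continuous_on (closure Cyl) F" "F (0, 0) > 0"
  shows "\<exists>d>0. \<forall>x. norm x < d \<longrightarrow> x \<in> closure Cyl \<longrightarrow> F x > 0"
proof -
  obtain d where "d > 0" "\<And>x. x \<in> closure Cyl \<Longrightarrow> dist x (0, 0) < d \<Longrightarrow> dist (F x) (F (0, 0)) < F (0, 0)"
    using assms zero_mem_closure_Cyl unfolding continuous_on_iff by metis
  then show ?thesis
    by (intro exI[of _ d]) (force simp: dist_real_def simp flip: zero_prod_def)
qed

context touching
begin

text \<open>A mere choice of levels; the squeeze between \<open>0\<close> and \<open>s\<close> is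
  enough to pass to limits as \<open>s\<close> tends to \<open>0\<close>.\<close>

lemma level_function:
  assumes y: "norm y < 1"
  obtains T where "\<And>s. 0 < s \<Longrightarrow> s < 1 \<Longrightarrow> 0 < T s \<and> T s \<le> s \<and> u (T s, y) = v (s, y)"
    and "filterlim T (at_right 0) (at_right 0)"
proof -
  obtain T where T: "\<And>s. 0 < s \<Longrightarrow> s < 1 \<Longrightarrow> 0 < T s \<and> T s \<le> s \<and> u (T s, y) = v (s, y)"
    using level_exists[OF _ _ y] by metis
  have "(T \<longlongrightarrow> 0) (at_right 0)"
  proof (rule tendsto_sandwich[OF _ _ tendsto_const tendsto_ident_at])
    show "\<forall>\<^sub>F s in at_right 0. 0 \<le> T s"
      using eventually_right_unit by eventually_elim (use T in \<open>auto simp: less_imp_le\<close>)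
    show "\<forall>\<^sub>F s in at_right 0. T s \<le> s"
      using eventually_right_unit by eventually_elim (use T in auto)
  qed
  moreover have "\<forall>\<^sub>F s in at_right 0. T s > 0"
    using eventually_right_unit by eventually_elim (use T in auto)
  ultimately have "filterlim T (at_right 0) (at_right 0)"
    by (auto simp: filterlim_at elim: eventually_mono)
  with T show ?thesis by (rule that)
qed

text \<open>The Laplacians are compared at \<open>(T s, y)\<close> and \<open>(s, y)\<close> as
  \<open>s\<close> tends to \<open>0\<close>; on the base the \<open>y\<close>-parts drop out
  because \<open>u\<close> and \<open>v\<close> vanish there. The case \<open>y \<noteq> 0\<close>
  serves to compare the \<open>y\<close>-gradients of the two sides at the origin.\<close>

lemma utt_le_vtt:
  assumes y: "norm y < 1"
  shows "Dt (Dt u) (0, y) \<le> Dt (Dt v) (0, y)"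
proof -
  obtain T where T: "\<And>s. 0 < s \<Longrightarrow> s < 1 \<Longrightarrow> 0 < T s \<and> T s \<le> s \<and> u (T s, y) = v (s, y)"
    "filterlim T (at_right 0) (at_right 0)" using level_function[OF y] by blast
  have "laplacian u (0, y) \<le> laplacian v (0, y)"
  proof (rule tendsto_le)
    show "((\<lambda>s. laplacian v (s, y)) \<longlongrightarrow> laplacian v (0, y)) (at_right 0)"
      using y by (intro tendsto_laplacian smooth_v) simp
    show "((\<lambda>s. laplacian u (T s, y)) \<longlongrightarrow> laplacian u (0, y)) (at_right 0)"
      using y by (intro filterlim_compose[OF tendsto_laplacian[OF smooth_u] T(2)]) simp
    show "\<forall>\<^sub>F s in at_right 0. laplacian u (T s, y) \<le> laplacian v (s, y)"
      using eventually_right_unit by eventually_elim (use T(1) y lap_le in auto)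
  qed simp
  then show ?thesis
    using grad_y_Dy_Dy_zero(1)[OF smooth_u u_zero y] grad_y_Dy_Dy_zero(1)[OF smooth_v v_zero y]
    by (simp add: laplacian_def)
qed

lemma v_ratio_zero:
  assumes "((\<lambda>t. u (t, 0) / t ^ m) \<longlongrightarrow> 0) (at_right 0)"
    and "((\<lambda>t. v (t, 0) / t ^ m) \<longlongrightarrow> b) (at_right 0)"
  shows "b = 0"
proof (rule tendsto_unique[OF _ assms(2)])
  show "((\<lambda>t. v (t, 0) / t ^ m) \<longlongrightarrow> 0) (at_right 0)"
  proof (rule tendsto_sandwich[OF _ _ tendsto_const assms(1)])
    show "\<forall>\<^sub>F t in at_right 0. 0 \<le> v (t, 0) / t ^ m"
      using eventually_right_unit
      by eventually_elim (use v_pos in \<open>auto simp: mem_Cyl less_imp_le\<close>)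
    show "\<forall>\<^sub>F t in at_right 0. v (t, 0) / t ^ m \<le> u (t, 0) / t ^ m"
      using eventually_right_unit
      by eventually_elim (intro divide_right_mono v_le_u, auto)
  qed
qed simp

lemma leading_coefficient_le:
  assumes a: "((\<lambda>t. u (t, 0) / t ^ m) \<longlongrightarrow> a) (at_right 0)"
    and b: "((\<lambda>t. v (t, 0) / t ^ m) \<longlongrightarrow> b) (at_right 0)"
    and \<epsilon>: "0 < \<epsilon>" "\<epsilon> < 1" and "d > 0"
    and le: "\<And>s. 0 < s \<Longrightarrow> s < d \<Longrightarrow> v (s, 0) \<le> u ((1 - \<epsilon>) * s, 0)"
  shows "b \<le> (1 - \<epsilon>) ^ m * a"
proof (rule tendsto_le[OF _ _ b])
  have "((\<lambda>s::real. (1 - \<epsilon>) * s) \<longlongrightarrow> (1 - \<epsilon>) * 0) (at_right 0)" by (intro tendsto_intros)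
  moreover have "\<forall>\<^sub>F s in at_right 0. (1 - \<epsilon>) * s > 0"
    using eventually_right_unit by eventually_elim (use \<epsilon> in auto)
  ultimately have "filterlim (\<lambda>s. (1 - \<epsilon>) * s) (at_right 0) (at_right 0)"
    by (auto simp: filterlim_at elim: eventually_mono)
  from tendsto_mult[OF tendsto_const filterlim_compose[OF a this], of "(1 - \<epsilon>) ^ m"]
  show "((\<lambda>s. (1 - \<epsilon>) ^ m * (u ((1 - \<epsilon>) * s, 0) / ((1 - \<epsilon>) * s) ^ m)) \<longlongrightarrow> (1 - \<epsilon>) ^ m * a) (at_right 0)" .
  have "\<forall>\<^sub>F s in at_right 0. 0 < s \<and> s < d"
    unfolding eventually_at_right_field using \<open>d > 0\<close> by blast
  then show "\<forall>\<^sub>F s in at_right 0. v (s, 0) / s ^ m \<le> (1 - \<epsilon>) ^ m * (u ((1 - \<epsilon>) * s, 0) / ((1 - \<epsilon>) * s) ^ m)"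
  proof eventually_elim
    case (elim s)
    have "(1 - \<epsilon>) ^ m * (u ((1 - \<epsilon>) * s, 0) / ((1 - \<epsilon>) * s) ^ m) = u ((1 - \<epsilon>) * s, 0) / s ^ m"
      using \<epsilon> by (simp add: power_mult_distrib)
    then show ?case using elim le[of s] by (simp add: divide_right_mono)
  qed
qed simp

section \<open>The Hopf estimate for the two orders of contact\<close>

lemma hopf_origin_order_2:
  assumes strict: "\<And>x. x \<in> Cyl \<Longrightarrow> v x < u x" and utt: "Dt (Dt u) (0, 0) > 0"
  shows "\<exists>\<epsilon>>0. \<epsilon> < 1 \<and> (\<exists>d>0. \<forall>s. 0 < s \<and> s < d \<longrightarrow> v (s, 0) \<le> u ((1 - \<epsilon>) * s, 0))"
proof -
  let ?F = "\<lambda>x. Dt (Dt u) x - 4 * (snd x \<bullet> grad_y (Dt u) x)"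
  have c: "continuous_on (closure Cyl) (Dt (Dt u))" "continuous_on (closure Cyl) (grad_y (Dt u))"
    unfolding grad_y_def[abs_def]
    by (intro continuous_on_vec_lambda smooth_on_set_continuous_on smooth_Dt smooth_Dy smooth_u)+
  obtain d1 where d1: "d1 > 0" "\<And>x. norm x < d1 \<Longrightarrow> x \<in> closure Cyl \<Longrightarrow> Dt (Dt u) x > 0"
    using continuous_pos_near_origin[OF c(1) utt] by blast
  have "continuous_on (closure Cyl) ?F" by (intro continuous_intros c)
  then obtain d2 where d2: "d2 > 0" "\<And>x. norm x < d2 \<Longrightarrow> x \<in> closure Cyl \<Longrightarrow> ?F x > 0"
    using continuous_pos_near_origin[of ?F] utt by auto
  define d where "d = min 1 (min d1 d2)"
  have d: "d > 0" "d \<le> 1" "d \<le> d1" "d \<le> d2" using d1(1) d2(1) by (auto simp: d_def)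
  have d': "d\<^sup>2 \<le> 1" using d by (simp add: power_le_one)
  show ?thesis
  \<comment> \<open>With these values the coefficient of \<open>Dt u\<close> is zero and
    \<open>?F\<close> remains, positive near the origin. For \<open>t \<le> d\<^sup>2 / 4\<close>
    the squared norm of \<open>(\<tau>, y)\<close> is at most \<open>3 * t\<close>, below
    \<open>d\<^sup>2\<close>.\<close>
  proof (rule hopf_origin[OF strict, of 1 "real CARD('n) + 1" "d\<^sup>2 / 4"])
    fix t \<tau> :: real and y :: "real ^ 'n"
    assume t: "0 < t" "t \<le> d\<^sup>2 / 4" "1 * (norm y)\<^sup>2 \<le> 2 * t" and \<tau>: "t / 2 \<le> \<tau>" "\<tau> \<le> t"
    have "\<tau>\<^sup>2 \<le> t\<^sup>2" using t \<tau> by (intro power_mono) auto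
    moreover have "t\<^sup>2 \<le> t * 1" unfolding power2_eq_square using t d' by (intro mult_left_mono) auto
    moreover have "(norm (\<tau>, y))\<^sup>2 = \<tau>\<^sup>2 + (norm y)\<^sup>2" by (simp add: norm_Pair)
    moreover have "0 < d\<^sup>2" using d(1) by simp
    ultimately have "(norm (\<tau>, y))\<^sup>2 < d\<^sup>2" using t by linarith
    then have n: "norm (\<tau>, y) < d" by (rule power2_less_imp_less) (use d(1) in simp)
    have "norm y \<le> 1" "\<tau> \<le> 1"
      using n d(2) norm_snd_le[of y \<tau>] norm_fst_le[of \<tau> y] by auto
    then have mem: "(\<tau>, y) \<in> closure Cyl" using t \<tau> by (simp add: mem_closure_Cyl)
    show "0 \<le> Dt (Dt u) (\<tau>, y) \<and> 0 < Dt u (\<tau>, y) * (2 * (real CARD('n) + 1 - (real CARD('n) + 1) * 1))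
        + Dt (Dt u) (\<tau>, y) - 4 * 1 * (y \<bullet> grad_y (Dt u) (\<tau>, y))"
      using d1(2)[OF _ mem] d2(2)[OF _ mem] n d by simp
  qed (use d in auto)
qed

lemma Dt_u_boundary: "norm y \<le> 1 \<Longrightarrow> Dt u (0, y) \<ge> 0"
proof -
  assume y: "norm y \<le> 1"
  have "continuous_on (closure Cyl) (Dt u)"
    by (intro smooth_on_set_continuous_on smooth_Dt smooth_u)
  then show ?thesis
    using continuous_ge_on_closure[of Cyl "Dt u" "(0, y)" 0] ut_pos y
    by (auto simp: mem_closure_Cyl less_imp_le)
qed

text \<open>By continuity \<open>Dt u\<close> is nonnegative on the base, and it is zero at the
  origin. These are the first and second order conditions for that minimum, the second rewritten by
  commuting derivatives.\<close>

lemma Dt_u_origin: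
  assumes ut: "Dt u (0, 0) = 0"
  shows "grad_y (Dt u) (0, 0) = 0" "Dt (Dy i (Dy i u)) (0, 0) \<ge> 0"
proof -
  have D: "((\<lambda>r. g (0, r *\<^sub>R axis i 1)) has_real_derivative Dy i g (0, r *\<^sub>R axis i 1)) (at r)"
    if "smooth g" "\<bar>r\<bar> < 1" for g :: "real \<times> (real ^ 'n) \<Rightarrow> real" and r i
    using DERIV_y[OF that(1), of 0 0 r "axis i 1"] that(2)
    by (simp add: inner_axis_grad_y norm_axis_1)
  have min: "Dt u (0, 0 *\<^sub>R axis i 1) \<le> Dt u (0, r *\<^sub>R axis i 1)" if "\<bar>r\<bar> < 1" for r i
    using Dt_u_boundary[of "r *\<^sub>R axis i 1"] that ut by (simp add: norm_axis_1)
  have "Dy i (Dt u) (0, 0) = 0" for i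
    using DERIV_local_min[OF D[OF smooth_Dt[OF smooth_u], of 0 i], of 1] min[where i = i] by simp
  then show "grad_y (Dt u) (0, 0) = 0" by (simp add: grad_y_def vec_eq_iff)
  have "Dy i (Dy i (Dt u)) (0, 0 *\<^sub>R axis i 1) \<ge> 0"
    by (rule second_derivative_local_min[OF zero_less_one D[OF smooth_Dt[OF smooth_u], of _ i]
          D[OF smooth_Dy[OF smooth_Dt[OF smooth_u]], of 0 i] min[where i = i]]) auto
  also have "Dy i (Dy i (Dt u)) (0, 0 *\<^sub>R axis i 1) = Dy i (Dy i (Dt u)) (0, 0)" by simp
  also have "\<dots> = Dy i (Dt (Dy i u)) (0, 0)"
    by (intro Dy_cong zero_mem_closure_Cyl) (simp add: Dt_Dy[OF smooth_u])
  also have "\<dots> = Dt (Dy i (Dy i u)) (0, 0)"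
    by (rule Dt_Dy[OF smooth_Dy[OF smooth_u] zero_mem_closure_Cyl, symmetric])
  finally show "Dt (Dy i (Dy i u)) (0, 0) \<ge> 0" .
qed

text \<open>The Euler inequality trades \<open>4 * K * (y \<bullet> grad_y (Dt u) x)\<close> for
  \<open>8 * K * Dt u x\<close>, which the choice of \<open>N\<close> pays, plus a multiple of
  \<open>K * (norm x)\<^sup>2\<close>. On the paraboloid the latter is at most \<open>3 * t\<close>
  whatever \<open>K\<close> is, so \<open>K\<close> may be as large as the lower bound for
  \<open>Dt (Dt u)\<close> demands.\<close>

lemma hopf_origin_order_3:
  assumes strict: "\<And>x. x \<in> Cyl \<Longrightarrow> v x < u x" and ut: "Dt u (0, 0) = 0" and utt: "Dt (Dt u) (0, 0) = 0"
    and grad_utt: "grad_y (Dt (Dt u)) (0, 0) = 0" and uttt: "Dt (Dt (Dt u)) (0, 0) > 0"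
  shows "\<exists>\<epsilon>>0. \<epsilon> < 1 \<and> (\<exists>d>0. \<forall>s. 0 < s \<and> s < d \<longrightarrow> v (s, 0) \<le> u ((1 - \<epsilon>) * s, 0))"
proof -
  define m where "m = Dt (Dt (Dt u)) (0, 0)"
  have m: "m > 0" using uttt by (simp add: m_def)
  obtain C d1 where C: "C > 0" and d1: "d1 > 0" "\<And>x. norm x < d1 \<Longrightarrow> x \<in> closure Cyl \<Longrightarrow>
      \<bar>Dt (Dt u) x - fst x * m\<bar> \<le> C * (norm x)\<^sup>2"
    using second_order_bound[OF smooth_Dt[OF smooth_Dt[OF smooth_u]]] by (auto simp: utt grad_utt m_def)
  \<comment> \<open>With \<open>K * (norm x)\<^sup>2 \<le> 3 * t\<close>, the constant
    \<open>m / 96\<close> makes the error after multiplication by \<open>4 * K\<close> at most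
    \<open>m * t / 8\<close>, half of the lower bound \<open>m * t / 4\<close> for
    \<open>Dt (Dt u)\<close>.\<close>
  obtain d2 where d2: "d2 > 0" "\<And>x. norm x < d2 \<Longrightarrow> x \<in> closure Cyl \<Longrightarrow>
      snd x \<bullet> grad_y (Dt u) x \<le> 2 * Dt u x + m / 96 * (norm x)\<^sup>2"
    using euler_inequality[OF smooth_Dt[OF smooth_u] ut utt Dt_u_origin(1)[OF ut] grad_utt, of "m / 96"] uttt m
    by (auto simp: less_imp_le)
  \<comment> \<open>This \<open>K\<close> gives \<open>C * (norm y)\<^sup>2 \<le> m * t / 8\<close>,
    and the bound \<open>m / (8 * C)\<close> in \<open>\<delta>\<close> gives the same for
    \<open>C * \<tau>\<^sup>2\<close>. Since \<open>m * \<tau> \<ge> m * t / 2\<close>, there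
    remains \<open>m * t / 4\<close>.\<close>
  define K where "K = 16 * C / m + 1"
  have K: "K \<ge> 1" "2 * C / K \<le> m / 8"
    using C m by (simp_all add: K_def field_simps)
  define d where "d = min 1 (min d1 d2)"
  have d: "d > 0" "d \<le> 1" "d \<le> d1" "d \<le> d2" using d1(1) d2(1) by (auto simp: d_def)
  have d': "d\<^sup>2 \<le> 1" using d by (simp add: power_le_one)
  define \<delta> where "\<delta> = min (1 / K) (min (m / (8 * C)) (d\<^sup>2 / 4))"
  have \<delta>: "\<delta> > 0" "\<delta> \<le> 1 / K" "C * \<delta> \<le> m / 8" "\<delta> \<le> d\<^sup>2 / 4"
  proof -
    show "\<delta> > 0" "\<delta> \<le> 1 / K" "\<delta> \<le> d\<^sup>2 / 4" using K m C d by (auto simp: \<delta>_def)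
    have "C * \<delta> \<le> C * (m / (8 * C))" using C by (intro mult_left_mono) (auto simp: \<delta>_def)
    then show "C * \<delta> \<le> m / 8" using C by simp
  qed
  show ?thesis
  proof (rule hopf_origin[OF strict, of K "(real CARD('n) + 5) * K" \<delta>])
    show "K > 0" "K \<le> (real CARD('n) + 5) * K" using K by (simp_all add: algebra_simps)
    fix t \<tau> :: real and y :: "real ^ 'n"
    assume t: "0 < t" "t \<le> \<delta>" "K * (norm y)\<^sup>2 \<le> 2 * t" and \<tau>: "t / 2 \<le> \<tau>" "\<tau> \<le> t"
    have sq: "(norm (\<tau>, y))\<^sup>2 = \<tau>\<^sup>2 + (norm y)\<^sup>2" by (simp add: norm_Pair)
    have y2: "(norm y)\<^sup>2 \<le> 2 * t / K" using t(3) K by (simp add: field_simps)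
    have t2: "\<tau>\<^sup>2 \<le> t * \<delta>" using mult_mono[of \<tau> t \<tau> \<delta>] t \<tau> by (simp add: power2_eq_square)
    have n2: "(norm (\<tau>, y))\<^sup>2 \<le> t * \<delta> + 2 * t / K" using sq y2 t2 by simp
    have "t * \<delta> \<le> t * (1 / K)" using t \<delta> by (intro mult_left_mono) auto
    then have n3: "(norm (\<tau>, y))\<^sup>2 \<le> 3 * t / K" using n2 by simp
    have "3 * t / K \<le> 3 * t" using K t by (simp add: field_simps)
    moreover have "0 < d\<^sup>2" using d(1) by simp
    ultimately have "(norm (\<tau>, y))\<^sup>2 < d\<^sup>2" using n3 t(2) \<delta>(4) by linarith
    then have n: "norm (\<tau>, y) < d" by (rule power2_less_imp_less) (use d(1) in simp)
    have "norm y \<le> 1" "\<tau> \<le> 1"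
      using n d(2) norm_snd_le[of y \<tau>] norm_fst_le[of \<tau> y] by auto
    then have mem: "(\<tau>, y) \<in> closure Cyl" using t \<tau> by (simp add: mem_closure_Cyl)
    have "C * (norm (\<tau>, y))\<^sup>2 \<le> C * (t * \<delta> + 2 * t / K)" using n2 C by (intro mult_left_mono) auto
    also have "\<dots> = t * (C * \<delta>) + t * (2 * C / K)" by (simp add: algebra_simps)
    also have "\<dots> \<le> t * (m / 8) + t * (m / 8)" using t \<delta>(3) K(2) by (intro add_mono mult_left_mono) auto
    finally have "C * (norm (\<tau>, y))\<^sup>2 \<le> t * m / 4" by (simp add: mult.commute)
    moreover have "m * (t / 2) \<le> m * \<tau>" using m \<tau> by (intro mult_left_mono) auto
    moreover have "\<bar>Dt (Dt u) (\<tau>, y) - \<tau> * m\<bar> \<le> C * (norm (\<tau>, y))\<^sup>2"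
      using d1(2)[OF _ mem] n d(3) by simp
    ultimately have utt_ge: "m * t / 4 \<le> Dt (Dt u) (\<tau>, y)"
      by (simp add: abs_le_iff algebra_simps)
    have "4 * K * (y \<bullet> grad_y (Dt u) (\<tau>, y)) \<le> 4 * K * (2 * Dt u (\<tau>, y) + m / 96 * (norm (\<tau>, y))\<^sup>2)"
      using d2(2)[OF _ mem] n d(4) K by (intro mult_left_mono) auto
    also have "\<dots> = 8 * K * Dt u (\<tau>, y) + m / 24 * (K * (norm (\<tau>, y))\<^sup>2)" by (simp add: algebra_simps)
    also have "m / 24 * (K * (norm (\<tau>, y))\<^sup>2) \<le> m / 24 * (3 * t)"
      using n3 K m by (intro mult_left_mono) (simp_all add: field_simps)
    finally have 1: "4 * K * (y \<bullet> grad_y (Dt u) (\<tau>, y)) \<le> 8 * K * Dt u (\<tau>, y) + m * t / 8" by simp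
    have 2: "Dt u (\<tau>, y) * (2 * ((real CARD('n) + 5) * K - (real CARD('n) + 1) * K)) = 8 * K * Dt u (\<tau>, y)"
      by (simp add: algebra_simps)
    have 3: "0 < m * t" using m t by simp
    show "0 \<le> Dt (Dt u) (\<tau>, y) \<and>
        0 < Dt u (\<tau>, y) * (2 * ((real CARD('n) + 5) * K - (real CARD('n) + 1) * K))
        + Dt (Dt u) (\<tau>, y) - 4 * K * (y \<bullet> grad_y (Dt u) (\<tau>, y))"
      unfolding 2 using 1 3 utt_ge by argo
  qed (use \<delta>(1) in auto)
qed

section \<open>Contact of second and third order\<close>

text \<open>
  Write \<open>\<eta>\<close> for the Laplacian of \<open>v\<close> at \<open>(s, 0)\<close>. The inequality between the Laplacians forces
  \<open>u\<close> to attain the value \<open>v (s, y)\<close> below the height \<open>(1 + o(1)) \<eta> / c\<close>, uniformly for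
  \<open>norm y \<le> M \<eta>\<close>. Comparing second differences of \<open>u\<close> and \<open>v\<close> in \<open>y\<close> at the scale \<open>M \<eta>\<close> bounds
  the \<open>y\<close>-Laplacian of \<open>v\<close> by \<open>(Q / c + O(1 / M\<^sup>2)) \<eta>\<close>, so the rest of \<open>\<eta>\<close>, which is the second
  \<open>t\<close>-derivative of \<open>v\<close>, is at least \<open>(m / c - O(1 / M\<^sup>2)) \<eta>\<close>.
\<close>

lemma vtt_lower_bound:
  assumes ut: "Dt u (0, 0) = 0" and utt: "Dt (Dt u) (0, 0) = 0"
    and grad_utt: "grad_y (Dt (Dt u)) (0, 0) = 0" and uttt: "Dt (Dt (Dt u)) (0, 0) > 0"
    and vtt: "Dt (Dt v) (0, 0) = 0"
    and e': "0 < e'" "e' < Dt (Dt (Dt u)) (0, 0)"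
  shows "\<exists>d>0. \<forall>s t. 0 < s \<longrightarrow> s < d \<longrightarrow> 0 < t \<longrightarrow> t \<le> s \<longrightarrow> u (t, 0) = v (s, 0) \<longrightarrow>
    (Dt (Dt (Dt u)) (0, 0) - e') * t \<le> Dt (Dt v) (s, 0)"
proof -
  define m where "m = Dt (Dt (Dt u)) (0, 0)"
  define q where "q i = Dt (Dy i (Dy i u)) (0, 0)" for i
  define Q where "Q = (\<Sum>i\<in>UNIV. q i)"
  define c where "c = m + Q"
  let ?n = "real CARD('n)"
  have m: "m > 0" using uttt by (simp add: m_def)
  have q: "q i \<ge> 0" for i using Dt_u_origin(2)[OF ut] by (simp add: q_def)
  then have "Q \<ge> 0" by (simp add: Q_def sum_nonneg)
  with m have c: "c > 0" by (simp add: c_def)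
  have n: "?n > 0" by simp
  \<comment> \<open>In the limit of small \<open>e\<close>, bounding the second difference of
    \<open>v\<close> by that of \<open>u\<close> costs
    \<open>?n * m / (3 * c\<^sup>2 * M\<^sup>2)\<close>, the contribution of
    \<open>2 * u (\<sigma>, 0)\<close>. \<open>M\<close> is fixed first, to push this below
    \<open>e'\<close>.\<close>
  define M where "M = 1 + ?n * m / (c\<^sup>2 * e')"
  have M: "M \<ge> 1" "?n * m / (3 * c\<^sup>2 * M\<^sup>2) < e'"
  proof -
    show "M \<ge> 1" using n m c e' by (simp add: M_def)
    have "?n * m / (c\<^sup>2 * e') < M" by (simp add: M_def)
    then have "?n * m < M * (c\<^sup>2 * e')" using c e' by (simp add: pos_divide_less_eq)
    also have "\<dots> \<le> M\<^sup>2 * (c\<^sup>2 * e')" using \<open>M \<ge> 1\<close> e' by (intro mult_right_mono) (auto simp: power2_eq_square)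
    also have "\<dots> \<le> 3 * (M\<^sup>2 * (c\<^sup>2 * e'))" using e' by simp
    finally show "?n * m / (3 * c\<^sup>2 * M\<^sup>2) < e'"
      using c \<open>M \<ge> 1\<close> by (simp add: pos_divide_less_eq algebra_simps)
  qed
  \<comment> \<open>The levels will lie below \<open>\<sigma> = \<kappa> e * \<eta>\<close>, and
    \<open>\<kappa> e\<close> tends to \<open>1 / c\<close>. \<open>\<Phi> e\<close> is the share of
    \<open>\<eta>\<close> left to the second \<open>t\<close>-derivative of \<open>v\<close>: from
    \<open>1\<close> are taken the linear part of the \<open>y\<close>-Laplacian of \<open>u\<close>
    at height \<open>\<sigma>\<close>, the errors of size \<open>e\<close>, and the cost of
    \<open>2 * u (\<sigma>, 0)\<close>.\<close>
  define \<kappa> where "\<kappa> e = (1 + 2 * (?n + 1) * e * M) / (c - (?n + 1) * e)" for e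
  define \<Phi> where "\<Phi> e = 1 - Q * \<kappa> e - ?n * e * (\<kappa> e + 2 * M) - 2 * ?n * (m / 6 + e) * \<kappa> e ^ 3 / M\<^sup>2" for e
  have e0: "((\<lambda>e. e) \<longlongrightarrow> (0::real)) (at_right 0)" by (rule tendsto_ident_at)
  have "(\<kappa> \<longlongrightarrow> (1 + 2 * (?n + 1) * 0 * M) / (c - (?n + 1) * 0)) (at_right 0)"
    unfolding \<kappa>_def[abs_def] using c by (intro tendsto_intros e0) simp
  then have \<kappa>0: "(\<kappa> \<longlongrightarrow> 1 / c) (at_right 0)" by simp
  \<comment> \<open>It is this product that multiplies \<open>t\<close> in the end, since
    \<open>(c - (?n + 1) * e) * t \<le> \<eta>\<close>.\<close>
  have "((\<lambda>e. \<Phi> e * (c - (?n + 1) * e)) \<longlongrightarrow>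
      (1 - Q * (1 / c) - ?n * 0 * (1 / c + 2 * M) - 2 * ?n * (m / 6 + 0) * (1 / c) ^ 3 / M\<^sup>2) * (c - (?n + 1) * 0)) (at_right 0)"
    unfolding \<Phi>_def using M(1) by (intro tendsto_intros e0 \<kappa>0) simp
  also have "(1 - Q * (1 / c) - ?n * 0 * (1 / c + 2 * M) - 2 * ?n * (m / 6 + 0) * (1 / c) ^ 3 / M\<^sup>2) * (c - (?n + 1) * 0)
      = m - ?n * m / (3 * c\<^sup>2 * M\<^sup>2)"
  proof -
    have "(1 - Q * (1 / c)) * c = m" using c by (simp add: c_def field_simps)
    moreover have "2 * ?n * (m / 6) * (1 / c) ^ 3 / M\<^sup>2 * c = ?n * m / (3 * c\<^sup>2 * M\<^sup>2)"
      using c M(1) by (simp add: field_simps power2_eq_square power3_eq_cube)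
    ultimately show ?thesis by (simp add: left_diff_distrib)
  qed
  finally have lim: "((\<lambda>e. \<Phi> e * (c - (?n + 1) * e)) \<longlongrightarrow> m - ?n * m / (3 * c\<^sup>2 * M\<^sup>2)) (at_right 0)" .
  have ev1: "\<forall>\<^sub>F e in at_right 0. m - e' < \<Phi> e * (c - (?n + 1) * e)"
    by (rule order_tendstoD(1)[OF lim]) (use M(2) in simp)
  have "((\<lambda>e. c - (?n + 1) * e) \<longlongrightarrow> c - (?n + 1) * 0) (at_right 0)" by (intro tendsto_intros e0)
  then have "((\<lambda>e. c - (?n + 1) * e) \<longlongrightarrow> c) (at_right 0)" by simp
  from order_tendstoD(1)[OF this c] have ev2: "\<forall>\<^sub>F e in at_right 0. 0 < c - (?n + 1) * e" .
  have "\<forall>\<^sub>F e in at_right 0. (0::real) < e" by (simp add: eventually_at_right_less)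
  from eventually_happens[OF eventually_conj[OF this eventually_conj[OF ev1 ev2]]]
  obtain e where e: "e > 0" "m - e' < \<Phi> e * (c - (?n + 1) * e)" "0 < c - (?n + 1) * e"
    by auto
  have \<kappa>: "\<kappa> e > 0" using e M(1) n by (simp add: \<kappa>_def add_pos_pos)
  have "0 < \<Phi> e * (c - (?n + 1) * e)" using e(2) e'(2) by (simp add: m_def)
  then have \<Phi>: "\<Phi> e > 0" using e(3) by (simp add: zero_less_mult_iff)
  obtain d1 where d1: "d1 > 0" "\<And>x. norm x < d1 \<Longrightarrow> x \<in> closure Cyl \<Longrightarrow> \<bar>Dt (Dt u) x - fst x * m\<bar> \<le> e * norm x"
    using first_order_expansion[OF smooth_Dt[OF smooth_Dt[OF smooth_u]] e(1)]
    by (auto simp: utt grad_utt m_def)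
  have "\<exists>d>0. \<forall>i x. norm x < d \<longrightarrow> x \<in> closure Cyl \<longrightarrow> \<bar>Dy i (Dy i u) x - fst x * q i\<bar> \<le> e * norm x"
  proof (rule finite_uniform_radius)
    show "\<exists>d>0. \<forall>x. norm x < d \<longrightarrow> x \<in> closure Cyl \<longrightarrow> \<bar>Dy i (Dy i u) x - fst x * q i\<bar> \<le> e * norm x" for i
      using first_order_expansion[OF smooth_Dy[OF smooth_Dy[OF smooth_u]] e(1), of i i]
        grad_y_Dy_Dy_zero[OF smooth_u u_zero] by (simp add: q_def)
  qed
  then obtain d2 where d2: "d2 > 0" "\<And>i x. norm x < d2 \<Longrightarrow> x \<in> closure Cyl \<Longrightarrow>
      \<bar>Dy i (Dy i u) x - fst x * q i\<bar> \<le> e * norm x" by blast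
  \<comment> \<open>By \<open>utt_le_vtt\<close> the difference of the second
    \<open>t\<close>-derivatives is nonnegative on the base and zero at the origin, so their
    \<open>y\<close>-gradients agree there.\<close>
  have "grad_y (Dt (Dt v)) (0, 0) = 0"
  proof -
    have "Dy i (Dt (Dt v)) (0, 0) - Dy i (Dt (Dt u)) (0, 0) = 0" for i
    proof -
      have D: "((\<lambda>r. g (0, r *\<^sub>R axis i 1)) has_real_derivative Dy i g (0, 0)) (at 0)"
        if "smooth g" for g :: "real \<times> (real ^ 'n) \<Rightarrow> real"
        using DERIV_y[OF that, of 0 0 0 "axis i 1"] by (simp add: inner_axis_grad_y)
      have "((\<lambda>r. Dt (Dt v) (0, r *\<^sub>R axis i 1) - Dt (Dt u) (0, r *\<^sub>R axis i 1)) has_real_derivative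
          Dy i (Dt (Dt v)) (0, 0) - Dy i (Dt (Dt u)) (0, 0)) (at 0)"
        by (intro DERIV_diff D smooth_Dt smooth_u smooth_v)
      from DERIV_local_min[OF this zero_less_one] show ?thesis
        using utt_le_vtt by (simp add: utt vtt norm_axis_1)
    qed
    then show ?thesis using grad_utt by (simp add: grad_y_def vec_eq_iff)
  qed
  from increment_y[OF smooth_Dt[OF smooth_Dt[OF smooth_v]] this e(1)]
  obtain d3 where d3: "d3 > 0" "\<And>s y. norm (s, y) < d3 \<Longrightarrow> (s, y) \<in> closure Cyl \<Longrightarrow>
      \<bar>Dt (Dt v) (s, y) - Dt (Dt v) (s, 0)\<bar> \<le> e * norm y" by blast
  have "\<exists>d>0. \<forall>i x. norm x < d \<longrightarrow> x \<in> closure Cyl \<longrightarrow>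
      \<bar>Dy i (Dy i v) x - Dy i (Dy i v) (fst x, 0)\<bar> \<le> e * norm (snd x)"
  proof (rule finite_uniform_radius)
    show "\<exists>d>0. \<forall>x. norm x < d \<longrightarrow> x \<in> closure Cyl \<longrightarrow>
      \<bar>Dy i (Dy i v) x - Dy i (Dy i v) (fst x, 0)\<bar> \<le> e * norm (snd x)" for i
      using increment_y[OF smooth_Dy[OF smooth_Dy[OF smooth_v]] grad_y_Dy_Dy_zero(2)[OF smooth_v v_zero] e(1), of i]
      by simp
  qed
  then obtain d4 where d4: "d4 > 0" "\<And>i x. norm x < d4 \<Longrightarrow> x \<in> closure Cyl \<Longrightarrow>
      \<bar>Dy i (Dy i v) x - Dy i (Dy i v) (fst x, 0)\<bar> \<le> e * norm (snd x)" by blast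
  have "((\<lambda>t. u (t, 0) / t ^ 3) \<longlongrightarrow> (Dt ^^ 3) u (0, 0) / fact 3) (at_right 0)"
    by (rule taylor_limit_t[OF smooth_u]) (auto simp: less_Suc_eq numeral_3_eq_3 u_zero ut utt)
  then have "((\<lambda>t. u (t, 0) / t ^ 3) \<longlongrightarrow> m / 6) (at_right 0)"
    by (simp add: numeral_3_eq_3 m_def)
  from order_tendstoD(2)[OF this, of "m / 6 + e"] e(1)
  have "\<forall>\<^sub>F t in at_right 0. u (t, 0) / t ^ 3 < m / 6 + e" by simp
  then obtain d5 where d5: "d5 > 0" "\<And>t. 0 < t \<Longrightarrow> t < d5 \<Longrightarrow> u (t, 0) / t ^ 3 < m / 6 + e"
    unfolding eventually_at_right_field by blast
  define d where "d = Min {1, d1, d2, d3, d4, d5}"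
  have d: "d > 0" unfolding d_def using d1(1) d2(1) d3(1) d4(1) d5(1) by (subst Min_gr_iff) auto
  have d_le: "d \<le> 1" "d \<le> d1" "d \<le> d2" "d \<le> d3" "d \<le> d4" "d \<le> d5"
    unfolding d_def by (rule Min_le; simp)+
  have mem: "(t, y) \<in> closure Cyl" "norm y < 1" "t < 1" if "0 \<le> t" "norm (t, y) < d" for t and y :: "real ^ 'n"
    using that d_le(1) norm_snd_le[of y t] norm_fst_le[of t y] by (auto simp: mem_closure_Cyl)
  have norm_le: "norm (t, y) \<le> t + norm y" if "0 \<le> t" for t and y :: "real ^ 'n"
    using norm_Pair_le[of t y] that by simp
  have lap_u: "c * t - (?n + 1) * e * (t + norm y) \<le> laplacian u (t, y)"
    if t: "0 \<le> t" "norm (t, y) < d" for t y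
  proof -
    have "e * norm (t, y) \<le> e * (t + norm y)" using norm_le[OF t(1)] e(1) by (intro mult_left_mono) auto
    then have 1: "t * m - e * (t + norm y) \<le> Dt (Dt u) (t, y)"
      and 2: "t * q i - e * (t + norm y) \<le> Dy i (Dy i u) (t, y)" for i
      using d1(2)[of "(t, y)"] d2(2)[of "(t, y)" i] mem[OF t] t(2) d_le by (auto simp: abs_le_iff)
    have "(\<Sum>i\<in>UNIV. t * q i - e * (t + norm y)) \<le> (\<Sum>i\<in>UNIV. Dy i (Dy i u) (t, y))"
      by (intro sum_mono 2)
    then have "t * Q - ?n * (e * (t + norm y)) \<le> (\<Sum>i\<in>UNIV. Dy i (Dy i u) (t, y))"
      by (simp add: sum_subtractf Q_def flip: sum_distrib_left)
    with 1 show ?thesis unfolding laplacian_def c_def by (simp add: algebra_simps)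
  qed
  have lap_v: "laplacian v (s, y) \<le> laplacian v (s, 0) + (?n + 1) * e * norm y"
    if s: "0 \<le> s" "norm (s, y) < d" for s y
  proof -
    have 1: "Dt (Dt v) (s, y) \<le> Dt (Dt v) (s, 0) + e * norm y"
      and 2: "Dy i (Dy i v) (s, y) \<le> Dy i (Dy i v) (s, 0) + e * norm y" for i
      using d3(2)[of s y] d4(2)[of "(s, y)" i] mem[OF s] s(2) d_le by (auto simp: abs_le_iff)
    have "(\<Sum>i\<in>UNIV. Dy i (Dy i v) (s, y)) \<le> (\<Sum>i\<in>UNIV. Dy i (Dy i v) (s, 0) + e * norm y)"
      by (intro sum_mono 2)
    then have "(\<Sum>i\<in>UNIV. Dy i (Dy i v) (s, y)) \<le> (\<Sum>i\<in>UNIV. Dy i (Dy i v) (s, 0)) + ?n * (e * norm y)"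
      by (simp add: sum.distrib)
    with 1 show ?thesis unfolding laplacian_def by (simp add: algebra_simps)
  qed
  have "((\<lambda>s. laplacian v (s, 0)) \<longlongrightarrow> laplacian v (0, 0)) (at_right 0)"
    by (intro tendsto_laplacian smooth_v) simp
  moreover have "laplacian v (0, 0) = 0"
    using grad_y_Dy_Dy_zero(1)[OF smooth_v v_zero, of 0] by (simp add: laplacian_def vtt)
  ultimately have lim0: "((\<lambda>s. laplacian v (s, 0)) \<longlongrightarrow> 0) (at_right 0)" by simp
  \<comment> \<open>This bound on \<open>\<eta>\<close> yields
    \<open>\<rho> + \<sigma> < d / 2\<close>; with \<open>s < d / 2\<close> all points used below
    lie within distance \<open>d\<close> of the origin.\<close>
  have B: "d / (2 * (M + \<kappa> e)) > 0" using d M(1) \<kappa> by simp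
  from order_tendstoD(2)[OF lim0 B]
  obtain d6 where d6: "d6 > 0" "\<And>s. 0 < s \<Longrightarrow> s < d6 \<Longrightarrow> laplacian v (s, 0) < d / (2 * (M + \<kappa> e))"
    unfolding eventually_at_right_field by blast
  have main: "(m - e') * t \<le> Dt (Dt v) (s, 0)"
    if s: "0 < s" "s < d / 2" "s < d6" and t: "0 < t" "t \<le> s" and eq: "u (t, 0) = v (s, 0)" for s t
  proof -
    define \<eta> where "\<eta> = laplacian v (s, 0)"
    have "c * t - (?n + 1) * e * (t + norm (0 :: real ^ 'n)) \<le> laplacian u (t, 0)"
      using s t by (intro lap_u) (auto simp: norm_Pair)
    also have "\<dots> \<le> \<eta>" unfolding \<eta>_def using s t eq d_le(1) by (intro lap_le) auto
    finally have t\<eta>: "(c - (?n + 1) * e) * t \<le> \<eta>" by (simp add: algebra_simps)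
    moreover have "0 < (c - (?n + 1) * e) * t" using e(3) t(1) by simp
    ultimately have \<eta>: "\<eta> > 0" by linarith
    define \<rho> where "\<rho> = M * \<eta>"
    define \<sigma> where "\<sigma> = \<kappa> e * \<eta>"
    have \<rho>: "\<rho> > 0" and \<sigma>: "\<sigma> > 0" using \<eta> M(1) \<kappa> by (simp_all add: \<rho>_def \<sigma>_def)
    have "(M + \<kappa> e) * \<eta> < d / 2"
      using d6(2)[OF s(1,3)] M(1) \<kappa> by (simp add: \<eta>_def field_simps)
    then have \<rho>\<sigma>: "\<rho> + \<sigma> < d / 2" by (simp add: \<rho>_def \<sigma>_def algebra_simps)
    \<comment> \<open>A level \<open>\<tau>\<close> of \<open>v (s, y)\<close> satisfies \<open>(c -
      (?n + 1) * e) * \<tau> \<le> \<eta> + 2 * ((?n + 1) * e * \<rho>)\<close>: the Laplacian of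
      \<open>u\<close> is bounded below at \<open>(\<tau>, y)\<close>, that of \<open>v\<close>
      above at \<open>(s, y)\<close>. As \<open>\<rho>\<close> is a multiple of
      \<open>\<eta>\<close>, so is the bound for \<open>\<tau>\<close>.\<close>
    have level: "v (s, y) \<le> u (\<sigma>, y)" if y: "norm y \<le> \<rho>" for y
    proof -
      have nsy: "norm (s, y) < d" using norm_le[of s y] s y \<rho>\<sigma> \<sigma> by simp
      note msy = mem[OF _ nsy]
      obtain \<tau> where \<tau>: "0 < \<tau>" "\<tau> \<le> s" "u (\<tau>, y) = v (s, y)"
        using level_exists[of s y] s msy by auto
      have n\<tau>: "norm (\<tau>, y) < d" using norm_le[of \<tau> y] \<tau> s y \<rho>\<sigma> \<sigma> by simp
      have "c * \<tau> - (?n + 1) * e * (\<tau> + norm y) \<le> laplacian u (\<tau>, y)"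
        using \<tau> n\<tau> by (intro lap_u) auto
      also have "\<dots> \<le> laplacian v (s, y)" using \<tau> s msy by (intro lap_le) auto
      also have "\<dots> \<le> \<eta> + (?n + 1) * e * norm y" unfolding \<eta>_def using s nsy by (intro lap_v) auto
      finally have "(c - (?n + 1) * e) * \<tau> \<le> \<eta> + 2 * ((?n + 1) * e * norm y)" by (simp add: algebra_simps)
      also have "\<dots> \<le> \<eta> + 2 * ((?n + 1) * e * \<rho>)" using y e(1) by simp
      also have "\<dots> = (1 + 2 * (?n + 1) * e * M) * \<eta>" by (simp add: \<rho>_def algebra_simps)
      finally have "\<tau> \<le> (1 + 2 * (?n + 1) * e * M) * \<eta> / (c - (?n + 1) * e)"
        using e(3) by (simp add: pos_le_divide_eq mult.commute)
      then have "\<tau> \<le> \<sigma>" by (simp add: \<sigma>_def \<kappa>_def)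
      moreover have "\<sigma> < 1" using \<rho>\<sigma> \<rho> d_le(1) by simp
      ultimately show ?thesis using \<tau> msy s by (metis less_imp_le u_mono)
    qed
    have u\<sigma>: "u (\<sigma>, 0) \<le> (m / 6 + e) * \<sigma> ^ 3"
      using d5(2)[OF \<sigma>] \<rho>\<sigma> \<rho> d d_le(6) \<sigma> by (simp add: pos_divide_less_eq less_imp_le)
    have "v (s, 0) > 0" using v_pos[of "(s, 0)"] s d_le(1) by (simp add: mem_Cyl)
    \<comment> \<open>The second difference of \<open>v\<close> at height \<open>s\<close> is at
      most that of \<open>u\<close> at the fixed height \<open>\<sigma>\<close> plus
      \<open>2 * u (\<sigma>, 0)\<close>: the outer values are ordered by \<open>level\<close>, and
      \<open>- 2 * v (s, 0)\<close> is negative.\<close>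
    have key: "\<rho>\<^sup>2 * (Dy i (Dy i v) (s, 0) - e * \<rho>) \<le> 2 * ((m / 6 + e) * \<sigma> ^ 3) + \<rho>\<^sup>2 * (q i * \<sigma> + e * (\<sigma> + \<rho>))" for i
    proof -
      have \<rho>1: "0 \<le> \<rho>" "\<rho> < 1" using \<rho> \<rho>\<sigma> \<sigma> d_le(1) by auto
      have "(- 1) * (v (s, axis i \<rho>) + v (s, axis i (- \<rho>)) - 2 * v (s, 0))
          \<le> (e * \<rho> - Dy i (Dy i v) (s, 0)) * \<rho>\<^sup>2"
      proof (rule second_difference_y_le[OF smooth_v _ _ \<rho>1])
        show "- 1 * Dy i (Dy i v) (s, axis i \<xi>) \<le> e * \<rho> - Dy i (Dy i v) (s, 0)" if "\<bar>\<xi>\<bar> \<le> \<rho>" for \<xi>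
        proof -
          have n: "norm (s, axis i \<xi> :: real ^ 'n) < d"
            using norm_le[of s "axis i \<xi>"] s that \<rho>\<sigma> \<sigma> by (simp add: norm_axis_real)
          have "e * \<bar>\<xi>\<bar> \<le> e * \<rho>" using that e(1) by simp
          then show ?thesis using d4(2)[of "(s, axis i \<xi>)" i] mem(1)[OF _ n] n s d_le(5)
            by (simp add: norm_axis_real abs_le_iff)
        qed
      qed (use s d_le(1) in auto)
      moreover have "1 * (u (\<sigma>, axis i \<rho>) + u (\<sigma>, axis i (- \<rho>)) - 2 * u (\<sigma>, 0))
          \<le> (q i * \<sigma> + e * (\<sigma> + \<rho>)) * \<rho>\<^sup>2"
      proof (rule second_difference_y_le[OF smooth_u _ _ \<rho>1])
        show "1 * Dy i (Dy i u) (\<sigma>, axis i \<xi>) \<le> q i * \<sigma> + e * (\<sigma> + \<rho>)" if "\<bar>\<xi>\<bar> \<le> \<rho>" for \<xi>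
        proof -
          have "norm (\<sigma>, axis i \<xi> :: real ^ 'n) \<le> \<sigma> + \<rho>"
            using norm_le[of \<sigma> "axis i \<xi>"] \<sigma> that by (simp add: norm_axis_real)
          then have "e * norm (\<sigma>, axis i \<xi> :: real ^ 'n) \<le> e * (\<sigma> + \<rho>)" and n: "norm (\<sigma>, axis i \<xi> :: real ^ 'n) < d"
            using e(1) \<rho>\<sigma> d by (auto intro: mult_left_mono)
          then show ?thesis using d2(2)[of "(\<sigma>, axis i \<xi>)" i] mem(1)[OF _ n] \<sigma> d_le(3)
            by (simp add: abs_le_iff mult.commute)
        qed
      qed (use \<sigma> \<rho> \<rho>\<sigma> d_le(1) in auto)
      moreover have "v (s, axis i \<rho>) \<le> u (\<sigma>, axis i \<rho>)" "v (s, axis i (- \<rho>)) \<le> u (\<sigma>, axis i (- \<rho>))"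
        using \<rho> by (auto intro!: level simp: norm_axis_real)
      ultimately show ?thesis using u\<sigma> \<open>v (s, 0) > 0\<close> by (simp add: algebra_simps)
    qed
    have "(\<Sum>i\<in>UNIV. \<rho>\<^sup>2 * (Dy i (Dy i v) (s, 0) - e * \<rho>))
        \<le> (\<Sum>i\<in>UNIV. 2 * ((m / 6 + e) * \<sigma> ^ 3) + \<rho>\<^sup>2 * (q i * \<sigma> + e * (\<sigma> + \<rho>)))"
      by (intro sum_mono key)
    moreover have "(\<Sum>i\<in>UNIV. \<rho>\<^sup>2 * (Dy i (Dy i v) (s, 0) - e * \<rho>))
        = \<rho>\<^sup>2 * ((\<eta> - Dt (Dt v) (s, 0)) - ?n * (e * \<rho>))"
      unfolding \<eta>_def laplacian_def by (simp add: sum_subtractf flip: sum_distrib_left)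
    moreover have "(\<Sum>i\<in>UNIV. 2 * ((m / 6 + e) * \<sigma> ^ 3) + \<rho>\<^sup>2 * (q i * \<sigma> + e * (\<sigma> + \<rho>)))
        = ?n * (2 * ((m / 6 + e) * \<sigma> ^ 3)) + \<rho>\<^sup>2 * (Q * \<sigma> + ?n * (e * (\<sigma> + \<rho>)))"
      unfolding Q_def by (simp add: sum.distrib flip: sum_distrib_left sum_distrib_right)
    ultimately have "\<rho>\<^sup>2 * ((\<eta> - Dt (Dt v) (s, 0)) - ?n * (e * \<rho>))
        \<le> ?n * (2 * ((m / 6 + e) * \<sigma> ^ 3)) + \<rho>\<^sup>2 * (Q * \<sigma> + ?n * (e * (\<sigma> + \<rho>)))" by simp
    then have "(\<eta> - Dt (Dt v) (s, 0)) - ?n * (e * \<rho>)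
        \<le> ?n * (2 * ((m / 6 + e) * \<sigma> ^ 3)) / \<rho>\<^sup>2 + (Q * \<sigma> + ?n * (e * (\<sigma> + \<rho>)))"
      using \<rho> by (simp add: field_simps)
    moreover have "?n * (2 * ((m / 6 + e) * \<sigma> ^ 3)) / \<rho>\<^sup>2 = 2 * ?n * (m / 6 + e) * \<kappa> e ^ 3 / M\<^sup>2 * \<eta>"
      using \<eta> by (simp add: \<rho>_def \<sigma>_def power_mult_distrib power2_eq_square power3_eq_cube)
    moreover have "\<eta> - ?n * (e * \<rho>) - (2 * ?n * (m / 6 + e) * \<kappa> e ^ 3 / M\<^sup>2 * \<eta> + (Q * \<sigma> + ?n * (e * (\<sigma> + \<rho>)))) = \<Phi> e * \<eta>"
      unfolding \<Phi>_def \<rho>_def \<sigma>_def by (simp add: algebra_simps)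
    ultimately have "\<Phi> e * \<eta> \<le> Dt (Dt v) (s, 0)" by linarith
    moreover have "\<Phi> e * ((c - (?n + 1) * e) * t) \<le> \<Phi> e * \<eta>" using t\<eta> \<Phi> by (intro mult_left_mono) auto
    moreover have "(m - e') * t \<le> \<Phi> e * (c - (?n + 1) * e) * t" using e(2) t(1) by (intro mult_right_mono) auto
    ultimately show ?thesis by (simp add: algebra_simps)
  qed
  show ?thesis
    by (rule exI[of _ "min (d / 2) d6"]) (use main d d6(1) in \<open>auto simp: m_def\<close>)
qed

section \<open>Hopf estimate against Laplacian inequality: the contradictions\<close>

lemma no_third_order_contact:
  assumes strict: "\<And>x. x \<in> Cyl \<Longrightarrow> v x < u x"
    and ut: "Dt u (0, 0) = 0" and utt: "Dt (Dt u) (0, 0) = 0"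
    and grad_utt: "grad_y (Dt (Dt u)) (0, 0) = 0" and uttt: "Dt (Dt (Dt u)) (0, 0) > 0"
    and finite_order: "\<exists>i\<ge>1. (Dt ^^ i) v (0, 0) \<noteq> 0"
  shows False
proof -
  define m where "m = Dt (Dt (Dt u)) (0, 0)"
  have m: "m > 0" using uttt by (simp add: m_def)
  have vanish: "(Dt ^^ i) u (0, 0) = 0" if "i < 3" for i
    using that by (auto simp: less_Suc_eq numeral_3_eq_3 u_zero ut utt)
  have u3: "((\<lambda>t. u (t, 0) / t ^ 3) \<longlongrightarrow> m / 6) (at_right 0)"
    using taylor_limit_t[where m = 3, OF smooth_u vanish] by (simp add: numeral_3_eq_3 m_def)
  have u_ratio: "((\<lambda>t. u (t, 0) / t ^ i) \<longlongrightarrow> 0) (at_right 0)" if "i < 3" for i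
    using taylor_limit_t[OF smooth_u vanish, of i] vanish[OF that] that by simp
  define j where "j = (LEAST i. i \<ge> 1 \<and> (Dt ^^ i) v (0, 0) \<noteq> 0)"
  have j: "j \<ge> 1" "(Dt ^^ j) v (0, 0) \<noteq> 0"
    using LeastI_ex[OF finite_order] by (simp_all add: j_def)
  have v_vanish: "(Dt ^^ i) v (0, 0) = 0" if "i < j" for i
    using not_less_Least[of i "\<lambda>i. i \<ge> 1 \<and> (Dt ^^ i) v (0, 0) \<noteq> 0"] that v_zero[of 0]
    by (cases "i = 0") (auto simp: j_def)
  define \<beta> where "\<beta> = (Dt ^^ j) v (0, 0) / fact j"
  have vj: "((\<lambda>t. v (t, 0) / t ^ j) \<longlongrightarrow> \<beta>) (at_right 0)"
    unfolding \<beta>_def by (rule taylor_limit_t[OF smooth_v v_vanish])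
  have "\<beta> \<noteq> 0" using j(2) by (simp add: \<beta>_def)
  \<comment> \<open>As \<open>v \<le> u\<close> and \<open>u\<close> is of order
    \<open>t ^ 3\<close> on the axis, \<open>v\<close> cannot have lower order.\<close>
  then have j3: "j \<ge> 3" using v_ratio_zero[OF u_ratio vj] by force
  have "\<beta> \<ge> 0"
  proof (rule tendsto_lowerbound[OF vj])
    show "\<forall>\<^sub>F t in at_right 0. 0 \<le> v (t, 0) / t ^ j"
      using eventually_right_unit
      by eventually_elim (use v_pos in \<open>auto simp: mem_Cyl less_imp_le\<close>)
  qed simp
  with \<open>\<beta> \<noteq> 0\<close> have \<beta>: "\<beta> > 0" by simp
  have vtt0: "Dt (Dt v) (0, 0) = 0" using v_vanish[of 2] j3 by (simp add: numeral_2_eq_2)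
  obtain \<epsilon> d where \<epsilon>: "0 < \<epsilon>" "\<epsilon> < 1" "d > 0"
    "\<And>s. 0 < s \<Longrightarrow> s < d \<Longrightarrow> v (s, 0) \<le> u ((1 - \<epsilon>) * s, 0)"
    using hopf_origin_order_3[OF strict ut utt grad_utt uttt] by blast
  have "norm (0 :: real ^ 'n) < 1" by simp
  obtain T where T: "\<And>s. 0 < s \<Longrightarrow> s < 1 \<Longrightarrow> 0 < T s \<and> T s \<le> s \<and> u (T s, 0) = v (s, 0)"
    "filterlim T (at_right 0) (at_right 0)"
    using level_function[OF \<open>norm 0 < 1\<close>] by blast
  \<comment> \<open>The common value \<open>u (T s, 0) = v (s, 0)\<close> turns the leading terms of
    \<open>u\<close> and \<open>v\<close> into that of \<open>T s ^ 3\<close>.\<close>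
  have Tj: "((\<lambda>s. T s ^ 3 / s ^ j) \<longlongrightarrow> \<beta> / (m / 6)) (at_right 0)"
  proof (rule Lim_transform_eventually)
    show "((\<lambda>s. (v (s, 0) / s ^ j) / (u (T s, 0) / T s ^ 3)) \<longlongrightarrow> \<beta> / (m / 6)) (at_right 0)"
      using m by (intro tendsto_divide vj filterlim_compose[OF u3 T(2)]) simp
    show "\<forall>\<^sub>F s in at_right 0. (v (s, 0) / s ^ j) / (u (T s, 0) / T s ^ 3) = T s ^ 3 / s ^ j"
      using eventually_right_unit
    proof eventually_elim
      case (elim s)
      have "v (s, 0) > 0" using elim v_pos by (simp add: mem_Cyl)
      then show ?case using T(1)[of s] elim by simp
    qed
  qed
  have vttj: "((\<lambda>t. Dt (Dt v) (t, 0) / t ^ (j - 2)) \<longlongrightarrow> \<beta> * (j * (j - 1))) (at_right 0)"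
  proof -
    have Dj: "(Dt ^^ i) (Dt (Dt v)) = (Dt ^^ (i + 2)) v" for i
      by (simp add: numeral_2_eq_2 funpow_swap1)
    have "((\<lambda>t. Dt (Dt v) (t, 0) / t ^ (j - 2)) \<longlongrightarrow> (Dt ^^ (j - 2)) (Dt (Dt v)) (0, 0) / fact (j - 2)) (at_right 0)"
      by (rule taylor_limit_t[OF smooth_Dt[OF smooth_Dt[OF smooth_v]]]) (auto simp only: Dj intro!: v_vanish)
    also have "(Dt ^^ (j - 2)) (Dt (Dt v)) = (Dt ^^ j) v"
      unfolding Dj using j3 by (subst le_add_diff_inverse2) simp_all
    also have "(Dt ^^ j) v (0, 0) / fact (j - 2) = \<beta> * (j * (j - 1))"
    proof -
      define i where "i = j - 2"
      have "j = Suc (Suc i)" using j3 by (simp add: i_def)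
      then have "fact j = real (j * (j - 1)) * fact (j - 2)" by (simp add: algebra_simps)
      moreover have "real (j * (j - 1)) \<noteq> 0" using j3 by simp
      ultimately show ?thesis unfolding \<beta>_def by (simp only: times_divide_eq_left) simp
    qed
    finally show ?thesis .
  qed
  define \<theta> where "\<theta> = 1 - \<epsilon>"
  have \<theta>: "0 < \<theta>" "\<theta> < 1" using \<epsilon> by (simp_all add: \<theta>_def)
  \<comment> \<open>Taking \<open>\<epsilon> * m\<close> as the loss makes the factor
    \<open>1 - \<epsilon>\<close> the same \<open>\<theta>\<close> as in the Hopf estimate, so that
    the two can be played against each other.\<close>
  have "0 < \<epsilon> * m" "\<epsilon> * m < m" using \<epsilon> m by simp_all
  then obtain d' where d': "d' > 0" "\<And>s t. 0 < s \<Longrightarrow> s < d' \<Longrightarrow> 0 < t \<Longrightarrow> t \<le> s \<Longrightarrow> u (t, 0) = v (s, 0) \<Longrightarrow>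
      (m - \<epsilon> * m) * t \<le> Dt (Dt v) (s, 0)"
    using vtt_lower_bound[OF ut utt grad_utt uttt vtt0, of "\<epsilon> * m"] unfolding m_def by blast
  \<comment> \<open>Cubing produces the ratio \<open>T s ^ 3 / s ^ j\<close>, whose limit is known.
    The surplus power of \<open>s\<close> on the right is
    \<open>3 * (j - 2) - j = 2 * (j - 3)\<close>.\<close>
  have "\<forall>\<^sub>F s in at_right 0. 0 < s \<and> s < d'"
    unfolding eventually_at_right_field using d'(1) by blast
  with eventually_right_unit
  have le: "\<forall>\<^sub>F s in at_right 0. (\<theta> * m) ^ 3 * (T s ^ 3 / s ^ j) \<le> (Dt (Dt v) (s, 0) / s ^ (j - 2)) ^ 3 * s ^ (2 * (j - 3))"
  proof eventually_elim
    case (elim s)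
    then have "(\<theta> * m) * T s \<le> Dt (Dt v) (s, 0)"
      using d'(2)[of s "T s"] T(1)[of s] by (simp add: \<theta>_def algebra_simps)
    moreover have "0 \<le> (\<theta> * m) * T s" using \<theta> m T(1)[of s] elim by simp
    ultimately have "((\<theta> * m) * T s) ^ 3 \<le> Dt (Dt v) (s, 0) ^ 3" by (intro power_mono)
    then have "((\<theta> * m) * T s) ^ 3 / s ^ j \<le> Dt (Dt v) (s, 0) ^ 3 / s ^ j" using elim by (intro divide_right_mono) auto
    moreover have "Dt (Dt v) (s, 0) ^ 3 / s ^ j = (Dt (Dt v) (s, 0) / s ^ (j - 2)) ^ 3 * s ^ (2 * (j - 3))"
    proof -
      have "(j - 2) * 3 = j + 2 * (j - 3)" using j3 by simp
      then have "(s ^ (j - 2)) ^ 3 = s ^ j * s ^ (2 * (j - 3))" by (simp flip: power_mult power_add)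
      then show ?thesis using elim by (simp add: power_divide)
    qed
    ultimately show ?case by (simp add: power_mult_distrib)
  qed
  have lim_l: "((\<lambda>s. (\<theta> * m) ^ 3 * (T s ^ 3 / s ^ j)) \<longlongrightarrow> (\<theta> * m) ^ 3 * (\<beta> / (m / 6))) (at_right 0)"
    by (intro tendsto_intros Tj)
  have lim_r: "((\<lambda>s. (Dt (Dt v) (s, 0) / s ^ (j - 2)) ^ 3 * s ^ (2 * (j - 3))) \<longlongrightarrow>
      (\<beta> * (j * (j - 1))) ^ 3 * 0 ^ (2 * (j - 3))) (at_right 0)"
    by (intro tendsto_intros vttj)
  have ineq: "(\<theta> * m) ^ 3 * (\<beta> / (m / 6)) \<le> (\<beta> * (j * (j - 1))) ^ 3 * 0 ^ (2 * (j - 3))"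
    by (rule tendsto_le[OF _ lim_r lim_l le]) simp
  have pos: "0 < (\<theta> * m) ^ 3 * (\<beta> / (m / 6))" using \<theta> m \<beta> by simp
  \<comment> \<open>The factor \<open>0 ^ (2 * (j - 3))\<close> in the right limit is
    \<open>1\<close> for \<open>j = 3\<close> and \<open>0\<close> for larger \<open>j\<close>,
    while the left limit is positive.\<close>
  have j3': "j = 3"
  proof (rule ccontr)
    assume "j \<noteq> 3"
    with j3 have "(0::real) ^ (2 * (j - 3)) = 0" by simp
    with ineq pos show False by simp
  qed
  have \<beta>_le: "\<beta> \<le> \<theta> ^ 3 * (m / 6)"
    using leading_coefficient_le[OF u3 _ \<epsilon>] vj unfolding j3' \<theta>_def by blast
  \<comment> \<open>The Laplacians give
    \<open>\<theta> ^ 3 * m\<^sup>2 \<le> (6 * \<beta>)\<^sup>2\<close>, the Hopf estimate gives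
    \<open>6 * \<beta> \<le> \<theta> ^ 3 * m\<close>. Combined they say
    \<open>1 \<le> \<theta> ^ 3\<close>.\<close>
  have "(\<theta> * m) ^ 3 * (\<beta> / (m / 6)) \<le> (\<beta> * 6) ^ 3" using ineq by (simp add: j3')
  then have "\<theta> ^ 3 * m\<^sup>2 * \<beta> \<le> 36 * \<beta>\<^sup>2 * \<beta>"
    using m by (simp add: field_simps power2_eq_square power3_eq_cube)
  then have "\<theta> ^ 3 * m\<^sup>2 \<le> (6 * \<beta>)\<^sup>2" using \<beta> by (simp add: power_mult_distrib)
  also have "\<dots> \<le> (\<theta> ^ 3 * m)\<^sup>2" using \<beta>_le \<beta> by (intro power_mono) auto
  also have "\<dots> = \<theta> ^ 3 * (\<theta> ^ 3 * m\<^sup>2)" by (simp add: power2_eq_square)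
  finally have "1 * (\<theta> ^ 3 * m\<^sup>2) \<le> \<theta> ^ 3 * (\<theta> ^ 3 * m\<^sup>2)" by simp
  then have "1 \<le> \<theta> ^ 3" using \<theta> m by (subst (asm) mult_le_cancel_right) auto
  moreover have "\<theta> ^ 3 < 1" using \<theta> by (intro power_less_one_iff[THEN iffD2]) auto
  ultimately show False by simp
qed

text \<open>The leading coefficients are halves of the second \<open>t\<close>-derivatives, so the
  Hopf factor \<open>(1 - \<epsilon>)\<^sup>2\<close> contradicts \<open>utt_le_vtt\<close> at the
  origin directly.\<close>

lemma no_second_order_contact:
  assumes strict: "\<And>x. x \<in> Cyl \<Longrightarrow> v x < u x"
    and ut: "Dt u (0, 0) = 0" and utt: "Dt (Dt u) (0, 0) > 0"
  shows False
proof -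
  have zero: "(Dt ^^ i) u (0, 0) = 0" if "i < 2" for i
    using that by (auto simp: less_Suc_eq numeral_2_eq_2 u_zero ut)
  have v0: "(Dt ^^ i) v (0, 0) = 0" if "i < 2" for i
  proof (cases "i = 0")
    case False
    with that have "i = 1" by simp
    have "((\<lambda>t. u (t, 0) / t ^ 1) \<longlongrightarrow> 0) (at_right 0)"
      using taylor_limit_t[OF smooth_u zero, of 1] ut by simp
    moreover have "((\<lambda>t. v (t, 0) / t ^ 1) \<longlongrightarrow> (Dt ^^ 1) v (0, 0) / fact 1) (at_right 0)"
      by (rule taylor_limit_t[OF smooth_v]) (simp add: v_zero)
    ultimately have "(Dt ^^ 1) v (0, 0) / fact 1 = 0" by (rule v_ratio_zero)
    then show ?thesis using \<open>i = 1\<close> by simp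
  qed (simp add: v_zero)
  have u2: "((\<lambda>t. u (t, 0) / t ^ 2) \<longlongrightarrow> Dt (Dt u) (0, 0) / 2) (at_right 0)"
    using taylor_limit_t[where m = 2, OF smooth_u zero] by (simp add: numeral_2_eq_2)
  have v2: "((\<lambda>t. v (t, 0) / t ^ 2) \<longlongrightarrow> Dt (Dt v) (0, 0) / 2) (at_right 0)"
    using taylor_limit_t[where m = 2, OF smooth_v v0] by (simp add: numeral_2_eq_2)
  obtain \<epsilon> d where \<epsilon>: "0 < \<epsilon>" "\<epsilon> < 1" "d > 0"
    "\<And>s. 0 < s \<Longrightarrow> s < d \<Longrightarrow> v (s, 0) \<le> u ((1 - \<epsilon>) * s, 0)"
    using hopf_origin_order_2[OF strict utt] by blast
  have "Dt (Dt v) (0, 0) / 2 \<le> (1 - \<epsilon>)\<^sup>2 * (Dt (Dt u) (0, 0) / 2)"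
    by (rule leading_coefficient_le[OF u2 v2 \<epsilon>])
  also have "\<dots> < 1 * (Dt (Dt u) (0, 0) / 2)"
    using utt \<epsilon> by (intro mult_strict_right_mono) (auto simp: power_less_one_iff)
  finally show False using utt_le_vtt[of 0] by simp
qed

end

theorem theorem2:
  fixes u v :: "real \<times> (real ^ 'n) \<Rightarrow> real" and k :: nat
  assumes smooth_u: "smooth_on_set (closure Cyl) u"
    and smooth_v: "smooth_on_set (closure Cyl) v"
    and u_ge_v: "\<And>x. x \<in> Cyl \<Longrightarrow> u x \<ge> v x"
    and u_pos: "\<And>x. x \<in> Cyl \<Longrightarrow> u x > 0"
    and v_pos: "\<And>x. x \<in> Cyl \<Longrightarrow> v x > 0"
    and ut_pos: "\<And>x. x \<in> Cyl \<Longrightarrow> Dt u x > 0"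
    and u_zero: "\<And>y. norm y < 1 \<Longrightarrow> u (0, y) = 0"
    and lap_le: "\<And>t s y. 0 < t \<Longrightarrow> t \<le> s \<Longrightarrow> s < 1 \<Longrightarrow> norm y < 1 \<Longrightarrow> u (t, y) = v (s, y)
                   \<Longrightarrow> laplacian u (t, y) \<le> laplacian v (s, y)"
    and ut_zero: "Dt u (0, 0) = 0"
    and u_finite_order: "\<exists>i\<ge>1. (Dt ^^ i) u (0, 0) \<noteq> 0"
    and v_finite_order: "\<exists>i\<ge>1. (Dt ^^ i) v (0, 0) \<noteq> 0"
    and grad_utt_zero: "grad_y (Dt (Dt u)) (0, 0) = 0"
    and k_def: "k = (LEAST i. i \<ge> 1 \<and> (Dt ^^ i) u (0, 0) \<noteq> 0)"
    and k_cases: "k = 2 \<or> k = 3"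
  shows "\<forall>x\<in>Cyl. u x = v x"
proof (rule ccontr)
  interpret touching u v
    using assms by unfold_locales
  assume "\<not> (\<forall>x\<in>Cyl. u x = v x)"
  then have strict: "v x < u x" if "x \<in> Cyl" for x
    using strong_maximum_principle u_ge_v that by (metis order_le_less)
  have k: "(Dt ^^ k) u (0, 0) \<noteq> 0" using LeastI_ex[OF u_finite_order] by (simp add: k_def)
  have vanish: "(Dt ^^ i) u (0, 0) = 0" if "i < k" for i
    using not_less_Least[of i "\<lambda>i. i \<ge> 1 \<and> (Dt ^^ i) u (0, 0) \<noteq> 0"] that u_zero[of 0]
    by (cases "i = 0") (auto simp: k_def)
  \<comment> \<open>Positivity of \<open>u\<close> fixes the sign of its first nonvanishing
    \<open>t\<close>-derivative, which both contact lemmas need to be positive.\<close>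
  have "0 \<le> (Dt ^^ k) u (0, 0) / fact k"
  proof (rule tendsto_lowerbound[OF taylor_limit_t[OF smooth_u vanish]])
    show "\<forall>\<^sub>F t in at_right 0. 0 \<le> u (t, 0) / t ^ k"
      using eventually_right_unit
      by eventually_elim (use u_pos in \<open>auto simp: mem_Cyl less_imp_le\<close>)
  qed simp_all
  with k have pos: "(Dt ^^ k) u (0, 0) > 0"
    by (smt (verit) divide_neg_pos fact_gt_zero)
  from k_cases show False
  proof
    assume "k = 2"
    with pos have "Dt (Dt u) (0, 0) > 0" by (simp add: numeral_2_eq_2)
    with strict ut_zero show False by (rule no_second_order_contact)
  next
    assume "k = 3"
    with pos vanish[of 2] have "Dt (Dt (Dt u)) (0, 0) > 0" "Dt (Dt u) (0, 0) = 0"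
      by (simp_all add: numeral_2_eq_2 numeral_3_eq_3)
    then show False
      using no_third_order_contact[OF _ ut_zero _ grad_utt_zero _ v_finite_order] strict by blast
  qed
qed

end
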